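(* Let $n\geqslant 4$ be an integer and let $A$ be a complex abelian variety with a group of automorphisms $G$ isomorphic to $Q(2^n)$. Assume that the analytic representation of $G$ decomposes as $\rho_a\simeq \bigoplus_{j=1}^4 a_j\chi_j\oplus\bigoplus_{s=1}^{2^{n-2}-1}b_s\Theta_s$ with non-negative integers $a_j$, $b_s$. The following statements are equivalent. 1. A group algebra decomposition of $A$ with respect to $G$ is trivial. 2. The dimension of $A_Z$ is zero. 3. The dimension of $A_K$ is zero, for each nontrivial subgroup $K$ of $G$. 4. The integers $a_i$ and $b_s$ equal zero, for all $i$ and for all even $s$. 5. $1$ is not an eigenvalue of $\rho_a(g)$, for each nontrivial $g\in G$.
   Context: $Q(2^n)=\langle x,y : x^{2^{n-1}}=1,\ y^2x^{2^{n-2}}=1,\ yxy^{-1}x=1\rangle$, of order $2^n$; $G$ is identified with it, and $Z=\langle y^2\rangle$. $G$ is a finite group of automorphisms of $A=V/\Lambda$ fixing the origin (so $G$ acts faithfully), with analytic representation $\rho_a:G\to\mathrm{GL}(V)$ and induced homomorphism $\Xi:\mathbb{Q}[G]\to\mathrm{End}(A)\otimes\mathbb{Q}$. For $K\leqslant G$, $A_K=\mathrm{Im}\,\Xi(\sum_{k\in K}k)$. Complex irreducible representations of $Q(2^n)$: $\chi_1: x,y\mapsto 1$; $\chi_2:x\mapsto 1,\,y\mapsto -1$; $\chi_3:x\mapsto -1,\,y\mapsto 1$; $\chi_4:x,y\mapsto -1$; and, with $\omega=\exp(2\pi i/2^{n-1})$, $\Theta_s:x\mapsto \mathrm{diag}(\omega^s,\bar\omega^s),\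 y\mapsto\begin{pmatrix}0&(-1)^s\\1&0\end{pmatrix}$, $1\leqslant s\leqslant 2^{n-2}-1$. Group algebra decomposition: let $W_1,\dots,W_r$ be the rational irreducible representations of $G$, with associated central idempotents $e_1,\dots,e_r$ of $\mathbb{Q}[G]$ (so $1=e_1+\cdots+e_r$). Write each $e_l=f_{l1}+\cdots+f_{ln_l}$ as a sum of orthogonal primitive idempotents, where $n_l=d_l/s_l$ with $d_l$ and $s_l$ the degree and the Schur index of a complex irreducible representation associated to $W_l$. If $B_l$ is the image in $A$ of an integer multiple of one $f_{lk}$ under $\Xi$, then $A\sim B_1^{n_1}\times\cdots\times B_r^{n_r}$ ($\sim$ is isogeny); this is called a group algebra decomposition of $A$ with respect to $G$. It is called trivial if all but one of its factors are zero-dimensional (if one group algebra decomposition is trivial then so is every other one). *)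

theory Defs
  imports
    Complex_Main
    "HOL-Algebra.Generated_Groups"
    "HOL-Algebra.Group_Action"
    "Jordan_Normal_Form.VS_Connect"
    "Jordan_Normal_Form.Char_Poly"
    "Jordan_Normal_Form.Schur_Decomposition"
begin

section \<open>The generalized quaternion group\<close>

text \<open>
  The group presented by these generators and relations has order \<open>2 ^ n\<close>. Hence a group of order
  \<open>2 ^ n\<close> generated by two elements satisfying the relations is (a copy of) the presented group.
\<close>

definition generalized_quaternion :: "nat \<Rightarrow> ('g, 'm) monoid_scheme \<Rightarrow> 'g \<Rightarrow> 'g \<Rightarrow> bool" where
  "generalized_quaternion n G x y \<longleftrightarrow>
     group G \<and> x \<in> carrier G \<and> y \<in> carrier G \<and>
     generate G {x, y} = carrier G \<and> card (carrier G) = 2 ^ n \<and>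
     x [^]\<^bsub>G\<^esub> (2 ^ (n - 1) :: nat) = \<one>\<^bsub>G\<^esub> \<and>
     (y [^]\<^bsub>G\<^esub> (2 :: nat)) \<otimes>\<^bsub>G\<^esub> (x [^]\<^bsub>G\<^esub> (2 ^ (n - 2) :: nat)) = \<one>\<^bsub>G\<^esub> \<and>
     y \<otimes>\<^bsub>G\<^esub> x \<otimes>\<^bsub>G\<^esub> inv\<^bsub>G\<^esub> y \<otimes>\<^bsub>G\<^esub> x = \<one>\<^bsub>G\<^esub>"


section \<open>Matrix representations\<close>

definition matrix_rep :: "('g, 'm) monoid_scheme \<Rightarrow> nat \<Rightarrow> ('g \<Rightarrow> 'a::field mat) \<Rightarrow> bool" where
  "matrix_rep G d \<rho> \<longleftrightarrow>
     (\<forall>g\<in>carrier G. \<rho> g \<in> carrier_mat d d) \<and>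
     \<rho> \<one>\<^bsub>G\<^esub> = 1\<^sub>m d \<and>
     (\<forall>g\<in>carrier G. \<forall>h\<in>carrier G. \<rho> (g \<otimes>\<^bsub>G\<^esub> h) = \<rho> g * \<rho> h)"

definition rep_equiv :: "('g, 'm) monoid_scheme \<Rightarrow> ('g \<Rightarrow> 'a::field mat) \<Rightarrow> ('g \<Rightarrow> 'a mat) \<Rightarrow> bool" where
  "rep_equiv G \<rho> \<sigma> \<longleftrightarrow> (\<exists>P Q. \<forall>g\<in>carrier G. similar_mat_wit (\<rho> g) (\<sigma> g) P Q)"

definition irreducible_rep :: "('g, 'm) monoid_scheme \<Rightarrow> nat \<Rightarrow> ('g \<Rightarrow> 'a::field mat) \<Rightarrow> bool" where
  "irreducible_rep G d \<rho> \<longleftrightarrow>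
     matrix_rep G d \<rho> \<and> d > 0 \<and>
     (\<forall>U. VectorSpace.subspace class_ring U (module_vec TYPE('a) d) \<and>
          (\<forall>g\<in>carrier G. \<forall>u\<in>U. \<rho> g *\<^sub>v u \<in> U)
          \<longrightarrow> U = {0\<^sub>v d} \<or> U = carrier_vec d)"

text \<open>
  A representation is determined by its values on the generators, so on \<open>carrier G\<close> the functions
  \<open>\<chi> j\<close> and \<open>\<Theta> s\<close> are uniquely determined by the following predicate.
\<close>

definition quaternion_irreps ::
  "nat \<Rightarrow> ('g, 'm) monoid_scheme \<Rightarrow> 'g \<Rightarrow> 'g \<Rightarrow> (nat \<Rightarrow> 'g \<Rightarrow> complex mat) \<Rightarrow> (nat \<Rightarrow> 'g \<Rightarrow> complex mat) \<Rightarrow> bool"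
  where
  "quaternion_irreps n G x y \<chi> \<Theta> \<longleftrightarrow>
     (\<forall>j\<in>{1..4}. matrix_rep G 1 (\<chi> j)) \<and>
     \<chi> 1 x = mat_of_rows_list 1 [[1]] \<and> \<chi> 1 y = mat_of_rows_list 1 [[1]] \<and>
     \<chi> 2 x = mat_of_rows_list 1 [[1]] \<and> \<chi> 2 y = mat_of_rows_list 1 [[-1]] \<and>
     \<chi> 3 x = mat_of_rows_list 1 [[-1]] \<and> \<chi> 3 y = mat_of_rows_list 1 [[1]] \<and>
     \<chi> 4 x = mat_of_rows_list 1 [[-1]] \<and> \<chi> 4 y = mat_of_rows_list 1 [[-1]] \<and>
     (\<forall>s\<in>{1..2 ^ (n - 2) - 1}.
        let \<omega> = exp (2 * complex_of_real pi * \<i> / 2 ^ (n - 1)) in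
        matrix_rep G 2 (\<Theta> s) \<and>
        \<Theta> s x = mat_of_rows_list 2 [[\<omega> ^ s, 0], [0, (cnj \<omega>) ^ s]] \<and>
        \<Theta> s y = mat_of_rows_list 2 [[0, (-1) ^ s], [1, 0]])"

text \<open>The direct sum of \<open>a j\<close> copies of each \<open>\<chi> j\<close> and \<open>b s\<close> copies of each \<open>\<Theta> s\<close>.\<close>

definition quaternion_rep_sum ::
  "nat \<Rightarrow> (nat \<Rightarrow> 'g \<Rightarrow> complex mat) \<Rightarrow> (nat \<Rightarrow> 'g \<Rightarrow> complex mat) \<Rightarrow> (nat \<Rightarrow> nat) \<Rightarrow> (nat \<Rightarrow> nat)
    \<Rightarrow> 'g \<Rightarrow> complex mat"
  where
  "quaternion_rep_sum n \<chi> \<Theta> a b g =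
     diag_block_mat
       (concat (map (\<lambda>j. replicate (a j) (\<chi> j g)) [1..<5]) @
        concat (map (\<lambda>s. replicate (b s) (\<Theta> s g)) [1..<2 ^ (n - 2)]))"


section \<open>Complex abelian varieties\<close>

text \<open>\<open>P\<close> is a period matrix: its \<open>2 * d\<close> columns form a real basis of \<open>\<complex>\<^sup>d\<close>.\<close>

definition lattice :: "nat \<Rightarrow> complex vec set \<Rightarrow> bool" where
  "lattice d \<Lambda> \<longleftrightarrow>
     (\<exists>P\<in>carrier_mat d (2 * d).
        (\<forall>c\<in>carrier_vec (2 * d). P *\<^sub>v map_vec complex_of_real c = 0\<^sub>v d \<longrightarrow> c = 0\<^sub>v (2 * d)) \<and>
        \<Lambda> = {P *\<^sub>v map_vec of_int c | c :: int vec. c \<in> carrier_vec (2 * d)})"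

text \<open>
  \<open>H\<close> is the matrix of a positive definite Hermitian form, \<open>(u, v) \<mapsto> (H u) \<bullet>c v\<close>, whose imaginary
  part is integral on the lattice.
\<close>

definition polarization :: "nat \<Rightarrow> complex vec set \<Rightarrow> complex mat \<Rightarrow> bool" where
  "polarization d \<Lambda> H \<longleftrightarrow>
     H \<in> carrier_mat d d \<and> mat_adjoint H = H \<and>
     (\<forall>v\<in>carrier_vec d. v \<noteq> 0\<^sub>v d \<longrightarrow> Re ((H *\<^sub>v v) \<bullet>c v) > 0) \<and>
     (\<forall>u\<in>\<Lambda>. \<forall>v\<in>\<Lambda>. Im ((H *\<^sub>v u) \<bullet>c v) \<in> \<int>)"

definition abelian_variety :: "nat \<Rightarrow> complex vec set \<Rightarrow> bool" where
  "abelian_variety d \<Lambda> \<longleftrightarrow> lattice d \<Lambda> \<and> (\<exists>H. polarization d \<Lambda> H)"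

definition complex_torus :: "nat \<Rightarrow> complex vec set \<Rightarrow> complex vec set monoid" where
  "complex_torus d \<Lambda> = add_monoid (module_vec TYPE(complex) d) Mod \<Lambda>"

definition torus_proj :: "nat \<Rightarrow> complex vec set \<Rightarrow> complex vec \<Rightarrow> complex vec set" where
  "torus_proj d \<Lambda> v = \<Lambda> #>\<^bsub>add_monoid (module_vec TYPE(complex) d)\<^esub> v"

text \<open>
  The \<open>\<phi> g\<close> are the automorphisms of the torus fixing the origin, and \<open>\<rho> g\<close> is the linear map
  that lifts \<open>\<phi> g\<close> to the universal cover.
\<close>

definition analytic_rep ::
  "nat \<Rightarrow> complex vec set \<Rightarrow> ('g, 'm) monoid_scheme \<Rightarrow> ('g \<Rightarrow> complex vec set \<Rightarrow> complex vec set)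
    \<Rightarrow> ('g \<Rightarrow> complex mat) \<Rightarrow> bool"
  where
  "analytic_rep d \<Lambda> G \<phi> \<rho> \<longleftrightarrow>
     matrix_rep G d \<rho> \<and>
     (\<forall>g\<in>carrier G. \<forall>v\<in>carrier_vec d. \<phi> g (torus_proj d \<Lambda> v) = torus_proj d \<Lambda> (\<rho> g *\<^sub>v v))"

text \<open>
  Endomorphisms of the torus fixing the origin are identified with their linear lifts, so
  \<open>End(A) \<otimes> \<rat>\<close> becomes a ring of complex matrices.
\<close>

definition torus_endomorphism :: "nat \<Rightarrow> complex vec set \<Rightarrow> complex mat \<Rightarrow> bool" where
  "torus_endomorphism d \<Lambda> T \<longleftrightarrow> T \<in> carrier_mat d d \<and> (\<forall>v\<in>\<Lambda>. T *\<^sub>v v \<in> \<Lambda>)"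

definition torus_image :: "nat \<Rightarrow> complex vec set \<Rightarrow> complex mat \<Rightarrow> complex vec set set" where
  "torus_image d \<Lambda> T = {torus_proj d \<Lambda> (T *\<^sub>v v) | v. v \<in> carrier_vec d}"

text \<open>
  The tangent space at the origin of a subtorus \<open>B\<close> consists of the \<open>v\<close> whose one-parameter group
  \<open>t \<mapsto> torus_proj d \<Lambda> (t v)\<close> stays in \<open>B\<close>.
\<close>

definition tangent_space :: "nat \<Rightarrow> complex vec set \<Rightarrow> complex vec set set \<Rightarrow> complex vec set" where
  "tangent_space d \<Lambda> B =
     {v \<in> carrier_vec d. \<forall>t::real. torus_proj d \<Lambda> (complex_of_real t \<cdot>\<^sub>v v) \<in> B}"

definition subtorus_dim :: "nat \<Rightarrow> complex vec set \<Rightarrow> complex vec set set \<Rightarrow> nat" where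
  "subtorus_dim d \<Lambda> B =
     vectorspace.dim class_ring (module_vec TYPE(complex) d\<lparr>carrier := tangent_space d \<Lambda> B\<rparr>)"


section \<open>The rational group algebra\<close>

definition group_algebra :: "('g, 'm) monoid_scheme \<Rightarrow> ('g \<Rightarrow> rat) ring" where
  "group_algebra G =
     \<lparr>carrier = {\<alpha>. \<forall>g. g \<notin> carrier G \<longrightarrow> \<alpha> g = 0},
      monoid.mult = (\<lambda>\<alpha> \<beta> g. if g \<in> carrier G
                       then \<Sum>h\<in>carrier G. \<alpha> h * \<beta> (inv\<^bsub>G\<^esub> h \<otimes>\<^bsub>G\<^esub> g) else 0),
      monoid.one = (\<lambda>g. of_bool (g = \<one>\<^bsub>G\<^esub>)),
      ring.zero = (\<lambda>_. 0),
      ring.add = (\<lambda>\<alpha> \<beta> g. \<alpha> g + \<beta> g)\<rparr>"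

definition subgroup_sum :: "'g set \<Rightarrow> 'g \<Rightarrow> rat" where
  "subgroup_sum K = (\<lambda>g. of_bool (g \<in> K))"

text \<open>
  The linear extension of a matrix representation to the group algebra. For the analytic
  representation this is \<open>\<Xi>\<close>.
\<close>

definition algebra_rep ::
  "('g, 'm) monoid_scheme \<Rightarrow> nat \<Rightarrow> ('g \<Rightarrow> 'a::field_char_0 mat) \<Rightarrow> ('g \<Rightarrow> rat) \<Rightarrow> 'a mat" where
  "algebra_rep G d \<rho> \<alpha> = mat d d (\<lambda>(i, j). \<Sum>g\<in>carrier G. of_rat (\<alpha> g) * \<rho> g $$ (i, j))"

text \<open>The group algebra element is a sum over \<open>K\<close>, so \<open>\<Xi>\<close> already sends it to \<open>End(A)\<close>.\<close>

definition fixed_image ::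
  "nat \<Rightarrow> complex vec set \<Rightarrow> ('g, 'm) monoid_scheme \<Rightarrow> ('g \<Rightarrow> complex mat) \<Rightarrow> 'g set
    \<Rightarrow> complex vec set set"
  where
  "fixed_image d \<Lambda> G \<rho> K = torus_image d \<Lambda> (algebra_rep G d \<rho> (subgroup_sum K))"

definition idempotent :: "('r, 'm) ring_scheme \<Rightarrow> 'r \<Rightarrow> bool" where
  "idempotent R e \<longleftrightarrow> e \<in> carrier R \<and> e \<otimes>\<^bsub>R\<^esub> e = e"

definition orthogonal_elements :: "('r, 'm) ring_scheme \<Rightarrow> 'r \<Rightarrow> 'r \<Rightarrow> bool" where
  "orthogonal_elements R e f \<longleftrightarrow> e \<otimes>\<^bsub>R\<^esub> f = \<zero>\<^bsub>R\<^esub> \<and> f \<otimes>\<^bsub>R\<^esub> e = \<zero>\<^bsub>R\<^esub>"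

definition primitive_idempotent :: "('r, 'm) ring_scheme \<Rightarrow> 'r \<Rightarrow> bool" where
  "primitive_idempotent R f \<longleftrightarrow>
     idempotent R f \<and> f \<noteq> \<zero>\<^bsub>R\<^esub> \<and>
     (\<forall>u v. idempotent R u \<and> idempotent R v \<and> orthogonal_elements R u v \<and> f = u \<oplus>\<^bsub>R\<^esub> v
        \<longrightarrow> u = \<zero>\<^bsub>R\<^esub> \<or> v = \<zero>\<^bsub>R\<^esub>)"

definition central_idempotent :: "('r, 'm) ring_scheme \<Rightarrow> 'r \<Rightarrow> bool" where
  "central_idempotent R e \<longleftrightarrow>
     idempotent R e \<and> (\<forall>u\<in>carrier R. e \<otimes>\<^bsub>R\<^esub> u = u \<otimes>\<^bsub>R\<^esub> e)"


section \<open>Group algebra decompositions\<close>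

text \<open>
  Indices start at 1. The fields are the number \<open>r\<close> of rational irreducible representations, the
  representations \<open>W\<^sub>l\<close> with their degrees over \<open>\<rat>\<close>, the idempotents \<open>e\<^sub>l\<close>, the numbers \<open>n\<^sub>l\<close>,
  the primitive idempotents \<open>f\<^sub>l\<^sub>k\<close> and the subvarieties \<open>B\<^sub>l\<close>.
\<close>

record 'g gad =
  irrep_count :: nat
  irrep_deg :: "nat \<Rightarrow> nat"
  irrep :: "nat \<Rightarrow> 'g \<Rightarrow> rat mat"
  central_idem :: "nat \<Rightarrow> 'g \<Rightarrow> rat"
  multiplicity :: "nat \<Rightarrow> nat"
  primitive_idem :: "nat \<Rightarrow> nat \<Rightarrow> 'g \<Rightarrow> rat"
  subvariety :: "nat \<Rightarrow> complex vec set set"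

definition rational_irreps :: "('g, 'm) monoid_scheme \<Rightarrow> 'g gad \<Rightarrow> bool" where
  "rational_irreps G D \<longleftrightarrow>
     (\<forall>l\<in>{1..irrep_count D}. irreducible_rep G (irrep_deg D l) (irrep D l)) \<and>
     (\<forall>l\<in>{1..irrep_count D}. \<forall>m\<in>{1..irrep_count D}.
        rep_equiv G (irrep D l) (irrep D m) \<longrightarrow> l = m) \<and>
     (\<forall>d (W :: 'g \<Rightarrow> rat mat). irreducible_rep G d W
        \<longrightarrow> (\<exists>l\<in>{1..irrep_count D}. rep_equiv G W (irrep D l)))"

text \<open>
  The central idempotent \<open>e\<^sub>l\<close> associated with \<open>W\<^sub>l\<close> is the one acting as the identity on \<open>W\<^sub>l\<close> and
  as zero on the other \<open>W\<^sub>m\<close>. By Wedderburn theory the number of summands in a decomposition of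
  \<open>e\<^sub>l\<close> into orthogonal primitive idempotents does not depend on the decomposition; it is the
  quotient of the degree by the Schur index of a complex irreducible constituent of \<open>W\<^sub>l\<close>.
\<close>

definition group_algebra_idempotents :: "('g, 'm) monoid_scheme \<Rightarrow> 'g gad \<Rightarrow> bool" where
  "group_algebra_idempotents G D \<longleftrightarrow>
     (\<forall>l\<in>{1..irrep_count D}.
        central_idempotent (group_algebra G) (central_idem D l) \<and>
        (\<forall>m\<in>{1..irrep_count D}.
           algebra_rep G (irrep_deg D m) (irrep D m) (central_idem D l) =
             (if m = l then 1\<^sub>m (irrep_deg D m) else 0\<^sub>m (irrep_deg D m) (irrep_deg D m))) \<and>
        (\<forall>k\<in>{1..multiplicity D l}.
           primitive_idempotent (group_algebra G) (primitive_idem D l k)) \<and>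
        (\<forall>j\<in>{1..multiplicity D l}. \<forall>k\<in>{1..multiplicity D l}. j \<noteq> k \<longrightarrow>
           orthogonal_elements (group_algebra G) (primitive_idem D l j) (primitive_idem D l k)) \<and>
        central_idem D l =
          (\<Oplus>\<^bsub>group_algebra G\<^esub>k\<in>{1..multiplicity D l}. primitive_idem D l k))"

definition group_algebra_decomposition ::
  "nat \<Rightarrow> complex vec set \<Rightarrow> ('g, 'm) monoid_scheme \<Rightarrow> ('g \<Rightarrow> complex mat) \<Rightarrow> 'g gad \<Rightarrow> bool" where
  "group_algebra_decomposition d \<Lambda> G \<rho> D \<longleftrightarrow>
     rational_irreps G D \<and> group_algebra_idempotents G D \<and>
     (\<forall>l\<in>{1..irrep_count D}. \<exists>k\<in>{1..multiplicity D l}. \<exists>m::nat. m > 0 \<and>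
        (let T = algebra_rep G d \<rho> (\<lambda>g. of_nat m * primitive_idem D l k g) in
         torus_endomorphism d \<Lambda> T \<and> subvariety D l = torus_image d \<Lambda> T))"

text \<open>The \<open>l\<close>-th factor is the power of \<open>B\<^sub>l\<close> with exponent \<open>n\<^sub>l\<close>.\<close>

definition factor_dim :: "nat \<Rightarrow> complex vec set \<Rightarrow> 'g gad \<Rightarrow> nat \<Rightarrow> nat" where
  "factor_dim d \<Lambda> D l = multiplicity D l * subtorus_dim d \<Lambda> (subvariety D l)"

definition trivial_decomposition :: "nat \<Rightarrow> complex vec set \<Rightarrow> 'g gad \<Rightarrow> bool" where
  "trivial_decomposition d \<Lambda> D \<longleftrightarrow>
     (\<exists>!l. l \<in> {1..irrep_count D} \<and> factor_dim d \<Lambda> D l \<noteq> 0)"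

end

theory Submission
  imports
    Defs
    "HOL-Analysis.Continuum_Not_Denumerable"
    "HOL-Computational_Algebra.Polynomial_Factorial"
    "HOL-Library.Function_Algebras"
    "HOL-Library.Z2"
    "Jordan_Normal_Form.DL_Rank"
begin

text \<open>
  Let \<open>z = y\<^sup>2 = x ^ 2 ^ (n - 2)\<close> be the unique involution of \<open>G\<close>. Every condition is equivalent to
  \<open>\<rho> z = -1\<close>. For conditions 2 to 5 this holds because every nontrivial element has a power equal
  to \<open>z\<close>, and because \<open>z\<close> acts as 1 in every \<open>\<chi>\<^sub>j\<close> and as \<open>(-1) ^ s\<close> in \<open>\<Theta>\<^sub>s\<close>.

  For condition 1, \<open>z\<close> acts as 1 or -1 in every rational irreducible representation. The component
  of \<open>\<rat>[G]\<close> on which it acts as -1 is a division algebra: \<open>\<Theta>\<^sub>1\<close> embeds it into the quaternions,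
  since \<open>1, \<omega>, \<dots>, \<omega> ^ (2 ^ (n - 2) - 1)\<close> are linearly independent over \<open>\<rat>\<close>. So exactly one
  rational irreducible representation has \<open>z\<close> acting as -1. A factor of the decomposition vanishes
  iff \<open>\<rho>\<close> kills the corresponding simple component. If only one factor survives then \<open>\<rho> z\<close> is a
  scalar, and it is not 1 because the action is faithful.
\<close>

section \<open>Rational independence of powers of a root of unity\<close>

text \<open>The idempotents and irreducible representations of a decomposition are given only by
  their properties, so no structure theory of the components is at hand. The main tool is that the
  rational irreducible representations separate the group algebra; its proof replaces semisimplicity
  by positivity: the coefficient of \<open>adjoint \<alpha> \<star> \<alpha>\<close> at the identity
  is a sum of squares. It follows that each W_l is faithful on the component of its e_l, that the
  e_l sum to 1, and that z acts as -1 in some W_l, since otherwise z = 1. Uniqueness of that l is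
  read off idempotents: a division algebra has only the idempotents 0 and 1, so a primitive
  idempotent on which z acts as -1 must be (1 - z)/2. Independence of the powers of \<omega> rests
  on the irreducibility of X^(2^(n-2)) + 1, which is why polynomials modulo 2 come in. Dimension
  zero of a subvariety becomes vanishing of a matrix through the tangent space.\<close>

lemma bit_poly_freshman: "([:1, 1:] :: bit poly) ^ (2 ^ m) = monom 1 (2 ^ m) + 1"
proof (induction m)
  case 0
  show ?case by (simp add: monom_Suc one_pCons)
next
  case (Suc m)
  have "([:1, 1:] :: bit poly) ^ (2 ^ Suc m) = (monom 1 (2 ^ m) + 1) * (monom 1 (2 ^ m) + 1)"
    by (simp add: Suc.IH[symmetric] power_add[symmetric] mult_2)
  also have "\<dots> = monom 1 (2 ^ Suc m) + 1 + (monom 1 (2 ^ m) + monom 1 (2 ^ m))"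
    by (simp only: distrib_left distrib_right mult_1_left mult_1_right mult_monom mult_2 power_Suc add_ac)
  also have "monom (1::bit) (2 ^ m) + monom 1 (2 ^ m) = 0"
    by (simp add: add_monom)
  finally show ?case by simp
qed

text \<open>If \<open>f\<close> misses the root \<open>c\<close>, then \<open>g\<close> has it;
  cancelling X - c lowers the exponent, so by induction all linear factors go into
  \<open>g\<close>.\<close>

lemma dvd_linear_power_degree_0:
  fixes f g :: "'a::field poly"
  assumes "f * g = [:- c, 1:] ^ n" "poly f c \<noteq> 0"
  shows "degree f = 0"
  using assms(1)
proof (induction n arbitrary: g)
  case 0
  thus ?case by (metis dvd_triv_left is_unit_iff_degree dvd_0_left_iff one_neq_zero power_0)
next
  case (Suc n)
  have "poly (f * g) c = 0" by (simp add: Suc.prems)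
  hence "poly g c = 0" using assms(2) by simp
  then obtain h where "g = [:- c, 1:] * h" by (auto simp: poly_eq_0_iff_dvd)
  hence "[:- c, 1:] * (f * h) = [:- c, 1:] * [:- c, 1:] ^ n"
    using Suc.prems by (metis mult.left_commute power_Suc)
  hence "f * h = [:- c, 1:] ^ n" by (simp only: mult_cancel_left) auto
  thus ?case by (rule Suc.IH)
qed

text \<open>
  Modulo 2 the polynomial is a power of \<open>X + 1\<close>, so two factors of positive degree would both take
  even values at 1, whereas the value of the product is 2.
\<close>
lemma irreducible_two_power_cyclotomic:
  "irreducible (monom 1 (2 ^ m) + 1 :: int poly)" (is "irreducible ?M")
proof (rule irreducibleI)
  have deg: "degree ?M = 2 ^ m"
    by (subst degree_add_eq_left) (auto simp: degree_monom_eq)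
  have lead: "lead_coeff ?M = 1"
    unfolding deg by (simp add: coeff_1)
  show "?M \<noteq> 0" by (metis deg degree_0 power_not_zero zero_neq_numeral)
  show "\<not> ?M dvd 1"
    by (metis deg degree_1 dvd_imp_degree_le le_zero_eq one_neq_zero power_not_zero zero_neq_numeral)
  fix f g assume fg: "?M = f * g"
  have "lead_coeff f * lead_coeff g = 1" using lead fg by (simp add: lead_coeff_mult)
  hence units: "\<bar>lead_coeff f\<bar> = 1" "\<bar>lead_coeff g\<bar> = 1"
    using abs_zmult_eq_1[of "lead_coeff f" "lead_coeff g"]
      abs_zmult_eq_1[of "lead_coeff g" "lead_coeff f"] by (simp_all add: mult.commute)
  have unitI: "h dvd 1" if "degree h = 0" "\<bar>lead_coeff h\<bar> = 1" for h :: "int poly"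
  proof -
    from that(1) obtain c where "h = [:c:]" by (rule degree_eq_zeroE)
    thus ?thesis using that(2) by (auto simp: is_unit_const_poly_iff)
  qed
  let ?r = "map_poly (of_int :: int \<Rightarrow> bit)"
  have rfg: "?r f * ?r g = [:- 1, 1:] ^ (2 ^ m)"
  proof -
    have "?r f * ?r g = ?r ?M" by (simp only: fg of_int_poly_hom.hom_mult)
    also have "\<dots> = monom 1 (2 ^ m) + 1"
      by (simp add: of_int_poly_hom.hom_add map_poly_monom)
    also have "\<dots> = [:- 1, 1:] ^ (2 ^ m)"
      by (simp add: bit_poly_freshman)
    finally show ?thesis .
  qed
  \<comment> \<open>The leading coefficient is 1 or -1, hence odd, so no degree is lost modulo
    2.\<close>
  have deg_r: "degree (?r h) = degree h" if "\<bar>lead_coeff h\<bar> = 1" for h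
  proof (rule antisym[OF degree_map_poly_le le_degree])
    have "lead_coeff h = 1 \<or> lead_coeff h = - 1" using that by linarith
    thus "coeff (?r h) (degree h) \<noteq> 0" by (auto simp: coeff_map_poly)
  qed
  have even_at_1: "even (poly h 1)" if "poly (?r h) 1 = 0" for h
  proof -
    have "poly (?r h) (of_int 1) = of_int (poly h 1)" by (rule of_int_hom.poly_map_poly)
    hence "(of_int (poly h 1) :: bit) = 0" using that by simp
    thus ?thesis by (metis even_of_int_iff dvd_0_right)
  qed
  show "f dvd 1 \<or> g dvd 1"
  proof (rule ccontr)
    assume "\<not> (f dvd 1 \<or> g dvd 1)"
    hence "degree f \<noteq> 0" "degree g \<noteq> 0" using unitI[of f] unitI[of g] units by metis+
    hence "degree (?r f) \<noteq> 0" "degree (?r g) \<noteq> 0" using deg_r units by auto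
    moreover have "?r g * ?r f = [:- 1, 1:] ^ (2 ^ m)" using rfg by (simp only: mult.commute)
    ultimately have "poly (?r f) 1 = 0" "poly (?r g) 1 = 0"
      using dvd_linear_power_degree_0[OF rfg] dvd_linear_power_degree_0[of "?r g" "?r f" 1]
      by metis+
    hence "even (poly f 1)" "even (poly g 1)" using even_at_1 by auto
    hence "4 dvd poly f 1 * poly g 1"
      using mult_dvd_mono[of 2 "poly f 1" 2 "poly g 1"] by simp
    moreover have "poly f 1 * poly g 1 = 2"
      using arg_cong[OF fg, of "\<lambda>p. poly p 1"] by (simp add: poly_monom)
    ultimately show False by simp
  qed
qed

text \<open>Minimality of X^(2^m) + 1, obtained inside integer polynomials: a nonzero
  \<open>f\<close> of least degree vanishing at \<omega> divides a constant multiple of this prime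
  polynomial. So the latter divides \<open>f\<close>, whose degree is too small, or the cofactor,
  which would make \<open>f\<close> constant.\<close>

lemma int_poly_root_unity_eq_0:
  fixes \<omega> :: "'a::field_char_0" and p :: "int poly"
  assumes \<omega>: "\<omega> ^ (2 ^ m) = - 1"
    and p: "poly (map_poly of_int p) \<omega> = 0" "degree p < 2 ^ m"
  shows "p = 0"
proof (rule ccontr)
  assume "p \<noteq> 0"
  let ?ev = "\<lambda>p. poly (map_poly of_int p) \<omega>"
  let ?M = "monom 1 (2 ^ m) + 1 :: int poly"
  let ?P = "\<lambda>f :: int poly. f \<noteq> 0 \<and> ?ev f = 0"
  obtain f where f: "?P f" "\<And>g. ?P g \<Longrightarrow> degree f \<le> degree g"
    using ex_has_least_nat[of ?P p degree] \<open>p \<noteq> 0\<close> p(1) by blast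
  have degf: "degree f < 2 ^ m" using f(2)[of p] p \<open>p \<noteq> 0\<close> by simp
  have degf0: "degree f \<noteq> 0"
  proof
    assume "degree f = 0"
    then obtain c where "f = [:c:]" by (rule degree_eq_zeroE)
    thus False using f(1) by (simp add: of_int_hom.map_poly_pCons_hom)
  qed
  have evM: "?ev ?M = 0"
    by (simp add: of_int_poly_hom.hom_add map_poly_monom poly_monom \<omega>)
  have degM: "degree ?M = 2 ^ m"
    by (subst degree_add_eq_left) (auto simp: degree_monom_eq)
  hence M0: "?M \<noteq> 0" by (metis degree_0 power_not_zero zero_neq_numeral)
  \<comment> \<open>Pseudo-division, since \<open>f\<close> need not be monic; the price is a
    nonzero integer factor \<open>c\<close>.\<close>
  obtain q r where qr: "pseudo_divmod ?M f = (q, r)" by force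
  define c where "c = lead_coeff f ^ (Suc (degree ?M) - degree f)"
  have c0: "c \<noteq> 0" using f(1) by (simp add: c_def)
  have eq: "smult c ?M = f * q + r" and r: "r = 0 \<or> degree r < degree f"
    using pseudo_divmod[OF _ qr] f(1) by (auto simp: c_def)
  have "?ev (smult c ?M) = 0" using evM by (simp add: of_int_hom.map_poly_hom_smult)
  hence "?ev r = 0" using f(1) by (simp add: eq of_int_poly_hom.hom_add of_int_poly_hom.hom_mult)
  hence "r = 0" using f(2)[of r] r by fastforce
  hence eq: "smult c ?M = f * q" using eq by simp
  have "prime_elem ?M"
    using irreducible_two_power_cyclotomic by (rule irreducible_imp_prime_elem)
  moreover have "?M dvd f * q" by (metis eq dvd_refl dvd_smult)
  ultimately consider "?M dvd f" | "?M dvd q" by (auto simp: prime_elem_dvd_mult_iff)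
  thus False
  proof cases
    case 1
    hence "2 ^ m \<le> degree f" using f(1) dvd_imp_degree_le degM by metis
    thus False using degf by simp
  next
    case 2
    then obtain q' where "q = ?M * q'" by (elim dvdE)
    hence "?M * [:c:] = ?M * (f * q')" using eq by (simp add: mult_ac)
    hence fq: "[:c:] = f * q'" using M0 by (simp only: mult_cancel_left) blast
    hence "q' \<noteq> 0" using c0 by auto
    hence "degree f + degree q' = 0" using fq f(1) by (metis degree_mult_eq degree_pCons_0)
    thus False using degf0 by simp
  qed
qed

lemma common_denominator:
  fixes c :: "'i \<Rightarrow> rat"
  assumes "finite I"
  obtains D :: int where "D \<noteq> 0" "\<And>i. i \<in> I \<Longrightarrow> of_int D * c i \<in> \<int>"
proof -
  have "\<exists>D::int. D \<noteq> 0 \<and> (\<forall>i\<in>I. of_int D * c i \<in> \<int>)"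
    using assms
  proof induction
    case empty
    show ?case by (rule exI[of _ 1]) auto
  next
    case (insert i I)
    then obtain D :: int where D: "D \<noteq> 0" "\<forall>i\<in>I. of_int D * c i \<in> \<int>" by blast
    obtain a b :: int where ab: "c i = of_int a / of_int b" "b \<noteq> 0"
      by (metis Rat_cases Fract_of_int_quotient of_int_0_less_iff less_irrefl)
    show ?case
    proof (intro exI[of _ "b * D"] conjI ballI)
      show "b * D \<noteq> 0" using D ab by simp
      fix j assume "j \<in> insert i I"
      thus "of_int (b * D) * c j \<in> \<int>"
      proof
        assume "j = i"
        hence "of_int (b * D) * c j = of_int (a * D)" using ab by simp
        thus ?thesis by (simp only: Ints_of_int)
      next
        assume "j \<in> I"
        hence "of_int b * (of_int D * c j) \<in> \<int>" using D by (intro Ints_mult[of "of_int b"]) auto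
        thus ?thesis by (simp only: of_int_mult mult.assoc)
      qed
    qed
  qed
  thus ?thesis using that by blast
qed

text \<open>Clearing denominators gives an integer polynomial of degree below 2^m vanishing at
  \<omega>.\<close>

lemma root_unity_powers_independent:
  fixes \<omega> :: "'a::field_char_0" and c :: "nat \<Rightarrow> rat"
  assumes \<omega>: "\<omega> ^ (2 ^ m) = - 1" and sum: "(\<Sum>i<2 ^ m. of_rat (c i) * \<omega> ^ i) = 0"
    and i: "i < 2 ^ m"
  shows "c i = 0"
proof -
  obtain D :: int where D: "D \<noteq> 0" "\<And>i. i \<in> {..<2 ^ m} \<Longrightarrow> of_int D * c i \<in> \<int>"
    using common_denominator[of "{..<2 ^ m}" c] by auto
  hence "\<forall>i<2 ^ m. \<exists>a. of_int D * c i = of_int a" by (auto elim!: Ints_cases)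
  then obtain a where a: "\<And>i. i < 2 ^ m \<Longrightarrow> of_int D * c i = of_int (a i)" by metis
  define p where "p = (\<Sum>i<2 ^ m. monom (a i) i)"
  have coeff: "coeff p i = (if i < 2 ^ m then a i else 0)" for i
    by (simp add: p_def coeff_sum)
  have "degree p < 2 ^ m"
    by (intro degree_lessI) (auto simp: coeff)
  moreover have "poly (map_poly of_int p) \<omega> = (\<Sum>i<2 ^ m. of_int (a i) * \<omega> ^ i)"
    by (simp add: p_def of_int_poly_hom.hom_sum map_poly_monom poly_sum poly_monom)
  moreover have "\<dots> = (\<Sum>i<2 ^ m. of_int D * (of_rat (c i) * \<omega> ^ i))"
  proof (rule sum.cong[OF refl])
    fix i assume "i \<in> {..<(2::nat) ^ m}"
    hence "of_rat (of_int D * c i) = (of_int (a i) :: 'a)" using a by simp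
    thus "of_int (a i) * \<omega> ^ i = of_int D * (of_rat (c i) * \<omega> ^ i)"
      by (simp add: of_rat_mult mult.assoc[symmetric])
  qed
  moreover have "\<dots> = 0" by (simp add: sum_distrib_left[symmetric] sum)
  ultimately have "p = 0" using int_poly_root_unity_eq_0[OF \<omega>] by simp
  hence "a i = 0" using coeff[of i] i by simp
  thus ?thesis using a[OF i] D(1) by simp
qed

section \<open>The rational group algebra\<close>

text \<open>A vector of \<open>span B\<close> outside \<open>span C\<close> would extend
  \<open>C\<close> to an independent set with more elements than the finite spanning set
  \<open>B\<close>.\<close>

lemma (in vector_space) span_eq_if_card_le:
  assumes "finite B" "independent C" "C \<subseteq> span B" "card B \<le> card C"
  shows "span C = span B"
proof
  show "span C \<subseteq> span B"
    using assms(3) span_minimal subspace_span by blast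
  have finC: "finite C"
    using assms independent_span_bound by blast
  show "span B \<subseteq> span C"
  proof
    fix v assume v: "v \<in> span B"
    show "v \<in> span C"
    proof (rule ccontr)
      assume nv: "v \<notin> span C"
      hence "independent (insert v C)" using assms(2) independent_insertI by blast
      moreover have "insert v C \<subseteq> span B" using v assms(3) by blast
      ultimately have "card (insert v C) \<le> card B"
        using assms(1) independent_span_bound by blast
      moreover have "v \<notin> C" using nv span_base by blast
      ultimately show False using finC assms(4) by simp
    qed
  qed
qed

text \<open>Relative to a finitely spanned subspace, because the ambient space in the application,
  all rational functions on the element type of \<open>G\<close>, may be infinite-dimensional.
  Injectivity carries the basis to an independent set of equal size.\<close>

lemma (in vector_space) injective_endomorphism_surjective:
  assumes lin: "Vector_Spaces.linear scale scale f"
    and B: "finite B" "independent B"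
    and into: "\<And>v. v \<in> span B \<Longrightarrow> f v \<in> span B"
    and inj: "\<And>v. v \<in> span B \<Longrightarrow> f v = 0 \<Longrightarrow> v = 0"
    and w: "w \<in> span B"
  shows "\<exists>v\<in>span B. f v = w"
proof -
  interpret f: Vector_Spaces.linear scale scale f by (rule lin)
  have inj_on: "inj_on f (span B)"
    using f.inj_on_iff_eq_0[OF subspace_span] inj by blast
  have ind: "independent (f ` B)"
    using f.independent_injective_image[OF B(2) inj_on] .
  have "inj_on f B" using inj_on span_superset inj_on_subset by blast
  hence "card (f ` B) = card B" by (rule card_image)
  moreover have "f ` B \<subseteq> span B" using into span_base by auto
  ultimately have "span (f ` B) = span B"
    using span_eq_if_card_le[OF B(1) ind] by simp
  thus ?thesis using w f.span_image by (metis imageE)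
qed

locale finite_group = group G for G :: "('g, 'm) monoid_scheme" (structure) +
  assumes finite_carrier: "finite (carrier G)"
begin

abbreviation QG :: "('g \<Rightarrow> rat) set" where
  "QG \<equiv> carrier (group_algebra G)"

abbreviation conv :: "('g \<Rightarrow> rat) \<Rightarrow> ('g \<Rightarrow> rat) \<Rightarrow> 'g \<Rightarrow> rat" (infixl "\<star>" 70) where
  "\<alpha> \<star> \<beta> \<equiv> \<alpha> \<otimes>\<^bsub>group_algebra G\<^esub> \<beta>"

definition single :: "'g \<Rightarrow> 'g \<Rightarrow> rat" where
  "single g = (\<lambda>h. of_bool (h = g))"

text \<open>The standard anti-involution of the group algebra, the linear extension of inversion.
  The conditional keeps the value zero off the carrier, as membership in \<open>QG\<close>
  requires.\<close>

definition adjoint :: "('g \<Rightarrow> rat) \<Rightarrow> 'g \<Rightarrow> rat" where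
  "adjoint \<alpha> = (\<lambda>g. if g \<in> carrier G then \<alpha> (inv g) else 0)"

lemma QG_iff: "\<alpha> \<in> QG \<longleftrightarrow> (\<forall>g. g \<notin> carrier G \<longrightarrow> \<alpha> g = 0)"
  by (simp add: group_algebra_def)

lemma QG_zero: "\<alpha> \<in> QG \<Longrightarrow> g \<notin> carrier G \<Longrightarrow> \<alpha> g = 0"
  by (simp add: group_algebra_def)

lemma conv_apply:
  "(\<alpha> \<star> \<beta>) g = (if g \<in> carrier G then \<Sum>h\<in>carrier G. \<alpha> h * \<beta> (inv h \<otimes> g) else 0)"
  by (simp add: group_algebra_def)

lemma conv_in_QG [simp]: "\<alpha> \<star> \<beta> \<in> QG"
  by (simp add: QG_iff conv_apply)

lemma single_in_QG [simp]: "g \<in> carrier G \<Longrightarrow> single g \<in> QG"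
  by (auto simp: QG_iff single_def)

text \<open>The ring record is tied to the pointwise operations on functions, so that ordinary sums
  and vector-space notions apply to the group algebra.\<close>

lemma zero_QG: "\<zero>\<^bsub>group_algebra G\<^esub> = 0"
  by (simp add: group_algebra_def zero_fun_def)

lemma add_QG: "\<alpha> \<oplus>\<^bsub>group_algebra G\<^esub> \<beta> = \<alpha> + \<beta>"
  by (simp add: group_algebra_def plus_fun_def)

lemma QG_ext: "\<alpha> \<in> QG \<Longrightarrow> \<beta> \<in> QG \<Longrightarrow> (\<And>g. g \<in> carrier G \<Longrightarrow> \<alpha> g = \<beta> g) \<Longrightarrow> \<alpha> = \<beta>"
  by (metis QG_zero ext)

lemma QG_add [simp]: "\<alpha> \<in> QG \<Longrightarrow> \<beta> \<in> QG \<Longrightarrow> \<alpha> + \<beta> \<in> QG"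
  and QG_diff [simp]: "\<alpha> \<in> QG \<Longrightarrow> \<beta> \<in> QG \<Longrightarrow> \<alpha> - \<beta> \<in> QG"
  and QG_0 [simp]: "0 \<in> QG"
  and QG_scale [simp]: "\<alpha> \<in> QG \<Longrightarrow> (\<lambda>g. c * \<alpha> g) \<in> QG"
  by (auto simp: QG_iff)

lemma reindex_left:
  assumes "a \<in> carrier G"
  shows "(\<Sum>h\<in>carrier G. f (a \<otimes> h)) = (\<Sum>h\<in>carrier G. f h)"
  by (rule sum.reindex_bij_witness[of _ "\<lambda>h. inv a \<otimes> h" "\<lambda>h. a \<otimes> h"])
     (use assms in \<open>auto simp: m_assoc[symmetric]\<close>)

lemma reindex_inv: "(\<Sum>h\<in>carrier G. f (inv h)) = (\<Sum>h\<in>carrier G. f h)"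
  by (rule sum.reindex_bij_witness[of _ "\<lambda>h. inv h" "\<lambda>h. inv h"]) auto

lemma conv_assoc: "(\<alpha> \<star> \<beta>) \<star> \<gamma> = \<alpha> \<star> (\<beta> \<star> \<gamma>)"
proof (rule QG_ext)
  fix g assume g: "g \<in> carrier G"
  have "((\<alpha> \<star> \<beta>) \<star> \<gamma>) g =
    (\<Sum>h\<in>carrier G. \<Sum>k\<in>carrier G. \<alpha> k * (\<beta> (inv k \<otimes> h) * \<gamma> (inv h \<otimes> g)))"
    using g by (simp add: conv_apply sum_distrib_right mult.assoc)
  also have "\<dots> = (\<Sum>k\<in>carrier G. \<alpha> k * (\<Sum>h\<in>carrier G. \<beta> (inv k \<otimes> h) * \<gamma> (inv h \<otimes> g)))"
    by (subst sum.swap) (simp add: sum_distrib_left)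
  also have "\<dots> = (\<Sum>k\<in>carrier G. \<alpha> k * (\<Sum>u\<in>carrier G. \<beta> u * \<gamma> (inv u \<otimes> (inv k \<otimes> g))))"
  proof (rule sum.cong[OF refl])
    fix k assume k: "k \<in> carrier G"
    have "(\<Sum>h\<in>carrier G. \<beta> (inv k \<otimes> h) * \<gamma> (inv h \<otimes> g)) =
      (\<Sum>u\<in>carrier G. \<beta> (inv k \<otimes> (k \<otimes> u)) * \<gamma> (inv (k \<otimes> u) \<otimes> g))"
      by (rule reindex_left[OF k, symmetric])
    also have "\<dots> = (\<Sum>u\<in>carrier G. \<beta> u * \<gamma> (inv u \<otimes> (inv k \<otimes> g)))"
      using k g by (intro sum.cong) (auto simp: m_assoc[symmetric] inv_mult_group)
    finally show "\<alpha> k * (\<Sum>h\<in>carrier G. \<beta> (inv k \<otimes> h) * \<gamma> (inv h \<otimes> g)) =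
      \<alpha> k * (\<Sum>u\<in>carrier G. \<beta> u * \<gamma> (inv u \<otimes> (inv k \<otimes> g)))" by simp
  qed
  also have "\<dots> = (\<alpha> \<star> (\<beta> \<star> \<gamma>)) g"
    using g by (simp add: conv_apply)
  finally show "((\<alpha> \<star> \<beta>) \<star> \<gamma>) g = (\<alpha> \<star> (\<beta> \<star> \<gamma>)) g" .
qed simp_all

lemma conv_add_left: "(\<alpha> + \<beta>) \<star> \<gamma> = \<alpha> \<star> \<gamma> + \<beta> \<star> \<gamma>"
  and conv_add_right: "\<gamma> \<star> (\<alpha> + \<beta>) = \<gamma> \<star> \<alpha> + \<gamma> \<star> \<beta>"
  and conv_diff_right: "\<gamma> \<star> (\<alpha> - \<beta>) = \<gamma> \<star> \<alpha> - \<gamma> \<star> \<beta>"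
  and conv_zero_left [simp]: "0 \<star> \<gamma> = 0"
  and conv_zero_right [simp]: "\<gamma> \<star> 0 = 0"
  and conv_scale_left: "(\<lambda>g. c * \<alpha> g) \<star> \<gamma> = (\<lambda>g. c * (\<alpha> \<star> \<gamma>) g)"
  and conv_scale_right: "\<gamma> \<star> (\<lambda>g. c * \<alpha> g) = (\<lambda>g. c * (\<gamma> \<star> \<alpha>) g)"
  by (auto simp: fun_eq_iff conv_apply algebra_simps sum.distrib sum_subtractf sum_distrib_left)

lemma conv_sum_left: "(\<Sum>i\<in>I. F i) \<star> \<gamma> = (\<Sum>i\<in>I. F i \<star> \<gamma>)"
  by (induction I rule: infinite_finite_induct) (simp_all only: sum.infinite sum.empty sum.insert conv_add_left conv_zero_left not_False_eq_True)

lemma conv_sum_right: "\<gamma> \<star> (\<Sum>i\<in>I. F i) = (\<Sum>i\<in>I. \<gamma> \<star> F i)"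
  by (induction I rule: infinite_finite_induct) (simp_all only: sum.infinite sum.empty sum.insert conv_add_right conv_zero_right not_False_eq_True)

lemma sum_fun_apply: "(\<Sum>i\<in>I. F i) g = (\<Sum>i\<in>I. (F i g :: rat))"
  by (induction I rule: infinite_finite_induct) auto

lemma QG_sum [simp]: "(\<And>i. i \<in> I \<Longrightarrow> F i \<in> QG) \<Longrightarrow> (\<Sum>i\<in>I. F i) \<in> QG"
  by (auto simp: QG_iff sum_fun_apply)

lemma single_conv:
  assumes "g \<in> carrier G"
  shows "(single g \<star> \<beta>) h = (if h \<in> carrier G then \<beta> (inv g \<otimes> h) else 0)"
proof -
  have "(\<Sum>k\<in>carrier G. single g k * \<beta> (inv k \<otimes> h)) =
    (\<Sum>k\<in>carrier G. if k = g then \<beta> (inv k \<otimes> h) else 0)"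
    by (rule sum.cong) (auto simp: single_def)
  thus ?thesis using assms finite_carrier by (simp add: conv_apply)
qed

lemma conv_single:
  assumes "g \<in> carrier G"
  shows "(\<beta> \<star> single g) h = (if h \<in> carrier G then \<beta> (h \<otimes> inv g) else 0)"
proof (cases "h \<in> carrier G")
  case True
  have "(\<Sum>k\<in>carrier G. \<beta> k * single g (inv k \<otimes> h)) =
    (\<Sum>k\<in>carrier G. if k = h \<otimes> inv g then \<beta> k else 0)"
  proof (rule sum.cong[OF refl])
    fix k assume k: "k \<in> carrier G"
    have "inv k \<otimes> h = g \<longleftrightarrow> k = h \<otimes> inv g"
      using k True assms by (metis inv_closed inv_solve_left inv_solve_right m_closed)
    thus "\<beta> k * single g (inv k \<otimes> h) = (if k = h \<otimes> inv g then \<beta> k else 0)"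
      by (simp add: single_def)
  qed
  thus ?thesis using assms finite_carrier True by (simp add: conv_apply)
qed (simp add: conv_apply)

lemma conv_one_left [simp]: "\<alpha> \<in> QG \<Longrightarrow> single \<one> \<star> \<alpha> = \<alpha>"
  and conv_one_right [simp]: "\<alpha> \<in> QG \<Longrightarrow> \<alpha> \<star> single \<one> = \<alpha>"
  by (auto simp: fun_eq_iff single_conv conv_single QG_iff)

lemma single_mult:
  assumes "g \<in> carrier G" "h \<in> carrier G"
  shows "single g \<star> single h = single (g \<otimes> h)"
proof (rule QG_ext)
  fix k assume "k \<in> carrier G"
  thus "(single g \<star> single h) k = single (g \<otimes> h) k"
    using assms by (simp only: single_conv) (auto simp: single_def inv_solve_left')
qed (use assms in auto)

lemma QG_expand:
  assumes "\<alpha> \<in> QG"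
  shows "\<alpha> = (\<Sum>g\<in>carrier G. (\<lambda>h. \<alpha> g * single g h))"
proof
  fix h
  have "(\<Sum>g\<in>carrier G. \<alpha> g * single g h) = (\<Sum>g\<in>carrier G. if g = h then \<alpha> g else 0)"
    by (rule sum.cong) (auto simp: single_def)
  thus "\<alpha> h = (\<Sum>g\<in>carrier G. (\<lambda>h. \<alpha> g * single g h)) h"
    using assms finite_carrier by (simp add: sum_fun_apply QG_iff)
qed

section \<open>The adjoint and its positivity\<close>

lemma adjoint_in_QG [simp]: "adjoint \<alpha> \<in> QG"
  by (simp add: QG_iff adjoint_def)

lemma adjoint_adjoint: "\<alpha> \<in> QG \<Longrightarrow> adjoint (adjoint \<alpha>) = \<alpha>"
  by (auto simp: adjoint_def fun_eq_iff QG_iff)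

lemma adjoint_conv: "adjoint (\<alpha> \<star> \<beta>) = adjoint \<beta> \<star> adjoint \<alpha>"
proof (rule QG_ext)
  fix g assume g: "g \<in> carrier G"
  have "adjoint (\<alpha> \<star> \<beta>) g = (\<Sum>h\<in>carrier G. \<alpha> h * \<beta> (inv h \<otimes> inv g))"
    using g by (simp add: adjoint_def conv_apply)
  also have "\<dots> = (\<Sum>h\<in>carrier G. \<alpha> (inv g \<otimes> h) * \<beta> (inv (inv g \<otimes> h) \<otimes> inv g))"
    using g by (intro reindex_left[symmetric]) auto
  also have "\<dots> = (\<Sum>h\<in>carrier G. adjoint \<beta> h * adjoint \<alpha> (inv h \<otimes> g))"
    using g by (intro sum.cong) (auto simp: adjoint_def inv_mult_group m_assoc)
  finally show "adjoint (\<alpha> \<star> \<beta>) g = (adjoint \<beta> \<star> adjoint \<alpha>) g"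
    using g by (simp add: conv_apply)
qed auto

lemma adjoint_conv_at_one: "(adjoint \<alpha> \<star> \<alpha>) \<one> = (\<Sum>h\<in>carrier G. (\<alpha> h)\<^sup>2)"
proof -
  have "(adjoint \<alpha> \<star> \<alpha>) \<one> = (\<Sum>h\<in>carrier G. (\<alpha> (inv h))\<^sup>2)"
    by (simp add: conv_apply adjoint_def power2_eq_square)
  thus ?thesis by (simp add: reindex_inv[of "\<lambda>h. (\<alpha> h)\<^sup>2"])
qed

text \<open>The coefficient at the identity is a sum of squares of rationals. This definiteness is
  what excludes nilpotent ideals.\<close>

lemma adjoint_conv_eq_0:
  assumes "\<alpha> \<in> QG" "adjoint \<alpha> \<star> \<alpha> = 0"
  shows "\<alpha> = 0"
proof -
  have "(\<Sum>h\<in>carrier G. (\<alpha> h)\<^sup>2) = 0"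
    using assms(2) adjoint_conv_at_one[of \<alpha>] by simp
  hence "\<forall>h\<in>carrier G. \<alpha> h = 0"
    using finite_carrier by (simp add: sum_nonneg_eq_0_iff)
  thus ?thesis using assms(1) by (intro QG_ext) auto
qed

end

section \<open>Matrix representations and Schur's lemma\<close>

lemma subspace_vecI:
  fixes U :: "'a::field vec set"
  assumes "U \<subseteq> carrier_vec d" "0\<^sub>v d \<in> U"
    and "\<And>u v. u \<in> U \<Longrightarrow> v \<in> U \<Longrightarrow> u + v \<in> U" "\<And>c u. u \<in> U \<Longrightarrow> c \<cdot>\<^sub>v u \<in> U"
  shows "VectorSpace.subspace class_ring U (module_vec TYPE('a) d)"
proof -
  interpret vec_space "TYPE('a)" d .
  show ?thesis
    by unfold_locales (use assms in \<open>auto simp: module_vec_simps\<close>)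
qed

lemma subspace_vecD:
  fixes U :: "'a::field vec set"
  assumes "VectorSpace.subspace class_ring U (module_vec TYPE('a) d)"
  shows "U \<subseteq> carrier_vec d" "0\<^sub>v d \<in> U"
    and "\<And>u v. u \<in> U \<Longrightarrow> v \<in> U \<Longrightarrow> u + v \<in> U" "\<And>c u. u \<in> U \<Longrightarrow> c \<cdot>\<^sub>v u \<in> U"
proof -
  interpret S: VectorSpace.subspace class_ring U "module_vec TYPE('a) d" by (rule assms)
  interpret submodule class_ring U "module_vec TYPE('a) d" by (rule S.submod)
  show "U \<subseteq> carrier_vec d" "0\<^sub>v d \<in> U"
    "\<And>u v. u \<in> U \<Longrightarrow> v \<in> U \<Longrightarrow> u + v \<in> U" "\<And>c u. u \<in> U \<Longrightarrow> c \<cdot>\<^sub>v u \<in> U"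
    using subset zero_closed m_closed smult_closed by (auto simp: module_vec_simps)
qed

lemma mat_eqI_mult_vec:
  fixes A B :: "'a::comm_ring_1 mat"
  assumes A: "A \<in> carrier_mat m d" and B: "B \<in> carrier_mat m d"
    and eq: "\<And>v. v \<in> carrier_vec d \<Longrightarrow> A *\<^sub>v v = B *\<^sub>v v"
  shows "A = B"
proof (rule eq_matI)
  fix i j assume ij: "i < dim_row B" "j < dim_col B"
  hence "(A *\<^sub>v unit_vec d j) $ i = (B *\<^sub>v unit_vec d j) $ i" using eq by simp
  thus "A $$ (i,j) = B $$ (i,j)" using A B ij by simp
qed (use A B in auto)

context
  fixes G :: "('g, 'm) monoid_scheme" and d :: nat and W :: "'g \<Rightarrow> 'a::field mat"
  assumes irr: "irreducible_rep G d W"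
begin

lemma irreducible_rep_matrix_rep: "matrix_rep G d W"
  using irr by (simp add: irreducible_rep_def)

text \<open>The kernel of \<open>M\<close> is an invariant subspace, and \<open>v\<close> makes it
  nonzero, so irreducibility makes it everything.\<close>

lemma schur_injective:
  assumes M: "M \<in> carrier_mat d d"
    and comm: "\<And>g. g \<in> carrier G \<Longrightarrow> M * W g = W g * M"
    and v: "v \<in> carrier_vec d" "v \<noteq> 0\<^sub>v d" "M *\<^sub>v v = 0\<^sub>v d"
  shows "M = 0\<^sub>m d d"
proof -
  define U where "U = {v \<in> carrier_vec d. M *\<^sub>v v = 0\<^sub>v d}"
  have W: "W g \<in> carrier_mat d d" if "g \<in> carrier G" for g
    using irreducible_rep_matrix_rep that by (simp add: matrix_rep_def)
  have "VectorSpace.subspace class_ring U (module_vec TYPE('a) d)"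
    by (rule subspace_vecI)
      (use M in \<open>auto simp: U_def mult_add_distrib_mat_vec mult_mat_vec\<close>)
  moreover have "\<forall>g\<in>carrier G. \<forall>u\<in>U. W g *\<^sub>v u \<in> U"
  proof (intro ballI)
    fix g u assume g: "g \<in> carrier G" and u: "u \<in> U"
    have "M *\<^sub>v (W g *\<^sub>v u) = (M * W g) *\<^sub>v u"
      using M W[OF g] u by (intro assoc_mult_mat_vec[symmetric]) (auto simp: U_def)
    also have "\<dots> = W g *\<^sub>v (M *\<^sub>v u)"
      using M W[OF g] u comm[OF g] assoc_mult_mat_vec[of "W g" d d M d u]
      by (auto simp: U_def)
    also have "\<dots> = 0\<^sub>v d" using u W[OF g] by (auto simp: U_def)
    finally show "W g *\<^sub>v u \<in> U" using W[OF g] u by (auto simp: U_def)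
  qed
  ultimately have "U = {0\<^sub>v d} \<or> U = carrier_vec d"
    using irr by (auto simp: irreducible_rep_def)
  moreover have "v \<in> U" using v by (simp add: U_def)
  ultimately have U: "U = carrier_vec d" using v(2) by blast
  show ?thesis
  proof (rule mat_eqI_mult_vec)
    fix v :: "'a vec" assume v: "v \<in> carrier_vec d"
    hence "M *\<^sub>v v = 0\<^sub>v d" using U by (auto simp: U_def)
    also have "0\<^sub>v d = 0\<^sub>m d d *\<^sub>v v" using v by (intro eq_vecI) auto
    finally show "M *\<^sub>v v = 0\<^sub>m d d *\<^sub>v v" .
  qed (use M in auto)
qed

text \<open>No algebraically closed field is at hand, so the eigenvector is built directly: if
  \<open>W z\<close> is not 1, some \<open>W z *\<^sub>v u - u\<close> is a nonzero vector killed by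
  \<open>W z + 1\<^sub>m d\<close>, and Schur's lemma makes that matrix zero.\<close>

lemma schur_central_involution:
  assumes z: "z \<in> carrier G" and zz: "z \<otimes>\<^bsub>G\<^esub> z = \<one>\<^bsub>G\<^esub>"
    and central: "\<And>g. g \<in> carrier G \<Longrightarrow> z \<otimes>\<^bsub>G\<^esub> g = g \<otimes>\<^bsub>G\<^esub> z"
  shows "W z = 1\<^sub>m d \<or> W z = - 1\<^sub>m d"
proof -
  note rep = irreducible_rep_matrix_rep[unfolded matrix_rep_def]
  have W: "W g \<in> carrier_mat d d" if "g \<in> carrier G" for g
    using rep that by auto
  have Wz2: "W z * W z = 1\<^sub>m d" using rep z zz by metis
  define M where "M = W z + 1\<^sub>m d"
  have M: "M \<in> carrier_mat d d" using W[OF z] by (simp add: M_def)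
  have comm: "M * W g = W g * M" if g: "g \<in> carrier G" for g
  proof -
    have "W z * W g = W g * W z" using rep z g central[OF g] by metis
    thus ?thesis using W[OF z] W[OF g]
      by (simp add: M_def add_mult_distrib_mat[of _ d d] mult_add_distrib_mat[of _ d d])
  qed
  show ?thesis
  proof (cases "W z = 1\<^sub>m d")
    case False
    then obtain u where u: "u \<in> carrier_vec d" "W z *\<^sub>v u \<noteq> 1\<^sub>m d *\<^sub>v u"
      using mat_eqI_mult_vec[OF W[OF z] one_carrier_mat] by blast
    define v where "v = W z *\<^sub>v u - u"
    have v: "v \<in> carrier_vec d" using u W[OF z] by (simp add: v_def)
    have "v \<noteq> 0\<^sub>v d"
    proof
      assume "v = 0\<^sub>v d"
      hence eq0: "(W z *\<^sub>v u - u) $ i = 0" if "i < d" for i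
        using that by (simp add: v_def)
      have "W z *\<^sub>v u = u"
        by (rule eq_vecI) (use u W[OF z] eq0 in auto)
      thus False using u by simp
    qed
    moreover have "M *\<^sub>v v = 0\<^sub>v d"
    proof -
      have "W z *\<^sub>v (W z *\<^sub>v u) = u" using Wz2 W[OF z] u(1)
        by (metis assoc_mult_mat_vec one_mult_mat_vec)
      thus ?thesis
        using W[OF z] u(1)
        by (auto simp: M_def v_def add_mult_distrib_mat_vec[of _ d d] mult_minus_distrib_mat_vec[of _ d d])
    qed
    ultimately have "M = 0\<^sub>m d d" using schur_injective[OF M comm v] by blast
    have "W z = - 1\<^sub>m d"
    proof (rule eq_matI)
      fix i j assume "i < dim_row (- 1\<^sub>m d)" "j < dim_col (- 1\<^sub>m d :: 'a mat)"
      moreover from this have "M $$ (i,j) = 0" using \<open>M = 0\<^sub>m d d\<close> by simp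
      ultimately show "W z $$ (i,j) = (- 1\<^sub>m d) $$ (i,j)"
        using W[OF z] by (simp add: M_def eq_neg_iff_add_eq_0)
    qed (use W[OF z] in auto)
    thus ?thesis ..
  qed simp
qed

end

section \<open>Linear extension of a representation to the group algebra\<close>

context finite_group
begin

lemma algebra_rep_carrier [simp]: "algebra_rep G d W \<alpha> \<in> carrier_mat d d"
  by (simp add: algebra_rep_def)

lemma algebra_rep_index:
  "i < d \<Longrightarrow> j < d \<Longrightarrow>
    algebra_rep G d W \<alpha> $$ (i, j) = (\<Sum>g\<in>carrier G. of_rat (\<alpha> g) * W g $$ (i, j))"
  by (simp add: algebra_rep_def)

lemma algebra_rep_dim [simp]:
  "dim_row (algebra_rep G d W \<alpha>) = d" "dim_col (algebra_rep G d W \<alpha>) = d"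
  by (simp_all add: algebra_rep_def)

lemma algebra_rep_add: "algebra_rep G d W (\<alpha> + \<beta>) = algebra_rep G d W \<alpha> + algebra_rep G d W \<beta>"
  by (rule eq_matI) (auto simp: algebra_rep_index of_rat_add algebra_simps sum.distrib)

lemma algebra_rep_diff: "algebra_rep G d W (\<alpha> - \<beta>) = algebra_rep G d W \<alpha> - algebra_rep G d W \<beta>"
  by (rule eq_matI) (auto simp: algebra_rep_index of_rat_diff algebra_simps sum_subtractf)

lemma algebra_rep_zero: "algebra_rep G d W 0 = 0\<^sub>m d d"
  by (rule eq_matI) (auto simp: algebra_rep_index)

lemma algebra_rep_scale: "algebra_rep G d W (\<lambda>g. c * \<alpha> g) = of_rat c \<cdot>\<^sub>m algebra_rep G d W \<alpha>"
  by (rule eq_matI) (auto simp: algebra_rep_index of_rat_mult sum_distrib_left mult.assoc)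

lemma algebra_rep_sum_eq_0:
  assumes "\<And>i. i \<in> I \<Longrightarrow> algebra_rep G d W (F i) = 0\<^sub>m d d"
  shows "algebra_rep G d W (\<Sum>i\<in>I. F i) = 0\<^sub>m d d"
  using assms
  by (induction I rule: infinite_finite_induct)
     (simp_all only: sum.infinite sum.empty sum.insert algebra_rep_zero algebra_rep_add
       not_False_eq_True insert_iff simp_thms right_add_zero_mat zero_carrier_mat)

context
  fixes d :: nat and W :: "'g \<Rightarrow> 'a::field_char_0 mat"
  assumes rep: "matrix_rep G d W"
begin

lemma matrix_rep_carrier: "g \<in> carrier G \<Longrightarrow> W g \<in> carrier_mat d d"
  and matrix_rep_one: "W \<one> = 1\<^sub>m d"
  and matrix_rep_mult: "g \<in> carrier G \<Longrightarrow> h \<in> carrier G \<Longrightarrow> W (g \<otimes> h) = W g * W h"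
  using rep by (auto simp: matrix_rep_def)

lemma algebra_rep_mult_vec:
  assumes "v \<in> carrier_vec d" "i < d"
  shows "(algebra_rep G d W \<alpha> *\<^sub>v v) $ i = (\<Sum>g\<in>carrier G. of_rat (\<alpha> g) * (W g *\<^sub>v v) $ i)"
proof -
  have "(algebra_rep G d W \<alpha> *\<^sub>v v) $ i =
    (\<Sum>j<d. \<Sum>g\<in>carrier G. of_rat (\<alpha> g) * W g $$ (i, j) * v $ j)"
    using assms by (simp add: scalar_prod_def algebra_rep_index sum_distrib_right lessThan_atLeast0)
  also have "\<dots> = (\<Sum>g\<in>carrier G. \<Sum>j<d. of_rat (\<alpha> g) * W g $$ (i, j) * v $ j)"
    by (rule sum.swap)
  also have "\<dots> = (\<Sum>g\<in>carrier G. of_rat (\<alpha> g) * (W g *\<^sub>v v) $ i)"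
  proof (rule sum.cong[OF refl])
    fix g assume "g \<in> carrier G"
    hence "dim_row (W g) = d" "dim_col (W g) = d" using matrix_rep_carrier by auto
    thus "(\<Sum>j<d. of_rat (\<alpha> g) * W g $$ (i, j) * v $ j) = of_rat (\<alpha> g) * (W g *\<^sub>v v) $ i"
      using assms by (simp add: scalar_prod_def sum_distrib_left mult.assoc lessThan_atLeast0)
  qed
  finally show ?thesis .
qed

lemma algebra_rep_single:
  assumes "g \<in> carrier G"
  shows "algebra_rep G d W (single g) = W g"
proof (rule eq_matI)
  fix i j assume ij: "i < dim_row (W g)" "j < dim_col (W g)"
  have "(\<Sum>h\<in>carrier G. of_rat (single g h) * W h $$ (i, j)) =
    (\<Sum>h\<in>carrier G. if h = g then W h $$ (i, j) else 0)"
    by (rule sum.cong) (auto simp: single_def)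
  thus "algebra_rep G d W (single g) $$ (i, j) = W g $$ (i, j)"
    using assms ij matrix_rep_carrier[OF assms] finite_carrier by (simp add: algebra_rep_index)
qed (use matrix_rep_carrier[OF assms] in auto)

lemma algebra_rep_conv:
  "algebra_rep G d W (\<alpha> \<star> \<beta>) = algebra_rep G d W \<alpha> * algebra_rep G d W \<beta>"
proof (rule eq_matI)
  fix i j assume "i < dim_row (algebra_rep G d W \<alpha> * algebra_rep G d W \<beta>)"
    "j < dim_col (algebra_rep G d W \<alpha> * algebra_rep G d W \<beta>)"
  hence ij: "i < d" "j < d" by auto
  have "algebra_rep G d W (\<alpha> \<star> \<beta>) $$ (i, j) =
    (\<Sum>g\<in>carrier G. \<Sum>h\<in>carrier G. of_rat (\<alpha> h) * of_rat (\<beta> (inv h \<otimes> g)) * W g $$ (i, j))"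
    using ij by (simp add: algebra_rep_index conv_apply of_rat_sum of_rat_mult sum_distrib_right)
  also have "\<dots> = (\<Sum>h\<in>carrier G. \<Sum>g\<in>carrier G. of_rat (\<alpha> h) * of_rat (\<beta> (inv h \<otimes> g)) * W g $$ (i, j))"
    by (rule sum.swap)
  \<comment> \<open>Substituting \<open>h \<otimes> g\<close> for \<open>g\<close> separates the two
    coefficients; multiplicativity of \<open>W\<close> then splits the matrix entry.\<close>
  also have "\<dots> = (\<Sum>h\<in>carrier G. \<Sum>g\<in>carrier G. of_rat (\<alpha> h) * of_rat (\<beta> g) * W (h \<otimes> g) $$ (i, j))"
  proof (rule sum.cong[OF refl])
    fix h assume h: "h \<in> carrier G"
    have "(\<Sum>g\<in>carrier G. of_rat (\<alpha> h) * of_rat (\<beta> (inv h \<otimes> g)) * W g $$ (i, j)) =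
      (\<Sum>g\<in>carrier G. of_rat (\<alpha> h) * of_rat (\<beta> (inv h \<otimes> (h \<otimes> g))) * W (h \<otimes> g) $$ (i, j))"
      by (rule reindex_left[OF h, symmetric])
    also have "\<dots> = (\<Sum>g\<in>carrier G. of_rat (\<alpha> h) * of_rat (\<beta> g) * W (h \<otimes> g) $$ (i, j))"
      using h by (intro sum.cong) (auto simp: m_assoc[symmetric])
    finally show "(\<Sum>g\<in>carrier G. of_rat (\<alpha> h) * of_rat (\<beta> (inv h \<otimes> g)) * W g $$ (i, j)) = \<dots>" .
  qed
  also have "\<dots> = (\<Sum>h\<in>carrier G. \<Sum>g\<in>carrier G. \<Sum>k<d.
      of_rat (\<alpha> h) * W h $$ (i, k) * (of_rat (\<beta> g) * W g $$ (k, j)))"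
  proof (intro sum.cong refl)
    fix h g assume hg: "h \<in> carrier G" "g \<in> carrier G"
    show "of_rat (\<alpha> h) * of_rat (\<beta> g) * W (h \<otimes> g) $$ (i, j) =
      (\<Sum>k<d. of_rat (\<alpha> h) * W h $$ (i, k) * (of_rat (\<beta> g) * W g $$ (k, j)))"
      using ij matrix_rep_carrier[OF hg(1)] matrix_rep_carrier[OF hg(2)]
      by (simp add: matrix_rep_mult[OF hg] scalar_prod_def sum_distrib_left lessThan_atLeast0
          algebra_simps)
  qed
  also have "\<dots> = (\<Sum>k<d. (\<Sum>h\<in>carrier G. of_rat (\<alpha> h) * W h $$ (i, k)) *
      (\<Sum>g\<in>carrier G. of_rat (\<beta> g) * W g $$ (k, j)))"
    unfolding sum_product
    by (subst sum.swap[of _ _ "{..<d}"], rule sum.cong[OF refl], rule sum.swap)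
  also have "\<dots> = (algebra_rep G d W \<alpha> * algebra_rep G d W \<beta>) $$ (i, j)"
    using ij by (simp add: scalar_prod_def algebra_rep_index lessThan_atLeast0)
  finally show "algebra_rep G d W (\<alpha> \<star> \<beta>) $$ (i, j) =
    (algebra_rep G d W \<alpha> * algebra_rep G d W \<beta>) $$ (i, j)" .
qed auto

lemma algebra_rep_one: "algebra_rep G d W (single \<one>) = 1\<^sub>m d"
  by (simp add: algebra_rep_single matrix_rep_one)

end

text \<open>Each entry of \<open>W\<close> is a linear combination of entries of \<open>W'\<close>
  with coefficients from \<open>P\<close> and \<open>Q\<close> that do not depend on the group
  element. The degrees agree because similarity at the identity forces equal sizes.\<close>

lemma algebra_rep_similar_eq_0:
  assumes W: "matrix_rep G d W" and W': "matrix_rep G d' W'"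
    and eq: "rep_equiv G W W'" and zero: "algebra_rep G d' W' \<alpha> = 0\<^sub>m d' d'"
  shows "algebra_rep G d W \<alpha> = 0\<^sub>m d d"
proof -
  obtain P Q where PQ: "\<And>g. g \<in> carrier G \<Longrightarrow> similar_mat_wit (W g) (W' g) P Q"
    using eq by (auto simp: rep_equiv_def)
  have dims: "{W g, W' g, P, Q} \<subseteq> carrier_mat d d" and WPQ: "W g = P * W' g * Q"
    if "g \<in> carrier G" for g
    using PQ[OF that] matrix_rep_carrier[OF W that] by (auto simp: similar_mat_wit_def Let_def)
  have [simp]: "d' = d" using dims[of \<one>] matrix_rep_carrier[OF W', of \<one>] by auto
  have P: "P \<in> carrier_mat d d" and Q: "Q \<in> carrier_mat d d" using dims[of \<one>] by auto
  show ?thesis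
  proof (rule eq_matI)
    fix i j assume "i < dim_row (0\<^sub>m d d)" "j < dim_col (0\<^sub>m d d)"
    hence ij: "i < d" "j < d" by auto
    have "algebra_rep G d W \<alpha> $$ (i,j) = (\<Sum>g\<in>carrier G. \<Sum>l<d. \<Sum>k<d.
        of_rat (\<alpha> g) * W' g $$ (l, k) * (P $$ (i, l) * Q $$ (k, j)))"
      unfolding algebra_rep_index[OF ij]
    proof (rule sum.cong[OF refl])
      fix g assume g: "g \<in> carrier G"
      have "W' g \<in> carrier_mat d d" using dims[OF g] by auto
      thus "of_rat (\<alpha> g) * W g $$ (i, j) = (\<Sum>l<d. \<Sum>k<d.
        of_rat (\<alpha> g) * W' g $$ (l, k) * (P $$ (i, l) * Q $$ (k, j)))"
        using ij P Q
        by (simp add: WPQ[OF g] scalar_prod_def sum_distrib_left sum_distrib_right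
            lessThan_atLeast0 mult_ac)
    qed
    also have "\<dots> = (\<Sum>l<d. \<Sum>k<d. \<Sum>g\<in>carrier G.
        of_rat (\<alpha> g) * W' g $$ (l, k) * (P $$ (i, l) * Q $$ (k, j)))"
      by (subst sum.swap, rule sum.cong[OF refl], rule sum.swap)
    also have "\<dots> = (\<Sum>l<d. \<Sum>k<d. algebra_rep G d' W' \<alpha> $$ (l, k) * (P $$ (i, l) * Q $$ (k, j)))"
      by (intro sum.cong refl) (simp add: algebra_rep_index sum_distrib_right)
    also have "\<dots> = 0" using zero by simp
    finally show "algebra_rep G d W \<alpha> $$ (i,j) = 0\<^sub>m d d $$ (i,j)" using ij by simp
  qed auto
qed

end

section \<open>Simple components of the group algebra\<close>

global_interpretation qfun: vector_space "\<lambda>(c::rat) (\<alpha> :: 'g \<Rightarrow> rat) g. c * \<alpha> g"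
  by unfold_locales (auto simp: fun_eq_iff algebra_simps)

section \<open>Minimal left ideals as irreducible representations\<close>

context finite_group
begin

lemma QG_span: "QG \<subseteq> qfun.span (single ` carrier G)"
proof
  fix \<alpha> assume "\<alpha> \<in> QG"
  hence "\<alpha> = (\<Sum>g\<in>carrier G. (\<lambda>h. \<alpha> g * single g h))" by (rule QG_expand)
  also have "\<dots> \<in> qfun.span (single ` carrier G)"
    by (intro qfun.span_sum qfun.span_scale qfun.span_base imageI)
  finally show "\<alpha> \<in> qfun.span (single ` carrier G)" .
qed

lemma finite_basis_of_subspace:
  assumes "qfun.subspace S" "S \<subseteq> QG"
  obtains B where "finite B" "qfun.independent B" "qfun.span B = S" "card B = qfun.dim S"
proof -
  obtain B where B: "B \<subseteq> S" "qfun.independent B" "S \<subseteq> qfun.span B" "card B = qfun.dim S"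
    using qfun.basis_exists by blast
  have "B \<subseteq> qfun.span (single ` carrier G)" using B(1) assms(2) QG_span by blast
  hence "finite B" using qfun.independent_span_bound[OF _ B(2)] finite_carrier by blast
  moreover have "qfun.span B = S"
    using B(1,3) assms(1) qfun.span_minimal by blast
  ultimately show ?thesis using that B by blast
qed

text \<open>Stability under the group elements suffices, since they span the algebra;
  \<open>left_ideal_conv\<close> recovers stability under all of it.\<close>

definition left_ideal :: "('g \<Rightarrow> rat) set \<Rightarrow> bool" where
  "left_ideal L \<longleftrightarrow> qfun.subspace L \<and> L \<subseteq> QG \<and> (\<forall>g\<in>carrier G. \<forall>\<alpha>\<in>L. single g \<star> \<alpha> \<in> L)"

lemma left_ideal_conv:
  assumes L: "left_ideal L" and \<beta>: "\<beta> \<in> QG" and \<alpha>: "\<alpha> \<in> L"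
  shows "\<beta> \<star> \<alpha> \<in> L"
proof -
  have "\<beta> \<star> \<alpha> = (\<Sum>g\<in>carrier G. (\<lambda>h. \<beta> g * (single g \<star> \<alpha>) h))"
    by (subst QG_expand[OF \<beta>]) (simp only: conv_sum_left conv_scale_left)
  also have "\<dots> \<in> L"
    using L \<alpha> by (auto simp: left_ideal_def intro!: qfun.subspace_sum qfun.subspace_scale)
  finally show ?thesis .
qed

text \<open>A nonzero left ideal of least dimension is minimal: a nonzero one inside it has at least
  the same dimension and so fills it.\<close>

lemma minimal_left_ideal_exists:
  assumes "left_ideal L0" "L0 \<noteq> {0}"
  obtains L where "left_ideal L" "L \<subseteq> L0" "L \<noteq> {0}"
    "\<And>L'. left_ideal L' \<Longrightarrow> L' \<subseteq> L \<Longrightarrow> L' \<noteq> {0} \<Longrightarrow> L' = L"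
proof -
  let ?P = "\<lambda>L. left_ideal L \<and> L \<subseteq> L0 \<and> L \<noteq> {0}"
  obtain L where L: "?P L" "\<And>L'. ?P L' \<Longrightarrow> qfun.dim L \<le> qfun.dim L'"
    using ex_has_least_nat[of ?P L0 qfun.dim] assms by auto
  have "L' = L" if L': "left_ideal L'" "L' \<subseteq> L" "L' \<noteq> {0}" for L'
  proof -
    obtain B where B: "finite B" "qfun.independent B" "qfun.span B = L" "card B = qfun.dim L"
      using finite_basis_of_subspace[of L] L(1) unfolding left_ideal_def by blast
    obtain C where C: "finite C" "qfun.independent C" "qfun.span C = L'" "card C = qfun.dim L'"
      using finite_basis_of_subspace[of L'] L'(1) unfolding left_ideal_def by blast
    have "C \<subseteq> qfun.span B" using C(3) B(3) L'(2) qfun.span_superset by blast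
    moreover have "card B \<le> card C" using L L' B C by auto
    ultimately show ?thesis using qfun.span_eq_if_card_le[OF B(1) C(2)] B(3) C(3) by simp
  qed
  thus ?thesis using that L(1) by blast
qed

text \<open>Irreducibility is defined for matrices and subspaces of column vectors, so left
  multiplication on \<open>L\<close> is written in a basis. Invariant subspaces then correspond to
  left ideals inside \<open>L\<close>, and minimality becomes irreducibility.\<close>

lemma minimal_left_ideal_rep:
  assumes L: "left_ideal L" and ne: "L \<noteq> {0}"
    and minimal: "\<And>L'. left_ideal L' \<Longrightarrow> L' \<subseteq> L \<Longrightarrow> L' \<noteq> {0} \<Longrightarrow> L' = L"
  obtains k and W :: "'g \<Rightarrow> rat mat" where "irreducible_rep G k W"
    "\<And>\<alpha> \<beta>. \<alpha> \<in> QG \<Longrightarrow> \<beta> \<in> L \<Longrightarrow> algebra_rep G k W \<alpha> = 0\<^sub>m k k \<Longrightarrow> \<alpha> \<star> \<beta> = 0"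
proof -
  have subL: "qfun.subspace L" and LQG: "L \<subseteq> QG" using L by (auto simp: left_ideal_def)
  obtain B where B: "finite B" "qfun.independent B" "qfun.span B = L"
    using finite_basis_of_subspace[OF subL LQG] by blast
  define k where "k = card B"
  obtain idx where idx: "bij_betw idx B {0..<k}"
    using ex_bij_betw_finite_nat[OF B(1)] k_def by blast
  have idx_less: "idx c < k" if "c \<in> B" for c using idx that by (auto simp: bij_betw_def)
  have reidx: "(\<Sum>c\<in>B. F (idx c)) = (\<Sum>j = 0..<k. F j)" for F :: "nat \<Rightarrow> rat"
    using sum.reindex_bij_betw[OF idx] .
  define b where "b = inv_into B idx"
  have b_idx: "b (idx c) = c" if "c \<in> B" for c
    using idx that by (simp add: b_def bij_betw_def)
  have b_B: "b j \<in> B" if "j < k" for j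
    using idx that unfolding b_def bij_betw_def by (metis atLeastLessThan_iff inv_into_into zero_le)
  have idx_b: "idx (b j) = j" if "j < k" for j
    using idx that unfolding b_def bij_betw_def by (metis atLeastLessThan_iff f_inv_into_f zero_le)
  have BL: "B \<subseteq> L" using B(3) qfun.span_superset by blast
  \<comment> \<open>\<open>lc\<close> sends a coordinate vector to its element of \<open>L\<close>,
    and \<open>crd\<close> inverts it. Both use the numbering \<open>idx\<close> of the basis, with
    inverse \<open>b\<close>.\<close>
  define lc where "lc v = (\<Sum>c\<in>B. (\<lambda>g. v $ idx c * c g))" for v :: "rat vec"
  define crd where "crd \<alpha> = vec k (\<lambda>i. qfun.representation B \<alpha> (b i))" for \<alpha>
  have lc_apply: "lc v g = (\<Sum>c\<in>B. v $ idx c * c g)" for v g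
    by (simp add: lc_def sum_fun_apply)
  have lc_L: "lc v \<in> L" for v
    unfolding lc_def using BL subL by (intro qfun.subspace_sum qfun.subspace_scale) auto
  have lc_crd: "lc (crd \<alpha>) = \<alpha>" if "\<alpha> \<in> L" for \<alpha>
  proof -
    have "lc (crd \<alpha>) = (\<Sum>c\<in>B. (\<lambda>g. qfun.representation B \<alpha> c * c g))"
      unfolding lc_def by (rule sum.cong) (auto simp: crd_def idx_less b_idx)
    also have "\<dots> = \<alpha>"
      by (rule qfun.sum_representation_eq[OF B(2) _ B(1) subset_refl]) (simp add: B(3) that)
    finally show ?thesis .
  qed
  have crd_carrier [simp]: "crd \<alpha> \<in> carrier_vec k" for \<alpha> by (simp add: crd_def)
  have lc_add: "lc (u + v) = lc u + lc v" if "u \<in> carrier_vec k" "v \<in> carrier_vec k" for u v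
    using that by (auto simp: fun_eq_iff lc_apply idx_less sum.distrib distrib_right)
  have lc_smult: "lc (c \<cdot>\<^sub>v v) = (\<lambda>g. c * lc v g)" if "v \<in> carrier_vec k" for c v
    using that by (auto simp: fun_eq_iff lc_apply idx_less sum_distrib_left mult.assoc)
  have lc_0: "lc (0\<^sub>v k) = 0"
    by (auto simp: fun_eq_iff lc_apply idx_less)
  have lc_eq_0: "v = 0\<^sub>v k" if v: "v \<in> carrier_vec k" and 0: "lc v = 0" for v
  proof (rule eq_vecI)
    fix i assume "i < dim_vec (0\<^sub>v k)"
    hence i: "i < k" by simp
    have "v $ idx (b i) = 0"
      using qfun.independentD[OF B(2) B(1) subset_refl, of "\<lambda>c. v $ idx c" "b i"] 0 b_B[OF i]
      by (simp add: lc_def)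
    thus "v $ i = 0\<^sub>v k $ i" using i idx_b by simp
  qed (use v in auto)
  have lc_inj: "u = v" if "u \<in> carrier_vec k" "v \<in> carrier_vec k" "lc u = lc v" for u v
  proof -
    have "lc (u + (-1) \<cdot>\<^sub>v v) = 0"
      using that by (simp add: lc_add lc_smult fun_eq_iff)
    hence eq: "u + (-1) \<cdot>\<^sub>v v = 0\<^sub>v k" using that by (intro lc_eq_0) auto
    show ?thesis
    proof (rule eq_vecI)
      fix i assume i: "i < dim_vec v"
      have "(u + (-1) \<cdot>\<^sub>v v) $ i = 0" using eq i that by simp
      thus "u $ i = v $ i" using that i by simp
    qed (use that in auto)
  qed
  \<comment> \<open>Column \<open>j\<close> holds the coordinates of
    \<open>single g \<star> b j\<close>; through \<open>lc\<close> this matrix is left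
    multiplication by \<open>g\<close>.\<close>
  define W where "W g = mat k k (\<lambda>(i, j). crd (single g \<star> b j) $ i)" for g
  have W_carrier [simp]: "W g \<in> carrier_mat k k" for g by (simp add: W_def)
  have lc_W: "lc (W g *\<^sub>v v) = single g \<star> lc v" if g: "g \<in> carrier G" and v: "v \<in> carrier_vec k" for g v
  proof
    fix h
    have gL: "single g \<star> c \<in> L" if "c \<in> B" for c
      using L BL that g by (auto simp: left_ideal_def)
    have "lc (W g *\<^sub>v v) h = (\<Sum>c\<in>B. (\<Sum>j = 0..<k. crd (single g \<star> b j) $ idx c * v $ j) * c h)"
      using v by (simp add: lc_apply idx_less scalar_prod_def W_def)
    also have "\<dots> = (\<Sum>c\<in>B. (\<Sum>c'\<in>B. crd (single g \<star> c') $ idx c * v $ idx c') * c h)"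
      by (simp add: reidx[symmetric] b_idx)
    also have "\<dots> = (\<Sum>c\<in>B. \<Sum>c'\<in>B. v $ idx c' * (crd (single g \<star> c') $ idx c * c h))"
      unfolding sum_distrib_right by (simp add: mult_ac)
    also have "\<dots> = (\<Sum>c'\<in>B. v $ idx c' * lc (crd (single g \<star> c')) h)"
      by (subst sum.swap) (simp add: lc_apply sum_distrib_left)
    also have "\<dots> = (\<Sum>c'\<in>B. v $ idx c' * (single g \<star> c') h)"
      using gL lc_crd by simp
    also have "\<dots> = (single g \<star> lc v) h"
      by (simp add: lc_def conv_sum_right conv_scale_right sum_fun_apply)
    finally show "lc (W g *\<^sub>v v) h = (single g \<star> lc v) h" .
  qed
  have lcQG: "lc v \<in> QG" for v using lc_L LQG by blast
  have rep: "matrix_rep G k W"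
    unfolding matrix_rep_def
  proof (intro conjI ballI)
    show "W \<one> = 1\<^sub>m k"
      by (rule mat_eqI_mult_vec[of _ k k])
        (auto intro!: lc_inj mult_mat_vec_carrier[OF W_carrier] simp: lc_W lcQG)
    show "W (g \<otimes> h) = W g * W h" if gh: "g \<in> carrier G" "h \<in> carrier G" for g h
    proof (rule mat_eqI_mult_vec[of _ k k])
      fix v :: "rat vec" assume v: "v \<in> carrier_vec k"
      have Wv: "W h *\<^sub>v v \<in> carrier_vec k" using v by (auto intro: mult_mat_vec_carrier[OF W_carrier])
      have "lc (W (g \<otimes> h) *\<^sub>v v) = (single g \<star> single h) \<star> lc v"
        using gh v by (simp add: lc_W single_mult)
      also have "\<dots> = lc (W g *\<^sub>v (W h *\<^sub>v v))"
        using gh v Wv by (simp add: lc_W conv_assoc)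
      finally have "W (g \<otimes> h) *\<^sub>v v = W g *\<^sub>v (W h *\<^sub>v v)"
        using v Wv by (intro lc_inj) (auto intro: mult_mat_vec_carrier[OF W_carrier])
      thus "W (g \<otimes> h) *\<^sub>v v = W g * W h *\<^sub>v v"
        using v by (simp add: assoc_mult_mat_vec[of _ k k _ k])
    qed (auto intro: mult_carrier_mat[OF W_carrier W_carrier])
  qed simp
  have lc_algebra_rep: "lc (algebra_rep G k W \<alpha> *\<^sub>v v) = \<alpha> \<star> lc v"
    if \<alpha>: "\<alpha> \<in> QG" and v: "v \<in> carrier_vec k" for \<alpha> v
  proof
    fix h
    have "lc (algebra_rep G k W \<alpha> *\<^sub>v v) h =
      (\<Sum>c\<in>B. (\<Sum>g\<in>carrier G. \<alpha> g * (W g *\<^sub>v v) $ idx c) * c h)"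
      using v by (simp add: lc_apply algebra_rep_mult_vec[OF rep] idx_less del: index_mult_mat_vec)
    also have "\<dots> = (\<Sum>g\<in>carrier G. \<alpha> g * lc (W g *\<^sub>v v) h)"
      unfolding sum_distrib_right lc_apply sum_distrib_left
      by (subst sum.swap) (simp add: mult_ac)
    also have "\<dots> = (\<Sum>g\<in>carrier G. \<alpha> g * (single g \<star> lc v) h)"
      using v by (simp add: lc_W)
    also have "\<dots> = ((\<Sum>g\<in>carrier G. (\<lambda>h. \<alpha> g * single g h)) \<star> lc v) h"
      by (simp add: conv_sum_left conv_scale_left sum_fun_apply)
    also have "\<dots> = (\<alpha> \<star> lc v) h"
      using QG_expand[OF \<alpha>] by simp
    finally show "lc (algebra_rep G k W \<alpha> *\<^sub>v v) h = (\<alpha> \<star> lc v) h" .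
  qed
  have irr: "irreducible_rep G k W"
    unfolding irreducible_rep_def
  proof (intro conjI allI impI)
    show "matrix_rep G k W" by (rule rep)
    show "0 < k"
    proof (rule ccontr)
      assume "\<not> 0 < k"
      hence "B = {}" using B(1) by (simp add: k_def)
      thus False using B(3) ne by simp
    qed
    fix U assume U: "VectorSpace.subspace class_ring U (module_vec TYPE(rat) k) \<and>
      (\<forall>g\<in>carrier G. \<forall>u\<in>U. W g *\<^sub>v u \<in> U)"
    note UD = subspace_vecD[OF conjunct1[OF U]]
    \<comment> \<open>The image of an invariant \<open>U\<close> is a left ideal inside
      \<open>L\<close>, so minimality leaves only zero and everything.\<close>
    have "left_ideal (lc ` U)"
      unfolding left_ideal_def
    proof (intro conjI ballI)
      show "qfun.subspace (lc ` U)"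
      proof (rule qfun.subspaceI)
        show "0 \<in> lc ` U" using lc_0 UD(2) by (metis imageI)
        show "\<alpha> + \<beta> \<in> lc ` U" if "\<alpha> \<in> lc ` U" "\<beta> \<in> lc ` U" for \<alpha> \<beta>
        proof -
          from that obtain u v where uv: "u \<in> U" "v \<in> U" "\<alpha> = lc u" "\<beta> = lc v" by blast
          hence "u \<in> carrier_vec k" "v \<in> carrier_vec k" using UD(1) by auto
          hence "\<alpha> + \<beta> = lc (u + v)" by (simp only: uv lc_add)
          thus ?thesis using UD(3)[OF uv(1,2)] by (simp only: image_eqI)
        qed
        show "(\<lambda>g. c * \<alpha> g) \<in> lc ` U" if "\<alpha> \<in> lc ` U" for c \<alpha>
        proof -
          from that obtain u where u: "u \<in> U" "\<alpha> = lc u" by blast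
          hence "u \<in> carrier_vec k" using UD(1) by auto
          hence "(\<lambda>g. c * \<alpha> g) = lc (c \<cdot>\<^sub>v u)" by (simp only: u lc_smult)
          thus ?thesis using UD(4)[OF u(1)] by (simp only: image_eqI)
        qed
      qed
      show "lc ` U \<subseteq> QG" using lcQG by blast
      fix g \<alpha> assume g: "g \<in> carrier G" and "\<alpha> \<in> lc ` U"
      then obtain u where u: "u \<in> U" "\<alpha> = lc u" by blast
      hence "u \<in> carrier_vec k" using UD(1) by auto
      hence "single g \<star> \<alpha> = lc (W g *\<^sub>v u)" by (simp only: u lc_W[OF g])
      moreover have "W g *\<^sub>v u \<in> U" using U g u(1) by blast
      ultimately show "single g \<star> \<alpha> \<in> lc ` U" by (simp only: image_eqI)
    qed
    moreover have "lc ` U \<subseteq> L" using lc_L by blast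
    ultimately consider "lc ` U = {0}" | "lc ` U = L" using minimal by blast
    thus "U = {0\<^sub>v k} \<or> U = carrier_vec k"
    proof cases
      case 1
      hence "U \<subseteq> {0\<^sub>v k}" using lc_eq_0 UD(1) by blast
      thus ?thesis using UD(2) by blast
    next
      case 2
      have "v \<in> U" if "v \<in> carrier_vec k" for v
      proof -
        obtain u where "u \<in> U" "lc v = lc u" using lc_L[of v] 2 by (metis imageE)
        thus ?thesis using lc_inj that UD(1) by blast
      qed
      thus ?thesis using UD(1) by blast
    qed
  qed
  show ?thesis
  proof (rule that[OF irr])
    fix \<alpha> \<beta> assume \<alpha>: "\<alpha> \<in> QG" and \<beta>: "\<beta> \<in> L" and 0: "algebra_rep G k W \<alpha> = 0\<^sub>m k k"
    have "\<alpha> \<star> \<beta> = lc (algebra_rep G k W \<alpha> *\<^sub>v crd \<beta>)"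
      using lc_algebra_rep[OF \<alpha>, of "crd \<beta>"] lc_crd[OF \<beta>] by simp
    also have "algebra_rep G k W \<alpha> *\<^sub>v crd \<beta> = 0\<^sub>v k"
      unfolding 0 by (rule eq_vecI) auto
    finally show "\<alpha> \<star> \<beta> = 0" by (simp only: lc_0)
  qed
qed

text \<open>
  The annihilator of all irreducible representations contains, if it is nonzero, a minimal left
  ideal \<open>L\<close>, on which it acts as zero. For \<open>\<lambda> \<in> L\<close> the self-adjoint element
  \<open>\<beta> = adjoint \<lambda> \<star> \<lambda>\<close> lies in \<open>L\<close>, so \<open>\<beta> \<star> \<beta> = 0\<close>, and positivity of the adjoint gives first
  \<open>\<beta> = 0\<close> and then \<open>\<lambda> = 0\<close>.
\<close>
theorem irreducible_reps_separate:
  assumes \<alpha>: "\<alpha> \<in> QG"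
    and zero: "\<And>d (W :: 'g \<Rightarrow> rat mat). irreducible_rep G d W \<Longrightarrow> algebra_rep G d W \<alpha> = 0\<^sub>m d d"
  shows "\<alpha> = 0"
proof (rule ccontr)
  assume "\<alpha> \<noteq> 0"
  define J where "J = {\<alpha> \<in> QG. \<forall>d (W :: 'g \<Rightarrow> rat mat). irreducible_rep G d W \<longrightarrow>
    algebra_rep G d W \<alpha> = 0\<^sub>m d d}"
  have "left_ideal J"
    unfolding left_ideal_def
  proof (intro conjI ballI)
    show "qfun.subspace J"
      by (rule qfun.subspaceI) (auto simp: J_def algebra_rep_zero algebra_rep_add algebra_rep_scale)
    show "single g \<star> \<beta> \<in> J" if "g \<in> carrier G" "\<beta> \<in> J" for g \<beta>
      using that by (auto simp: J_def algebra_rep_conv irreducible_rep_def)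
  qed (auto simp: J_def)
  moreover have "\<alpha> \<in> J" using \<alpha> zero by (simp add: J_def)
  ultimately obtain L where L: "left_ideal L" "L \<subseteq> J" "L \<noteq> {0}"
    "\<And>L'. left_ideal L' \<Longrightarrow> L' \<subseteq> L \<Longrightarrow> L' \<noteq> {0} \<Longrightarrow> L' = L"
    using minimal_left_ideal_exists[of J] \<open>\<alpha> \<noteq> 0\<close> by blast
  obtain k and W :: "'g \<Rightarrow> rat mat" where W: "irreducible_rep G k W"
    "\<And>\<alpha> \<beta>. \<alpha> \<in> QG \<Longrightarrow> \<beta> \<in> L \<Longrightarrow> algebra_rep G k W \<alpha> = 0\<^sub>m k k \<Longrightarrow> \<alpha> \<star> \<beta> = 0"
    using minimal_left_ideal_rep[OF L(1,3,4)] by blast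
  have LQG: "L \<subseteq> QG" "0 \<in> L"
    using L(1) by (auto simp: left_ideal_def dest: qfun.subspace_0)
  have "\<mu> = 0" if \<mu>: "\<mu> \<in> L" for \<mu>
  proof -
    have \<mu>Q: "\<mu> \<in> QG" using LQG \<mu> by blast
    define \<beta> where "\<beta> = adjoint \<mu> \<star> \<mu>"
    have \<beta>L: "\<beta> \<in> L" unfolding \<beta>_def by (rule left_ideal_conv[OF L(1) _ \<mu>]) simp
    have "adjoint \<beta> = \<beta>" using \<mu>Q by (simp add: \<beta>_def adjoint_conv adjoint_adjoint)
    moreover have "\<beta> \<star> \<beta> = 0"
      using W \<beta>L L(2) LQG by (auto simp: J_def subset_iff)
    ultimately have "\<beta> = 0" using adjoint_conv_eq_0[of \<beta>] \<beta>L LQG by auto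
    thus "\<mu> = 0" using adjoint_conv_eq_0[OF \<mu>Q] by (simp add: \<beta>_def)
  qed
  thus False using L(3) LQG(2) by blast
qed

lemma finsum_QG:
  assumes "\<And>i. i \<in> I \<Longrightarrow> F i \<in> QG"
  shows "finsum (group_algebra G) F I = (\<Sum>i\<in>I. F i)"
proof -
  have "abelian_group (group_algebra G)"
  proof (rule abelian_groupI)
    fix \<alpha> assume \<alpha>: "\<alpha> \<in> QG"
    show "\<exists>\<beta>\<in>QG. \<beta> \<oplus>\<^bsub>group_algebra G\<^esub> \<alpha> = \<zero>\<^bsub>group_algebra G\<^esub>"
      by (rule bexI[of _ "0 - \<alpha>"]) (use \<alpha> in \<open>auto simp: add_QG zero_QG QG_iff\<close>)
  qed (auto simp: add_QG zero_QG add_ac)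
  then interpret abelian_group "group_algebra G" .
  show ?thesis
    using assms
  proof (induction I rule: infinite_finite_induct)
    case (infinite I)
    thus ?case by (simp only: finsum_infinite zero_QG sum.infinite not_False_eq_True)
  next
    case empty
    show ?case by (simp only: finsum_empty zero_QG sum.empty)
  next
    case (insert i I)
    have "finsum (group_algebra G) F (insert i I) = F i \<oplus>\<^bsub>group_algebra G\<^esub> finsum (group_algebra G) F I"
      using insert by (intro finsum_insert) auto
    thus ?case using insert by (simp only: add_QG sum.insert insert_iff simp_thms)
  qed
qed

text \<open>Left multiplication by \<open>k\<close> permutes the conjugates of \<open>q\<close> at
  the cost of a factor \<open>k\<close> on the right.\<close>

lemma conjugation_sum_central:
  assumes "q \<in> QG"
  defines "c \<equiv> \<Sum>g\<in>carrier G. single g \<star> q \<star> single (inv g)"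
  assumes k: "k \<in> carrier G"
  shows "single k \<star> c = c \<star> single k"
proof -
  have "single k \<star> c = (\<Sum>g\<in>carrier G. single (k \<otimes> g) \<star> q \<star> single (inv g))"
    unfolding c_def conv_sum_right
    by (intro sum.cong refl) (use k in \<open>simp add: conv_assoc[symmetric] single_mult\<close>)
  also have "\<dots> = (\<Sum>g\<in>carrier G. single (k \<otimes> g) \<star> q \<star> single (inv (k \<otimes> g) \<otimes> k))"
    by (intro sum.cong refl) (use k in \<open>simp add: inv_mult_group m_assoc\<close>)
  also have "\<dots> = (\<Sum>g\<in>carrier G. single g \<star> q \<star> single (inv g \<otimes> k))"
    using k by (intro sum.reindex_bij_witness[of _ "\<lambda>h. inv k \<otimes> h" "\<lambda>h. k \<otimes> h"])
      (auto simp: m_assoc[symmetric])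
  also have "\<dots> = c \<star> single k"
    unfolding c_def conv_sum_left
    by (intro sum.cong refl) (use k in \<open>simp add: conv_assoc single_mult\<close>)
  finally show ?thesis .
qed

text \<open>
  The conjugates of \<open>adjoint f \<star> f\<close> sum up to a central element \<open>c\<close> of the two-sided ideal
  generated by \<open>f\<close>, nonzero since its coefficient at the identity is positive. By Schur's lemma
  multiplication by \<open>c\<close> is injective on the simple component with unit \<open>e\<close>, so it is
  surjective there and \<open>e = c \<star> \<beta>\<close> for some \<open>\<beta>\<close>.
\<close>
lemma algebra_rep_component_eq_0:
  fixes \<rho> :: "'g \<Rightarrow> 'a::field_char_0 mat" and W :: "'g \<Rightarrow> rat mat"
  assumes \<rho>: "matrix_rep G d \<rho>"
    and e: "e \<in> QG" "\<And>\<alpha>. \<alpha> \<in> QG \<Longrightarrow> e \<star> \<alpha> = \<alpha> \<star> e"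
    and W: "irreducible_rep G m W"
    and separates: "\<And>\<alpha>. \<alpha> \<in> QG \<Longrightarrow> e \<star> \<alpha> = \<alpha> \<Longrightarrow> algebra_rep G m W \<alpha> = 0\<^sub>m m m \<Longrightarrow> \<alpha> = 0"
    and ee: "e \<star> e = e"
    and f: "f \<in> QG" "f \<noteq> 0" "e \<star> f = f"
    and zero: "algebra_rep G d \<rho> f = 0\<^sub>m d d"
  shows "algebra_rep G d \<rho> e = 0\<^sub>m d d"
proof -
  define q where "q = adjoint f \<star> f"
  define c where "c = (\<Sum>g\<in>carrier G. single g \<star> q \<star> single (inv g))"
  have q: "q \<in> QG" by (simp add: q_def)
  have c: "c \<in> QG" by (simp add: c_def)
  \<comment> \<open>\<open>e\<close> is central, so it moves past \<open>adjoint f\<close> and is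
    absorbed by \<open>f\<close>.\<close>
  have eq: "e \<star> q = q"
    using e f by (metis adjoint_in_QG conv_assoc q_def)
  have ec: "e \<star> c = c"
    unfolding c_def conv_sum_right
  proof (rule sum.cong[OF refl])
    fix g assume g: "g \<in> carrier G"
    have "e \<star> (single g \<star> q \<star> single (inv g)) = (e \<star> single g) \<star> q \<star> single (inv g)"
      by (simp add: conv_assoc)
    also have "\<dots> = single g \<star> (e \<star> q) \<star> single (inv g)"
      using g e(2) by (simp add: conv_assoc)
    finally show "e \<star> (single g \<star> q \<star> single (inv g)) = single g \<star> q \<star> single (inv g)"
      by (simp add: eq)
  qed
  have q1: "q \<one> > 0"
  proof -
    obtain h where "h \<in> carrier G" "f h \<noteq> 0"
      using f QG_ext[of f 0] by auto
    thus ?thesis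
      unfolding q_def adjoint_conv_at_one using finite_carrier by (intro sum_pos2[of _ h]) auto
  qed
  have "c \<one> = (\<Sum>g\<in>carrier G. q \<one>)"
    unfolding c_def sum_fun_apply
    by (intro sum.cong refl) (simp add: conv_single single_conv)
  moreover have "card (carrier G) > 0" using finite_carrier by (auto simp: card_gt_0_iff)
  ultimately have "c \<one> > 0" using q1 by simp
  hence c0: "c \<noteq> 0" by auto
  have Wrep: "matrix_rep G m W" using W by (rule irreducible_rep_matrix_rep)
  have Wc0: "algebra_rep G m W c \<noteq> 0\<^sub>m m m"
    using separates[OF c ec] c0 by blast
  have inj: "\<alpha> = 0" if \<alpha>: "\<alpha> \<in> QG" "e \<star> \<alpha> = \<alpha>" "c \<star> \<alpha> = 0" for \<alpha>
  proof (rule separates[OF \<alpha>(1,2)], rule mat_eqI_mult_vec[of _ m m])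
    fix v :: "rat vec" assume v: "v \<in> carrier_vec m"
    define u where "u = algebra_rep G m W \<alpha> *\<^sub>v v"
    have u: "u \<in> carrier_vec m"
      unfolding u_def using v by (intro mult_mat_vec_carrier[of _ m m]) auto
    have "algebra_rep G m W c *\<^sub>v u = algebra_rep G m W (c \<star> \<alpha>) *\<^sub>v v"
      using v by (simp add: u_def algebra_rep_conv[OF Wrep] assoc_mult_mat_vec[of _ m m _ m])
    also have "\<dots> = 0\<^sub>v m"
      using v by (intro eq_vecI) (auto simp: \<alpha> algebra_rep_zero)
    finally have "u = 0\<^sub>v m"
    proof (rule contrapos_pp)
      assume "u \<noteq> 0\<^sub>v m"
      moreover have "algebra_rep G m W c * W g = W g * algebra_rep G m W c" if "g \<in> carrier G" for g
        using conjugation_sum_central[OF q that] that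
        by (metis algebra_rep_conv[OF Wrep] algebra_rep_single[OF Wrep] c_def)
      ultimately show "algebra_rep G m W c *\<^sub>v u \<noteq> 0\<^sub>v m"
        using schur_injective[OF W _ _ u] Wc0 by auto
    qed
    also have "0\<^sub>v m = 0\<^sub>m m m *\<^sub>v v" using v by (intro eq_vecI) auto
    finally show "algebra_rep G m W \<alpha> *\<^sub>v v = 0\<^sub>m m m *\<^sub>v v" by (simp add: u_def)
  qed auto
  \<comment> \<open>The component with unit \<open>e\<close> as a rational subspace;
    \<open>inj\<close> says that multiplication by \<open>c\<close> is injective on it.\<close>
  define S where "S = {\<alpha> \<in> QG. e \<star> \<alpha> = \<alpha>}"
  have S: "qfun.subspace S"
    by (rule qfun.subspaceI) (auto simp: S_def conv_add_right conv_scale_right)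
  obtain B where B: "finite B" "qfun.independent B" "qfun.span B = S"
    using finite_basis_of_subspace[OF S] by (auto simp: S_def)
  have "\<exists>\<beta>\<in>qfun.span B. c \<star> \<beta> = e"
  proof (rule qfun.injective_endomorphism_surjective[OF _ B(1,2)])
    show "Vector_Spaces.linear (\<lambda>c \<alpha> g. c * \<alpha> g) (\<lambda>c \<alpha> g. c * \<alpha> g) ((\<star>) c)"
      by unfold_locales (simp_all only: conv_add_right conv_scale_right)
    show "c \<star> v \<in> qfun.span B" if "v \<in> qfun.span B" for v
    proof -
      have "e \<star> (c \<star> v) = c \<star> v" unfolding conv_assoc[symmetric] ec ..
      thus ?thesis by (simp only: B S_def mem_Collect_eq conv_in_QG)
    qed
    show "v = 0" if v: "v \<in> qfun.span B" and 0: "c \<star> v = 0" for v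
    proof -
      have "v \<in> QG" "e \<star> v = v" using v unfolding B S_def by blast+
      thus ?thesis using 0 by (rule inj)
    qed
    show "e \<in> qfun.span B" using e(1) ee by (simp only: B S_def mem_Collect_eq)
  qed
  then obtain \<beta> where \<beta>: "c \<star> \<beta> = e" by blast
  \<comment> \<open>Each conjugate contains \<open>f\<close> as a factor, so \<open>c\<close> is
    killed, and with it the product of \<open>c\<close> and \<beta>.\<close>
  have "algebra_rep G d \<rho> c = 0\<^sub>m d d"
    unfolding c_def
  proof (rule algebra_rep_sum_eq_0)
    fix g assume g: "g \<in> carrier G"
    have "algebra_rep G d \<rho> q = 0\<^sub>m d d"
      by (simp add: q_def algebra_rep_conv[OF \<rho>] zero)
    thus "algebra_rep G d \<rho> (single g \<star> q \<star> single (inv g)) = 0\<^sub>m d d"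
      by (simp add: algebra_rep_conv[OF \<rho>])
  qed
  thus ?thesis
    using algebra_rep_conv[OF \<rho>, of c \<beta>] by (simp add: \<beta>)
qed

end

lemma double_eq_0_mat:
  fixes A :: "'a::field_char_0 mat"
  assumes "A \<in> carrier_mat d d" "A = - A"
  shows "A = 0\<^sub>m d d"
proof (rule eq_matI)
  fix i j assume "i < dim_row (0\<^sub>m d d :: 'a mat)" "j < dim_col (0\<^sub>m d d :: 'a mat)"
  hence ij: "i < d" "j < d" by auto
  have "A $$ (i, j) = (- A) $$ (i, j)" using assms(2) by simp
  hence "A $$ (i, j) = - (A $$ (i, j))" using ij assms(1) by simp
  thus "A $$ (i, j) = 0\<^sub>m d d $$ (i, j)" using ij by (simp add: eq_neg_iff_add_eq_0)
qed (use assms in auto)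

section \<open>Components cut out by the central idempotents\<close>

context finite_group
begin

context
  fixes D :: "'g gad"
  assumes irreps: "rational_irreps G D" and idems: "group_algebra_idempotents G D"
begin

lemma irrep_irreducible: "l \<in> {1..irrep_count D} \<Longrightarrow> irreducible_rep G (irrep_deg D l) (irrep D l)"
  using irreps unfolding rational_irreps_def by blast

lemma irrep_rep: "l \<in> {1..irrep_count D} \<Longrightarrow> matrix_rep G (irrep_deg D l) (irrep D l)"
  using irrep_irreducible irreducible_rep_matrix_rep by blast

lemma irreps_separate:
  assumes "\<alpha> \<in> QG"
    and "\<And>l. l \<in> {1..irrep_count D} \<Longrightarrow>
      algebra_rep G (irrep_deg D l) (irrep D l) \<alpha> = 0\<^sub>m (irrep_deg D l) (irrep_deg D l)"
  shows "\<alpha> = 0"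
proof (rule irreducible_reps_separate[OF assms(1)])
  fix d and W :: "'g \<Rightarrow> rat mat"
  assume W: "irreducible_rep G d W"
  then obtain l where l: "l \<in> {1..irrep_count D}" "rep_equiv G W (irrep D l)"
    using irreps unfolding rational_irreps_def by blast
  show "algebra_rep G d W \<alpha> = 0\<^sub>m d d"
    by (rule algebra_rep_similar_eq_0[OF irreducible_rep_matrix_rep[OF W] irrep_rep[OF l(1)] l(2)
          assms(2)[OF l(1)]])
qed

lemma central_idem_in_QG: "l \<in> {1..irrep_count D} \<Longrightarrow> central_idem D l \<in> QG"
  and central_idem_idem: "l \<in> {1..irrep_count D} \<Longrightarrow> central_idem D l \<star> central_idem D l = central_idem D l"
  and central_idem_central: "l \<in> {1..irrep_count D} \<Longrightarrow> \<alpha> \<in> QG \<Longrightarrow>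
    central_idem D l \<star> \<alpha> = \<alpha> \<star> central_idem D l"
  using idems unfolding group_algebra_idempotents_def central_idempotent_def idempotent_def by blast+

lemma irrep_central_idem:
  assumes "l \<in> {1..irrep_count D}" "m \<in> {1..irrep_count D}"
  shows "algebra_rep G (irrep_deg D m) (irrep D m) (central_idem D l) =
    (if m = l then 1\<^sub>m (irrep_deg D m) else 0\<^sub>m (irrep_deg D m) (irrep_deg D m))"
  using idems assms unfolding group_algebra_idempotents_def by blast

text \<open>The other irreducible representations kill the idempotent and therefore \<alpha>; hence
  the \<open>l\<close>-th one is faithful on its own component.\<close>

lemma component_separate:
  assumes l: "l \<in> {1..irrep_count D}" and \<alpha>: "\<alpha> \<in> QG" "central_idem D l \<star> \<alpha> = \<alpha>"
    and 0: "algebra_rep G (irrep_deg D l) (irrep D l) \<alpha> = 0\<^sub>m (irrep_deg D l) (irrep_deg D l)"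
  shows "\<alpha> = 0"
proof (rule irreps_separate[OF \<alpha>(1)])
  fix m assume m: "m \<in> {1..irrep_count D}"
  have "algebra_rep G (irrep_deg D m) (irrep D m) \<alpha> =
    algebra_rep G (irrep_deg D m) (irrep D m) (central_idem D l) *
    algebra_rep G (irrep_deg D m) (irrep D m) \<alpha>"
    by (subst algebra_rep_conv[OF irrep_rep[OF m], symmetric]) (simp only: \<alpha>(2))
  thus "algebra_rep G (irrep_deg D m) (irrep D m) \<alpha> = 0\<^sub>m (irrep_deg D m) (irrep_deg D m)"
    using 0 irrep_central_idem[OF l m] by (cases "m = l") auto
qed

lemma primitive_idem_props:
  assumes l: "l \<in> {1..irrep_count D}" and k: "k \<in> {1..multiplicity D l}"
  shows "primitive_idem D l k \<in> QG" "primitive_idem D l k \<noteq> 0"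
    and "primitive_idem D l k \<star> primitive_idem D l k = primitive_idem D l k"
    and "central_idem D l \<star> primitive_idem D l k = primitive_idem D l k"
proof -
  let ?f = "primitive_idem D l" and ?K = "{1..multiplicity D l}"
  have prim: "primitive_idempotent (group_algebra G) (?f k)" if "k \<in> ?K" for k
    using idems l that unfolding group_algebra_idempotents_def by blast
  hence f: "?f k \<in> QG" if "k \<in> ?K" for k
    using that unfolding primitive_idempotent_def idempotent_def by blast
  show "?f k \<in> QG" using f k .
  show "?f k \<noteq> 0" "?f k \<star> ?f k = ?f k"
    using prim[OF k] unfolding primitive_idempotent_def idempotent_def zero_QG by blast+
  have "central_idem D l = finsum (group_algebra G) ?f ?K"
    using idems l unfolding group_algebra_idempotents_def by blast
  \<comment> \<open>After expanding into primitive idempotents, orthogonality leaves only the square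
    of \<open>?f k\<close>.\<close>
  hence "central_idem D l \<star> ?f k = (\<Sum>j\<in>?K. ?f j \<star> ?f k)"
    using f by (simp only: finsum_QG conv_sum_left)
  also have "\<dots> = ?f k \<star> ?f k + (\<Sum>j\<in>?K - {k}. ?f j \<star> ?f k)"
    using k by (intro sum.remove) auto
  also have "(\<Sum>j\<in>?K - {k}. ?f j \<star> ?f k) = 0"
  proof (rule sum.neutral, rule ballI)
    fix j assume "j \<in> ?K - {k}"
    hence "orthogonal_elements (group_algebra G) (?f j) (?f k)"
      using idems l k unfolding group_algebra_idempotents_def by blast
    thus "?f j \<star> ?f k = 0" unfolding orthogonal_elements_def zero_QG by blast
  qed
  finally show "central_idem D l \<star> ?f k = ?f k"
    using \<open>?f k \<star> ?f k = ?f k\<close> by (simp only: add_0_right)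
qed

text \<open>Derived from separation: in each listed representation one summand acts as the identity
  and the others as zero, so the difference of the two sides is killed by all of them.\<close>

lemma sum_central_idem: "(\<Sum>l\<in>{1..irrep_count D}. central_idem D l) = single \<one>"
proof -
  let ?I = "{1..irrep_count D}"
  let ?\<alpha> = "(\<Sum>l\<in>?I. central_idem D l) - single \<one>"
  have "?\<alpha> = 0"
  proof (rule irreps_separate)
    show "?\<alpha> \<in> QG" using central_idem_in_QG by (intro QG_diff QG_sum single_in_QG) auto
    fix m assume m: "m \<in> ?I"
    let ?W = "algebra_rep G (irrep_deg D m) (irrep D m)"
    have "(\<Sum>l\<in>?I. central_idem D l) = central_idem D m + (\<Sum>l\<in>?I - {m}. central_idem D l)"
      using m by (intro sum.remove) auto
    moreover have "?W (\<Sum>l\<in>?I - {m}. central_idem D l) = 0\<^sub>m (irrep_deg D m) (irrep_deg D m)"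
      using irrep_central_idem[OF _ m] by (intro algebra_rep_sum_eq_0) auto
    ultimately show "?W ?\<alpha> = 0\<^sub>m (irrep_deg D m) (irrep_deg D m)"
      using irrep_central_idem[OF m m]
      by (simp only: algebra_rep_diff algebra_rep_add algebra_rep_one[OF irrep_rep[OF m]]) simp
  qed
  thus ?thesis by (simp only: right_minus_eq)
qed

text \<open>\<open>irrep D l\<close> is faithful on its component, so a group element that it sends
  to 1 or -1 acts on the component by that sign.\<close>

lemma component_scalar:
  assumes l: "l \<in> {1..irrep_count D}" and g: "g \<in> carrier G"
    and \<alpha>: "\<alpha> \<in> QG" "central_idem D l \<star> \<alpha> = \<alpha>"
  shows "irrep D l g = 1\<^sub>m (irrep_deg D l) \<Longrightarrow> single g \<star> \<alpha> = \<alpha>"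
    and "irrep D l g = - 1\<^sub>m (irrep_deg D l) \<Longrightarrow> single g \<star> \<alpha> = 0 - \<alpha>"
proof -
  note rep = irrep_rep[OF l]
  let ?W = "algebra_rep G (irrep_deg D l) (irrep D l)"
  have e: "central_idem D l \<star> (single g \<star> \<alpha>) = single g \<star> \<alpha>"
    using central_idem_central[OF l, of "single g"] g \<alpha>(2)
    by (simp only: conv_assoc[symmetric] single_in_QG) (simp only: conv_assoc)
  have Wg: "?W (single g \<star> \<alpha>) = irrep D l g * ?W \<alpha>"
    by (simp only: algebra_rep_conv[OF rep] algebra_rep_single[OF rep g])
  show "single g \<star> \<alpha> = \<alpha>" if "irrep D l g = 1\<^sub>m (irrep_deg D l)"
  proof -
    have "single g \<star> \<alpha> - \<alpha> = 0"
    proof (rule component_separate[OF l])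
      show "?W (single g \<star> \<alpha> - \<alpha>) = 0\<^sub>m (irrep_deg D l) (irrep_deg D l)"
        by (simp only: algebra_rep_diff Wg that left_mult_one_mat[OF algebra_rep_carrier]) auto
    qed (use \<alpha> in \<open>simp_all only: conv_diff_right e QG_diff conv_in_QG\<close>)
    thus ?thesis by (simp only: right_minus_eq)
  qed
  show "single g \<star> \<alpha> = 0 - \<alpha>" if "irrep D l g = - 1\<^sub>m (irrep_deg D l)"
  proof -
    have "single g \<star> \<alpha> + \<alpha> = 0"
    proof (rule component_separate[OF l])
      have "irrep D l g * ?W \<alpha> = - ?W \<alpha>"
        unfolding that by (simp add: uminus_mult_left_mat)
      thus "?W (single g \<star> \<alpha> + \<alpha>) = 0\<^sub>m (irrep_deg D l) (irrep_deg D l)"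
        by (simp only: algebra_rep_add Wg) (auto intro!: eq_matI)
    qed (use \<alpha> in \<open>simp_all only: conv_add_right e QG_add conv_in_QG\<close>)
    thus ?thesis by (simp only: eq_neg_iff_add_eq_0 diff_0)
  qed
qed

end

end

section \<open>Tangent spaces of images of endomorphisms\<close>

lemma torus_proj_iff: "w \<in> torus_proj d \<Lambda> v \<longleftrightarrow> (\<exists>l\<in>\<Lambda>. w = l + v)"
  by (auto simp: torus_proj_def r_coset_def module_vec_simps)

lemma lattice_properties:
  assumes "lattice d \<Lambda>"
  shows "\<Lambda> \<subseteq> carrier_vec d" "0\<^sub>v d \<in> \<Lambda>" "countable \<Lambda>"
    and "\<And>l. l \<in> \<Lambda> \<Longrightarrow> - l \<in> \<Lambda>" "\<And>l m. l \<in> \<Lambda> \<Longrightarrow> m \<in> \<Lambda> \<Longrightarrow> l + m \<in> \<Lambda>"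
proof -
  obtain P where P: "P \<in> carrier_mat d (2 * d)"
    and \<Lambda>: "\<Lambda> = {P *\<^sub>v map_vec of_int c | c :: int vec. c \<in> carrier_vec (2 * d)}"
    using assms by (auto simp: lattice_def)
  let ?F = "\<lambda>c :: int vec. P *\<^sub>v map_vec of_int c"
  have \<Lambda>': "\<Lambda> = ?F ` carrier_vec (2 * d)" using \<Lambda> by auto
  show "\<Lambda> \<subseteq> carrier_vec d" using P by (auto simp: \<Lambda>')
  have "?F (0\<^sub>v (2 * d)) = 0\<^sub>v d"
    using P by (intro eq_vecI) (auto simp: scalar_prod_def)
  thus "0\<^sub>v d \<in> \<Lambda>" unfolding \<Lambda>' by (metis image_eqI zero_carrier_vec)
  \<comment> \<open>Integer vectors are images of integer lists, hence countable.\<close>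
  have "surj (vec_of_list :: int list \<Rightarrow> int vec)"
    by (rule surjI[of _ list_of_vec]) (rule vec_list)
  hence "countable (UNIV :: int vec set)"
    by (metis countable_image countableI_type)
  hence "countable (carrier_vec (2 * d) :: int vec set)"
    by (rule countable_subset[OF subset_UNIV])
  thus "countable \<Lambda>" by (simp add: \<Lambda>')
  show "- l \<in> \<Lambda>" if l: "l \<in> \<Lambda>" for l
  proof -
    obtain c where c: "c \<in> carrier_vec (2 * d)" "l = ?F c" using l by (auto simp: \<Lambda>')
    have "?F (- c) = - l"
      using P c by (intro eq_vecI) (auto simp: scalar_prod_def sum_negf)
    thus ?thesis unfolding \<Lambda>' using c(1) by (metis image_eqI uminus_carrier_vec)
  qed
  show "l + m \<in> \<Lambda>" if l: "l \<in> \<Lambda>" and m: "m \<in> \<Lambda>" for l m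
  proof -
    obtain b where b: "b \<in> carrier_vec (2 * d)" "l = ?F b" using l by (auto simp: \<Lambda>')
    obtain c where c: "c \<in> carrier_vec (2 * d)" "m = ?F c" using m by (auto simp: \<Lambda>')
    have "?F (b + c) = l + m"
      using P b c by (intro eq_vecI) (auto simp: scalar_prod_def sum.distrib distrib_left)
    thus ?thesis unfolding \<Lambda>' using b(1) c(1) by (metis image_eqI add_carrier_vec)
  qed
qed

lemma torus_proj_eqD:
  assumes "lattice d \<Lambda>" "v \<in> carrier_vec d" "torus_proj d \<Lambda> v = torus_proj d \<Lambda> w"
  shows "\<exists>l\<in>\<Lambda>. v = l + w"
proof -
  have "v \<in> torus_proj d \<Lambda> v"
    unfolding torus_proj_iff using lattice_properties(2)[OF assms(1)] assms(2)
    by (intro bexI[of _ "0\<^sub>v d"]) auto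
  thus ?thesis unfolding assms(3) torus_proj_iff .
qed

text \<open>
  If the line \<open>t \<mapsto> t v\<close> stays in the image of \<open>T\<close> modulo the countable lattice, then two of its
  points differ by an element of the image.
\<close>
lemma tangent_space_torus_image:
  assumes \<Lambda>: "lattice d \<Lambda>" and T: "T \<in> carrier_mat d d"
  shows "tangent_space d \<Lambda> (torus_image d \<Lambda> T) = (\<lambda>v. T *\<^sub>v v) ` carrier_vec d"
proof (rule Set.set_eqI, rule iffI)
  fix v assume v: "v \<in> tangent_space d \<Lambda> (torus_image d \<Lambda> T)"
  hence vc: "v \<in> carrier_vec d" by (simp add: tangent_space_def)
  have "\<exists>l\<in>\<Lambda>. \<exists>w\<in>carrier_vec d. complex_of_real t \<cdot>\<^sub>v v = l + T *\<^sub>v w" for t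
  proof -
    have "torus_proj d \<Lambda> (complex_of_real t \<cdot>\<^sub>v v) \<in> torus_image d \<Lambda> T"
      using v by (simp add: tangent_space_def)
    then obtain w where w: "w \<in> carrier_vec d"
      "torus_proj d \<Lambda> (complex_of_real t \<cdot>\<^sub>v v) = torus_proj d \<Lambda> (T *\<^sub>v w)"
      by (auto simp: torus_image_def)
    thus ?thesis using torus_proj_eqD[OF \<Lambda> _ w(2)] vc by auto
  qed
  then obtain l w where lw: "\<And>t. l t \<in> \<Lambda>" "\<And>t. w t \<in> carrier_vec d"
    "\<And>t. complex_of_real t \<cdot>\<^sub>v v = l t + T *\<^sub>v w t"
    by metis
  have "\<not> inj l"
  proof
    assume "inj l"
    moreover have "countable (range l)"
      using lw(1) lattice_properties(3)[OF \<Lambda>] by (metis countable_subset image_subset_iff)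
    ultimately show False using countable_image_inj_on uncountable_UNIV_real by blast
  qed
  then obtain s t where st: "s \<noteq> t" "l s = l t" by (auto simp: inj_def)
  have lc: "l t \<in> carrier_vec d" using lw(1) lattice_properties(1)[OF \<Lambda>] by blast
  define u where "u = (1 / complex_of_real (s - t)) \<cdot>\<^sub>v (w s - w t)"
  have u: "u \<in> carrier_vec d" using lw(2) by (simp add: u_def)
  have "v = T *\<^sub>v u"
  proof (rule eq_vecI)
    fix i assume "i < dim_vec (T *\<^sub>v u)"
    hence i: "i < d" using T by simp
    have *: "complex_of_real r * v $ i = l r $ i + (T *\<^sub>v w r) $ i" for r
      using arg_cong[OF lw(3)[of r], of "\<lambda>x. x $ i"] i vc T by simp
    have "complex_of_real (s - t) * v $ i = (T *\<^sub>v w s) $ i - (T *\<^sub>v w t) $ i"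
      using *[of s] *[of t] st(2) by (simp add: algebra_simps)
    hence "v $ i = (1 / complex_of_real (s - t)) * ((T *\<^sub>v w s) $ i - (T *\<^sub>v w t) $ i)"
      using st(1) by (simp add: field_simps)
    also have "\<dots> = ((1 / complex_of_real (s - t)) \<cdot>\<^sub>v (T *\<^sub>v w s - T *\<^sub>v w t)) $ i"
      using i T by simp
    also have "(1 / complex_of_real (s - t)) \<cdot>\<^sub>v (T *\<^sub>v w s - T *\<^sub>v w t) = T *\<^sub>v u"
      using T lw(2) by (simp add: u_def mult_mat_vec[of _ d d] mult_minus_distrib_mat_vec[of _ d d])
    finally show "v $ i = (T *\<^sub>v u) $ i" .
  qed (use vc T in auto)
  thus "v \<in> (\<lambda>v. T *\<^sub>v v) ` carrier_vec d" using u by blast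
next
  fix v assume "v \<in> (\<lambda>v. T *\<^sub>v v) ` carrier_vec d"
  then obtain w where w: "w \<in> carrier_vec d" "v = T *\<^sub>v w" by blast
  have "complex_of_real t \<cdot>\<^sub>v v = T *\<^sub>v (complex_of_real t \<cdot>\<^sub>v w)" for t
    using w T by (simp add: mult_mat_vec[of _ d d])
  thus "v \<in> tangent_space d \<Lambda> (torus_image d \<Lambda> T)"
    using w T by (auto simp: tangent_space_def torus_image_def)
qed

text \<open>A nonzero column alone is a linearly independent set, so it forces positive
  rank.\<close>

lemma (in vec_space) rank_eq_0_iff:
  assumes A: "A \<in> carrier_mat n nc"
  shows "rank A = 0 \<longleftrightarrow> A = 0\<^sub>m n nc"
proof
  assume rank: "rank A = 0"
  show "A = 0\<^sub>m n nc"
  proof (rule ccontr)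
    assume "A \<noteq> 0\<^sub>m n nc"
    then obtain i j where ij: "i < n" "j < nc" "A $$ (i, j) \<noteq> 0"
      using A by (auto simp: mat_eq_iff)
    define v where "v = col A j"
    have v: "v \<in> carrier_vec n" "v \<in> set (cols A)" "v $ i \<noteq> 0"
      using A ij by (auto simp: v_def cols_def)
    have "v \<noteq> 0\<^sub>v n" using v(3) ij(1) by auto
    note v = v(1) this v(2)
    have "lin_indpt {v}"
      using lin_dep_iff_in_span[of "{}" v] v finite_lin_indpt2[of "{}"] span_empty by auto
    hence "card {v} \<le> rank A" using rank_ge_card_indpt[OF A, of "{v}"] v by simp
    thus False using rank by simp
  qed
qed (simp add: rank_0I)

text \<open>The tangent space is the column space, whose dimension is the rank. This turns every
  dimension condition into the vanishing of a matrix.\<close>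

lemma subtorus_dim_torus_image_eq_0_iff:
  assumes \<Lambda>: "lattice d \<Lambda>" and T: "T \<in> carrier_mat d d"
  shows "subtorus_dim d \<Lambda> (torus_image d \<Lambda> T) = 0 \<longleftrightarrow> T = 0\<^sub>m d d"
proof -
  interpret vec_space "TYPE(complex)" d .
  have "tangent_space d \<Lambda> (torus_image d \<Lambda> T) = span (set (cols T))"
    using T col_space_eq[OF T] by (auto simp: tangent_space_torus_image[OF \<Lambda> T] col_space_def)
  hence "subtorus_dim d \<Lambda> (torus_image d \<Lambda> T) = rank T"
    by (simp add: subtorus_dim_def rank_def)
  thus ?thesis using rank_eq_0_iff[OF T] by simp
qed

section \<open>The generalized quaternion group\<close>

text \<open>\<open>n \<ge> 2\<close> keeps the exponents \<open>n - 1\<close> and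
  \<open>n - 2\<close> from being truncated, so that the first power of two is twice the
  second.\<close>

locale quaternion_group =
  fixes n :: nat and G :: "('g, 'm) monoid_scheme" (structure) and x y :: 'g
  assumes n: "n \<ge> 2" and quaternion: "generalized_quaternion n G x y"
begin

sublocale finite_group G
proof (rule finite_group.intro)
  show "group G" using quaternion by (simp add: generalized_quaternion_def)
  have "card (carrier G) \<noteq> 0" using quaternion by (simp add: generalized_quaternion_def)
  thus "finite_group_axioms G" by (simp add: finite_group_axioms_def card_eq_0_iff)
qed

abbreviation N :: nat where "N \<equiv> 2 ^ (n - 2)"

lemma two_N: "2 ^ (n - 1) = 2 * N" and four_N: "2 ^ n = 4 * N"
proof -
  obtain m where m: "n = m + 2" using n by (metis le_Suc_ex add.commute)
  show "2 ^ (n - 1) = 2 * N" "2 ^ n = 4 * N" by (simp_all add: m)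
qed

lemma N_pos: "N > 0" by simp

lemma xy_closed [simp]: "x \<in> carrier G" "y \<in> carrier G"
  using quaternion by (auto simp: generalized_quaternion_def)

definition z :: 'g where "z = x [^] N"

lemma z_closed [simp]: "z \<in> carrier G" by (simp add: z_def)

lemma x_pow_2N: "x [^] (2 * N) = \<one>"
  using quaternion two_N by (simp add: generalized_quaternion_def)

lemma z_squared [simp]: "z \<otimes> z = \<one>"
  using x_pow_2N by (simp add: z_def nat_pow_mult mult_2)

lemma x_pow_mod: "x [^] (i mod (2 * N)) = x [^] i"
proof -
  have "x [^] i = x [^] (2 * N * (i div (2 * N)) + i mod (2 * N))" by simp
  also have "\<dots> = (x [^] (2 * N)) [^] (i div (2 * N)) \<otimes> x [^] (i mod (2 * N))"
    by (simp only: nat_pow_mult[symmetric] nat_pow_pow xy_closed)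
  also have "\<dots> = x [^] (i mod (2 * N))" by (simp only: x_pow_2N nat_pow_one) simp
  finally show ?thesis ..
qed

lemma y_squared: "y \<otimes> y = z"
proof -
  have "(y \<otimes> y) \<otimes> z = \<one>"
    using quaternion by (simp add: generalized_quaternion_def z_def numeral_2_eq_2)
  hence "y \<otimes> y = inv z" by (simp add: inv_equality)
  also have "inv z = z" by (rule inv_equality) auto
  finally show ?thesis .
qed

lemma y_pow_2: "y [^] (2::nat) = z"
  using y_squared by (simp add: numeral_2_eq_2)

lemma y_x: "y \<otimes> x = inv x \<otimes> y"
proof -
  have "y \<otimes> x \<otimes> inv y \<otimes> x = \<one>"
    using quaternion by (simp add: generalized_quaternion_def)
  hence "inv x = y \<otimes> x \<otimes> inv y" by (simp add: inv_equality)
  thus ?thesis by (simp add: m_assoc)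
qed

text \<open>Writing the inverse as a natural power keeps all computations with normal forms in
  natural exponents.\<close>

lemma inv_x: "inv x = x [^] (2 * N - 1)"
proof (rule inv_equality)
  have "x [^] (2 * N - 1) \<otimes> x = x [^] Suc (2 * N - 1)" by (simp only: nat_pow_Suc)
  also have "Suc (2 * N - 1) = 2 * N" by simp
  finally show "x [^] (2 * N - 1) \<otimes> x = \<one>" by (simp only: x_pow_2N)
qed auto

lemma y_x_pow: "y \<otimes> x [^] i = x [^] ((2 * N - 1) * i) \<otimes> y"
proof (induction i)
  case (Suc i)
  have "y \<otimes> x [^] Suc i = (y \<otimes> x [^] i) \<otimes> x" by (simp add: m_assoc)
  also have "\<dots> = x [^] ((2 * N - 1) * i) \<otimes> (y \<otimes> x)" by (simp add: Suc m_assoc)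
  also have "\<dots> = x [^] ((2 * N - 1) * i) \<otimes> x [^] (2 * N - 1) \<otimes> y"
    by (simp add: y_x inv_x m_assoc)
  also have "x [^] ((2 * N - 1) * i) \<otimes> x [^] (2 * N - 1) = x [^] ((2 * N - 1) * Suc i)"
    by (simp only: nat_pow_mult xy_closed) (simp add: add.commute)
  finally show ?case .
qed simp

lemma mult_xx: "x [^] i \<otimes> x [^] j = x [^] (i + j :: nat)"
  by (simp add: nat_pow_mult)

lemma mult_xy: "x [^] i \<otimes> (x [^] j \<otimes> y) = x [^] (i + j :: nat) \<otimes> y"
  by (simp add: nat_pow_mult[symmetric] m_assoc)

lemma mult_yx: "(x [^] i \<otimes> y) \<otimes> x [^] j = x [^] (i + (2 * N - 1) * j) \<otimes> y"
  by (simp only: m_assoc y_x_pow nat_pow_closed xy_closed m_closed nat_pow_mult[symmetric])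

lemma mult_yy: "(x [^] i \<otimes> y) \<otimes> (x [^] j \<otimes> y) = x [^] (i + (2 * N - 1) * j + N)" for i j :: nat
proof -
  have "(x [^] i \<otimes> y) \<otimes> (x [^] j \<otimes> y) = ((x [^] i \<otimes> y) \<otimes> x [^] j) \<otimes> y"
    by (simp add: m_assoc)
  also have "\<dots> = x [^] (i + (2 * N - 1) * j) \<otimes> (y \<otimes> y)"
    by (simp only: mult_yx) (simp add: m_assoc)
  also have "\<dots> = x [^] (i + (2 * N - 1) * j + N)"
    by (simp only: y_squared z_def nat_pow_mult xy_closed)
  finally show ?thesis .
qed

lemma xy_squared: "(x [^] i \<otimes> y) \<otimes> (x [^] i \<otimes> y) = z" for i :: nat
proof -
  have "i + (2 * N - 1) * i = 2 * N * i"
    by (metis N_pos add.commute mult_Suc Suc_pred' nat_0_less_mult_iff pos2)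
  hence "x [^] (i + (2 * N - 1) * i + N) = (x [^] (2 * N)) [^] i \<otimes> z"
    by (simp only: z_def nat_pow_mult nat_pow_pow xy_closed)
  also have "\<dots> = z" by (simp only: x_pow_2N nat_pow_one l_one z_closed)
  finally show ?thesis by (simp only: mult_yy)
qed

text \<open>The normal forms are closed under products and inverses and contain both generators, so
  they exhaust the generated group.\<close>

lemma carrier_eq:
  "carrier G = (\<lambda>i. x [^] i) ` {..<2 * N} \<union> (\<lambda>i. x [^] i \<otimes> y) ` {..<2 * N}" (is "_ = ?A \<union> ?B")
proof
  have A: "x [^] i \<in> ?A" for i :: nat
    by (rule image_eqI[of _ _ "i mod (2 * N)"]) (simp_all add: x_pow_mod)
  have B: "x [^] i \<otimes> y \<in> ?B" for i :: nat
    by (rule image_eqI[of _ _ "i mod (2 * N)"]) (simp_all add: x_pow_mod)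
  have zy: "z \<otimes> y = y \<otimes> z"
    by (simp add: y_squared[symmetric] m_assoc)
  have "subgroup (?A \<union> ?B) G"
  proof (rule subgroupI)
    show "?A \<union> ?B \<subseteq> carrier G" by auto
    show "?A \<union> ?B \<noteq> {}" using A by blast
    fix g assume g: "g \<in> ?A \<union> ?B"
    show "inv g \<in> ?A \<union> ?B"
    proof (cases "g \<in> ?A")
      case True
      then obtain i :: nat where "g = x [^] i" by blast
      hence "inv g = x [^] ((2 * N - 1) * i)"
        by (simp only: nat_pow_inv[symmetric] inv_x nat_pow_pow xy_closed)
      thus ?thesis using A by simp
    next
      case False
      then obtain i :: nat where i: "g = x [^] i \<otimes> y" using g by blast
      \<comment> \<open>Such a \<open>g\<close> has square \<open>z\<close> by
        \<open>xy_squared\<close>, and \<open>z\<close> is its own inverse.\<close>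
      have "inv g = g \<otimes> z"
      proof (rule inv_equality)
        have "g \<otimes> z \<otimes> g = (g \<otimes> (z \<otimes> x [^] i)) \<otimes> y" by (simp add: i m_assoc)
        also have "z \<otimes> x [^] i = x [^] i \<otimes> z" by (simp add: z_def nat_pow_mult add.commute)
        also have "g \<otimes> (x [^] i \<otimes> z) \<otimes> y = (g \<otimes> g) \<otimes> z" by (simp add: i m_assoc zy)
        also have "\<dots> = \<one>" by (simp only: i xy_squared z_squared)
        finally show "g \<otimes> z \<otimes> g = \<one>" .
      qed (simp_all add: i)
      also have "\<dots> = x [^] (i + (2 * N - 1) * N) \<otimes> y" by (simp only: i z_def mult_yx)
      finally show ?thesis using B by simp
    qed
    fix h assume h: "h \<in> ?A \<union> ?B"
    show "g \<otimes> h \<in> ?A \<union> ?B"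
      using g h A B by (auto simp: mult_xx mult_xy mult_yx mult_yy)
  qed
  moreover have "{x, y} \<subseteq> ?A \<union> ?B"
    using A[of 1] B[of 0] by simp
  ultimately have "generate G {x, y} \<subseteq> ?A \<union> ?B"
    by (intro generate_subgroup_incl)
  thus "carrier G \<subseteq> ?A \<union> ?B"
    using quaternion by (simp add: generalized_quaternion_def)
qed auto

text \<open>Here the prescribed order enters: at most \<open>4 * N\<close> normal forms cover a
  group with exactly that many elements, so no two coincide.\<close>

lemma carrier_inj:
  shows inj_x_pow: "inj_on (\<lambda>i. x [^] i) {..<2 * N}"
    and inj_x_pow_y: "inj_on (\<lambda>i. x [^] i \<otimes> y) {..<2 * N}"
    and x_pow_disjoint: "(\<lambda>i. x [^] i) ` {..<2 * N} \<inter> (\<lambda>i. x [^] i \<otimes> y) ` {..<2 * N} = {}"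
      (is "?A \<inter> ?B = {}")
proof -
  have "card (?A \<union> ?B) = 4 * N"
    using quaternion four_N by (simp add: generalized_quaternion_def carrier_eq[symmetric])
  moreover have "card (?A \<union> ?B) + card (?A \<inter> ?B) = card ?A + card ?B"
    by (rule card_Un_Int[symmetric]) auto
  moreover have "card ?A \<le> 2 * N" "card ?B \<le> 2 * N"
    using card_image_le[of "{..<2 * N}"] by (metis card_lessThan finite_lessThan)+
  ultimately have "card ?A = 2 * N" "card ?B = 2 * N" "card (?A \<inter> ?B) = 0" by linarith+
  thus "inj_on (\<lambda>i. x [^] i) {..<2 * N}" "inj_on (\<lambda>i. x [^] i \<otimes> y) {..<2 * N}" "?A \<inter> ?B = {}"
    by (auto intro!: eq_card_imp_inj_on)
qed

lemma sum_carrier: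
  "(\<Sum>g\<in>carrier G. F g) = (\<Sum>i<2 * N. F (x [^] i)) + (\<Sum>i<2 * N. F (x [^] i \<otimes> y))"
proof -
  have "(\<Sum>g\<in>carrier G. F g) =
    sum F ((\<lambda>i. x [^] i) ` {..<2 * N}) + sum F ((\<lambda>i. x [^] i \<otimes> y) ` {..<2 * N})"
    unfolding carrier_eq by (rule sum.union_disjoint) (use x_pow_disjoint in auto)
  thus ?thesis by (simp only: sum.reindex[OF inj_x_pow] sum.reindex[OF inj_x_pow_y] o_def)
qed

lemma carrier_cases:
  assumes "g \<in> carrier G"
  obtains (x) i where "i < 2 * N" "g = x [^] i" | (xy) i where "i < 2 * N" "g = x [^] i \<otimes> y"
  using assms carrier_eq by blast

section \<open>The involution \<open>z\<close>\<close>

lemma z_not_one: "z \<noteq> \<one>"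
proof
  assume "z = \<one>"
  hence "x [^] N = x [^] (0::nat)" by (simp add: z_def)
  hence "N = 0" using inj_onD[OF inj_x_pow, of N 0] by simp
  thus False by simp
qed

lemma z_central:
  assumes "g \<in> carrier G"
  shows "z \<otimes> g = g \<otimes> z"
  using assms
proof (cases rule: carrier_cases)
  case (x i)
  thus ?thesis by (simp add: z_def nat_pow_mult add.commute)
next
  case (xy i)
  have "z \<otimes> (x [^] i \<otimes> y) = x [^] i \<otimes> (z \<otimes> y)"
    by (simp add: z_def nat_pow_mult m_assoc[symmetric] add.commute)
  also have "z \<otimes> y = y \<otimes> z" by (simp add: y_squared[symmetric] m_assoc)
  finally show ?thesis by (simp add: xy m_assoc)
qed

text \<open>For a power of \<open>x\<close>, divisibility of 2 i by 2 N leaves only i = N; an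
  element \<open>x [^] i \<otimes> y\<close> squares to \<open>z\<close>, which is not 1.\<close>

lemma unique_involution:
  assumes g: "g \<in> carrier G" "g \<noteq> \<one>" "g \<otimes> g = \<one>"
  shows "g = z"
  using g(1)
proof (cases rule: carrier_cases)
  case (x i)
  have eq: "x [^] ((2 * i) mod (2 * N)) = x [^] (0::nat)"
    using g(3) by (simp only: x_pow_mod) (simp add: x nat_pow_mult mult_2)
  have "(2 * i) mod (2 * N) = 0"
    using inj_onD[OF inj_x_pow eq] by simp
  hence "i mod N = 0" by simp
  moreover have "i \<noteq> 0" using g(2) x(2) by (metis nat_pow_0)
  ultimately have "i = N" using x(1) by (auto elim!: dvdE simp: mod_eq_0_iff_dvd)
  thus ?thesis by (simp add: x z_def)
next
  case (xy i)
  thus ?thesis using g(3) xy_squared z_not_one by simp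
qed

text \<open>The order of \<open>g\<close> is a power of two, so the last nontrivial term among its
  repeated squares is an involution.\<close>

lemma power_eq_z:
  assumes g: "g \<in> carrier G" "g \<noteq> \<one>"
  obtains k :: nat where "g [^] k = z"
proof -
  have ex: "\<exists>k. g [^] (2 ^ k :: nat) = \<one>"
    using g(1)
  proof (cases rule: carrier_cases)
    case (x i)
    have "(x [^] i) [^] (2 * N) = (x [^] (2 * N)) [^] i"
      by (simp only: nat_pow_pow xy_closed mult.commute)
    also have "\<dots> = \<one>" by (simp only: x_pow_2N nat_pow_one)
    finally have "g [^] (2 ^ (n - 1) :: nat) = \<one>" by (simp only: x(2) two_N)
    thus ?thesis ..
  next
    case (xy i)
    have "(g \<otimes> g) \<otimes> (g \<otimes> g) = \<one>" by (simp only: xy(2) xy_squared z_squared)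
    hence "g [^] (2 ^ 2 :: nat) = \<one>" using g(1) by (simp add: numeral_eq_Suc m_assoc)
    thus ?thesis ..
  qed
  define k where "k = (LEAST k. g [^] (2 ^ k :: nat) = \<one>)"
  have k: "g [^] (2 ^ k :: nat) = \<one>" unfolding k_def using ex by (rule LeastI_ex)
  have "k \<noteq> 0"
  proof
    assume "k = 0"
    hence "g [^] Suc 0 = \<one>" using k by simp
    thus False using g by simp
  qed
  then obtain j where j: "k = Suc j" using not0_implies_Suc by blast
  have "g [^] (2 ^ j :: nat) \<noteq> \<one>"
    using not_less_Least[of j "\<lambda>k. g [^] (2 ^ k :: nat) = \<one>"] j by (simp add: k_def)
  moreover have "g [^] (2 ^ j :: nat) \<otimes> g [^] (2 ^ j :: nat) = \<one>"
    using k g(1) by (simp add: j nat_pow_mult mult_2)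
  ultimately have "g [^] (2 ^ j :: nat) = z" using unique_involution g(1) by simp
  thus ?thesis using that by blast
qed

lemma generate_y_squared: "generate G {y [^] (2::nat)} = {\<one>, z}"
proof -
  have "generate G {z} = {\<one>, z}"
  proof
    have "subgroup {\<one>, z} G"
      by (rule subgroupI) (auto intro: inv_equality)
    thus "generate G {z} \<subseteq> {\<one>, z}" by (intro generate_subgroup_incl) auto
    show "{\<one>, z} \<subseteq> generate G {z}" by (auto intro: generate.one generate.incl)
  qed
  thus ?thesis by (simp add: y_pow_2)
qed

end

lemma sum_lessThan_add: "(\<Sum>i<m + k. f i) = (\<Sum>i<m. f i) + (\<Sum>i<k. f (m + i))"
  for f :: "nat \<Rightarrow> 'a::comm_monoid_add"
  by (induction k) (simp_all add: add.assoc)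

text \<open>Both the coefficients and the powers of \<omega> change sign after 2^m steps, so the two
  halves of the sum are equal and independence applies to the first. The sign rule carries the zeros
  to all indices.\<close>

lemma antiperiodic_sum_eq_0:
  fixes c :: "nat \<Rightarrow> rat" and \<omega> :: complex
  assumes \<omega>: "\<omega> ^ (2 ^ m) = - 1"
    and anti: "\<And>i. c (2 ^ m + i) = - c i"
    and sum: "(\<Sum>i<2 * 2 ^ m. of_rat (c i) * \<omega> ^ i) = 0"
  shows "c i = 0"
proof -
  have "of_rat (c (2 ^ m + i)) * \<omega> ^ (2 ^ m + i) = of_rat (c i) * \<omega> ^ i" for i
    by (simp only: anti power_add \<omega> of_rat_minus) simp
  hence "(\<Sum>i<2 * 2 ^ m. of_rat (c i) * \<omega> ^ i) = 2 * (\<Sum>i<2 ^ m. of_rat (c i) * \<omega> ^ i)"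
    by (simp only: mult_2 sum_lessThan_add)
  hence zero: "(\<Sum>i<2 ^ m. of_rat (c i) * \<omega> ^ i) = 0" using sum by simp
  have "c (i mod 2 ^ m + 2 ^ m * k) = 0" for k
  proof (induction k)
    case 0
    have "c (i mod 2 ^ m) = 0"
      by (rule root_unity_powers_independent[OF \<omega> zero]) simp
    thus ?case by simp
  next
    case (Suc k)
    thus ?case using anti[of "i mod 2 ^ m + 2 ^ m * k"] by (simp add: add_ac)
  qed
  from this[of "i div 2 ^ m"] show ?thesis by simp
qed

lemma mat2_mult:
  fixes a :: "'a::semiring_0"
  shows "mat_of_rows_list 2 [[a, b], [c, d]] * mat_of_rows_list 2 [[a', b'], [c', d']] =
    mat_of_rows_list 2 [[a * a' + b * c', a * b' + b * d'], [c * a' + d * c', c * b' + d * d']]"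
  by (auto intro!: eq_matI simp: mat_of_rows_list_def scalar_prod_def numeral_2_eq_2 less_Suc_eq)

section \<open>The part of the group algebra on which \<open>z\<close> acts as -1\<close>

context quaternion_group
begin

text \<open>The idempotent (1 - z)/2, the unit of the subalgebra on which \<open>z\<close> acts as
  -1.\<close>

definition \<epsilon> :: "'g \<Rightarrow> rat" where
  "\<epsilon> = (\<lambda>g. (1 / 2) * (single \<one> - single z) g)"

lemma \<epsilon>_in_QG [simp]: "\<epsilon> \<in> QG"
  unfolding \<epsilon>_def by (intro QG_scale QG_diff single_in_QG) auto

lemma z_conv_eq:
  assumes "g \<in> carrier G"
  shows "(single z \<star> \<alpha>) g = \<alpha> (z \<otimes> g)"
proof -
  have "inv z = z" by (rule inv_equality) auto
  thus ?thesis using assms by (simp add: single_conv)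
qed

lemma z_conv_\<epsilon>: "single z \<star> \<epsilon> = 0 - \<epsilon>"
  unfolding \<epsilon>_def conv_scale_right conv_diff_right
  by (simp only: single_mult z_closed one_closed z_squared r_one) (auto simp: fun_eq_iff field_simps)

context
  fixes \<theta> :: "'g \<Rightarrow> complex mat" and \<omega> :: complex
  assumes \<theta>: "matrix_rep G 2 \<theta>"
    and \<theta>_x: "\<theta> x = mat_of_rows_list 2 [[\<omega>, 0], [0, cnj \<omega>]]"
    and \<theta>_y: "\<theta> y = mat_of_rows_list 2 [[0, - 1], [1, 0]]"
    and \<omega>: "\<omega> ^ N = - 1"
begin

lemma \<theta>_x_pow: "\<theta> (x [^] i) = mat_of_rows_list 2 [[\<omega> ^ i, 0], [0, cnj \<omega> ^ i]]"
proof (induction i)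
  case 0
  show ?case
    using matrix_rep_one[OF \<theta>]
    by (auto intro!: eq_matI simp: mat_of_rows_list_def numeral_2_eq_2 less_Suc_eq)
next
  case (Suc i)
  thus ?case
    using matrix_rep_mult[OF \<theta>, of "x [^] i" x] by (simp add: \<theta>_x mat2_mult mult.commute)
qed

lemma \<theta>_x_pow_y: "\<theta> (x [^] i \<otimes> y) = mat_of_rows_list 2 [[0, - (\<omega> ^ i)], [cnj \<omega> ^ i, 0]]" for i :: nat
  using matrix_rep_mult[OF \<theta>, of "x [^] i" y] by (simp add: \<theta>_x_pow \<theta>_y mat2_mult)

text \<open>Together with \<open>cb\<close>, the complex coordinates of the quaternion attached to
  \<alpha>: the powers of \<open>x\<close> contribute to one, their products with \<open>y\<close>
  to the other.\<close>

definition ca :: "('g \<Rightarrow> rat) \<Rightarrow> complex" where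
  "ca \<alpha> = (\<Sum>i<2 * N. of_rat (\<alpha> (x [^] i)) * \<omega> ^ i)"

definition cb :: "('g \<Rightarrow> rat) \<Rightarrow> complex" where
  "cb \<alpha> = (\<Sum>i<2 * N. of_rat (\<alpha> (x [^] i \<otimes> y)) * \<omega> ^ i)"

lemma algebra_rep_\<theta>:
  "algebra_rep G 2 \<theta> \<alpha> = mat_of_rows_list 2 [[ca \<alpha>, - cb \<alpha>], [cnj (cb \<alpha>), cnj (ca \<alpha>)]]"
proof (rule eq_matI)
  \<comment> \<open>Rational coefficients are real, so conjugation passes through the sums and
    yields the second row.\<close>
  have cnj_rat: "cnj (of_rat q) = of_rat q" for q
    by (cases q rule: Rat_cases) (simp add: Fract_of_int_quotient of_rat_divide)
  fix i j
  assume "i < dim_row (mat_of_rows_list 2 [[ca \<alpha>, - cb \<alpha>], [cnj (cb \<alpha>), cnj (ca \<alpha>)]])"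
    "j < dim_col (mat_of_rows_list 2 [[ca \<alpha>, - cb \<alpha>], [cnj (cb \<alpha>), cnj (ca \<alpha>)]])"
  hence "i < 2" "j < 2" by (auto simp: mat_of_rows_list_def)
  thus "algebra_rep G 2 \<theta> \<alpha> $$ (i, j) =
    mat_of_rows_list 2 [[ca \<alpha>, - cb \<alpha>], [cnj (cb \<alpha>), cnj (ca \<alpha>)]] $$ (i, j)"
    by (auto simp: algebra_rep_index sum_carrier \<theta>_x_pow \<theta>_x_pow_y ca_def cb_def
        mat_of_rows_list_def less_2_cases_iff cnj_rat sum_negf)
qed (auto simp: mat_of_rows_list_def)

text \<open>Shifting the exponent of \<open>x\<close> by \<open>N\<close> multiplies by
  \<open>z\<close>, so both coefficient sequences are antiperiodic and the powers of \<omega> can be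
  used as independent. Thus \<theta> is injective on this part.\<close>

lemma minus_component_eq_0:
  assumes \<alpha>: "\<alpha> \<in> QG" "single z \<star> \<alpha> = 0 - \<alpha>" and 0: "ca \<alpha> = 0" "cb \<alpha> = 0"
  shows "\<alpha> = 0"
proof -
  have anti: "\<alpha> (z \<otimes> g) = - \<alpha> g" if "g \<in> carrier G" for g
    using z_conv_eq[OF that, of \<alpha>] by (simp add: \<alpha>(2))
  have "\<alpha> (x [^] i) = 0" for i :: nat
  proof (rule antiperiodic_sum_eq_0[OF \<omega>])
    show "\<alpha> (x [^] (N + i)) = - \<alpha> (x [^] i)" for i
      using anti[of "x [^] i"] by (simp add: z_def nat_pow_mult)
    show "(\<Sum>i<2 * N. of_rat (\<alpha> (x [^] i)) * \<omega> ^ i) = 0" using 0(1) by (simp add: ca_def)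
  qed
  moreover have "\<alpha> (x [^] i \<otimes> y) = 0" for i :: nat
  proof (rule antiperiodic_sum_eq_0[OF \<omega>])
    show "\<alpha> (x [^] (N + i) \<otimes> y) = - \<alpha> (x [^] i \<otimes> y)" for i
      using anti[of "x [^] i \<otimes> y"] by (simp add: z_def nat_pow_mult m_assoc[symmetric])
    show "(\<Sum>i<2 * N. of_rat (\<alpha> (x [^] i \<otimes> y)) * \<omega> ^ i) = 0" using 0(2) by (simp add: cb_def)
  qed
  ultimately show ?thesis
    by (intro QG_ext[OF \<alpha>(1) QG_0]) (erule carrier_cases, simp_all)
qed

text \<open>
  The values of \<open>\<theta>\<close> on the group algebra are matrices of quaternions, for which the determinant
  is \<open>\<bar>a\<bar>\<^sup>2 + \<bar>b\<bar>\<^sup>2\<close>, so the minus component of the group algebra is a division algebra.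
\<close>
lemma minus_component_idempotent:
  assumes f: "f \<in> QG" "single z \<star> f = 0 - f" "f \<star> f = f"
  shows "f = 0 \<or> f = \<epsilon>"
proof -
  define a b where "a = ca f" and "b = cb f"
  define M where "M = mat_of_rows_list 2 [[a, - b], [cnj b, cnj a]]"
  have M: "algebra_rep G 2 \<theta> f = M" by (simp add: algebra_rep_\<theta> M_def a_def b_def)
  have "M * M = M" using algebra_rep_conv[OF \<theta>, of f f] by (simp add: M f(3))
  moreover have "(M * M) $$ (0, 0) = a * a + (- b) * cnj b"
    "(M * M) $$ (0, 1) = a * (- b) + (- b) * cnj a"
    unfolding M_def mat2_mult by (simp_all add: mat_of_rows_list_def)
  moreover have "M $$ (0, 0) = a" "M $$ (0, 1) = - b"
    unfolding M_def by (simp_all add: mat_of_rows_list_def)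
  ultimately have e1: "a * a + (- b) * cnj b = a" and "a * (- b) + (- b) * cnj a = - b"
    by metis+
  moreover have "a * (- b) + (- b) * cnj a = - (b * (a + cnj a))"
    by (simp add: distrib_left mult.commute)
  ultimately have e2: "b * (a + cnj a) = b" by (metis neg_equal_iff_equal)
  have b: "b = 0"
  proof (rule ccontr)
    assume "b \<noteq> 0"
    \<comment> \<open>A nonzero \<open>b\<close> forces trace 1, and then \<open>e1\<close> says
      that the determinant vanishes.\<close>
    hence "a + cnj a = 1" using e2 by (metis mult_cancel_left mult.right_neutral)
    hence "cnj a = 1 - a" by (metis add_diff_cancel_left')
    hence "a * cnj a = a - a * a" by (simp add: right_diff_distrib)
    hence "a * cnj a + b * cnj b = a - (a * a + (- b) * cnj b)" by simp
    hence "a * cnj a + b * cnj b = 0" unfolding e1 by simp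
    hence "complex_of_real ((cmod a)\<^sup>2 + (cmod b)\<^sup>2) = 0"
      by (simp only: of_real_add complex_norm_square)
    hence "(cmod a)\<^sup>2 + (cmod b)\<^sup>2 = 0" by (simp only: of_real_eq_0_iff)
    thus False using \<open>b \<noteq> 0\<close> by (simp add: sum_power2_eq_zero_iff)
  qed
  hence "a * (a - 1) = 0" using e1 by (simp add: right_diff_distrib)
  then consider "a = 0" | "a = 1" by auto
  thus ?thesis
  proof cases
    case 1
    have "f = 0"
      by (rule minus_component_eq_0[OF f(1,2) 1[unfolded a_def] b[unfolded b_def]])
    thus ?thesis ..
  next
    case 2
    \<comment> \<open>Now \<open>f\<close> and \<epsilon> have the same image under \<theta>, and
      injectivity on the minus part identifies them.\<close>
    have "cnj \<omega> ^ N = - 1" using arg_cong[OF \<omega>, of cnj] by simp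
    hence \<theta>z: "\<theta> z = mat_of_rows_list 2 [[- 1, 0], [0, - 1]]"
      by (simp only: z_def \<theta>_x_pow \<omega>)
    have "algebra_rep G 2 \<theta> \<epsilon> = of_rat (1 / 2) \<cdot>\<^sub>m (1\<^sub>m 2 - \<theta> z)"
      unfolding \<epsilon>_def algebra_rep_scale algebra_rep_diff algebra_rep_one[OF \<theta>]
        algebra_rep_single[OF \<theta> z_closed] ..
    moreover have "ca \<epsilon> = algebra_rep G 2 \<theta> \<epsilon> $$ (0, 0)" "cb \<epsilon> = - algebra_rep G 2 \<theta> \<epsilon> $$ (0, 1)"
      by (simp_all add: algebra_rep_\<theta> mat_of_rows_list_def)
    ultimately have \<epsilon>: "ca \<epsilon> = 1" "cb \<epsilon> = 0"
      by (simp_all add: \<theta>z mat_of_rows_list_def of_rat_divide)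
    have diff: "(f - \<epsilon>) g = f g - \<epsilon> g" for g by simp
    have "ca (f - \<epsilon>) = ca f - ca \<epsilon>" "cb (f - \<epsilon>) = cb f - cb \<epsilon>"
      by (simp_all only: ca_def cb_def diff of_rat_diff left_diff_distrib sum_subtractf)
    hence "ca (f - \<epsilon>) = 0" "cb (f - \<epsilon>) = 0"
      using 2 b by (simp_all only: \<epsilon> a_def b_def) simp_all
    moreover have "single z \<star> (f - \<epsilon>) = 0 - (f - \<epsilon>)"
      unfolding conv_diff_right f(2) z_conv_\<epsilon> by (rule ext) simp
    moreover have "f - \<epsilon> \<in> QG" using f(1) \<epsilon>_in_QG by (rule QG_diff)
    ultimately have "f - \<epsilon> = 0" by (intro minus_component_eq_0)
    thus ?thesis by (simp only: right_minus_eq simp_thms)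
  qed
qed

end
end

section \<open>Triviality of a group algebra decomposition\<close>

context quaternion_group
begin

text \<open>Vanishing of a factor is rephrased as vanishing of \<rho> on one primitive idempotent.
  By \<open>minus_idem\<close>, every component with \<open>z\<close> acting as -1 has \<epsilon> as
  this idempotent, so there can be only one such component.\<close>

lemma trivial_decomposition_iff:
  fixes \<rho> :: "'g \<Rightarrow> complex mat" and D :: "'g gad"
  assumes decomp: "group_algebra_decomposition d \<Lambda> G \<rho> D" and \<Lambda>: "lattice d \<Lambda>"
    and \<rho>: "matrix_rep G d \<rho>" and \<rho>z: "\<rho> z \<noteq> 1\<^sub>m d"
    and minus_idem: "\<And>f. f \<in> QG \<Longrightarrow> single z \<star> f = 0 - f \<Longrightarrow> f \<star> f = f \<Longrightarrow> f = 0 \<or> f = \<epsilon>"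
  shows "trivial_decomposition d \<Lambda> D \<longleftrightarrow> \<rho> z = - 1\<^sub>m d"
proof -
  let ?I = "{1..irrep_count D}" and ?R = "algebra_rep G d \<rho>"
  have irreps: "rational_irreps G D" and idems: "group_algebra_idempotents G D"
    using decomp by (auto simp: group_algebra_decomposition_def)
  have "\<forall>l\<in>?I. \<exists>k\<in>{1..multiplicity D l}. \<exists>m::nat. m > 0 \<and>
    subvariety D l = torus_image d \<Lambda> (?R (\<lambda>g. of_nat m * primitive_idem D l k g))"
    using decomp unfolding group_algebra_decomposition_def Let_def by blast
  then obtain k where k: "\<And>l. l \<in> ?I \<Longrightarrow> k l \<in> {1..multiplicity D l}"
    and sub: "\<And>l. l \<in> ?I \<Longrightarrow> \<exists>m::nat. m > 0 \<and>
    subvariety D l = torus_image d \<Lambda> (?R (\<lambda>g. of_nat m * primitive_idem D l (k l) g))"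
    by metis
  define f where "f l = primitive_idem D l (k l)" for l
  note f = primitive_idem_props[OF irreps idems _ k, folded f_def]
  have factor: "factor_dim d \<Lambda> D l \<noteq> 0 \<longleftrightarrow> ?R (f l) \<noteq> 0\<^sub>m d d" if l: "l \<in> ?I" for l
  proof -
    obtain m :: nat where m: "m > 0" "subvariety D l = torus_image d \<Lambda> (?R (\<lambda>g. of_nat m * f l g))"
      using sub[OF l] by (auto simp: f_def)
    \<comment> \<open>\<open>k l\<close> is a valid index, so the multiplicity is positive and only
      the dimension of the subvariety can vanish.\<close>
    have "factor_dim d \<Lambda> D l \<noteq> 0 \<longleftrightarrow> ?R (\<lambda>g. of_nat m * f l g) \<noteq> 0\<^sub>m d d"
      using k[OF l] subtorus_dim_torus_image_eq_0_iff[OF \<Lambda>, of "?R (\<lambda>g. of_nat m * f l g)"]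
      by (simp add: factor_dim_def m(2))
    also have "?R (\<lambda>g. of_nat m * f l g) = of_nat m \<cdot>\<^sub>m ?R (f l)"
      by (simp add: algebra_rep_scale)
    also have "\<dots> \<noteq> 0\<^sub>m d d \<longleftrightarrow> ?R (f l) \<noteq> 0\<^sub>m d d"
      using m(1) by (auto simp: mat_eq_iff)
    finally show ?thesis .
  qed
  have trivial: "trivial_decomposition d \<Lambda> D \<longleftrightarrow> (\<exists>!l. l \<in> ?I \<and> ?R (f l) \<noteq> 0\<^sub>m d d)"
    unfolding trivial_decomposition_def using factor by metis
  have Wz: "irrep D l z = 1\<^sub>m (irrep_deg D l) \<or> irrep D l z = - 1\<^sub>m (irrep_deg D l)" if "l \<in> ?I" for l
    by (rule schur_central_involution[OF irrep_irreducible[OF irreps idems that]])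
      (simp_all add: z_central)
  have f_minus: "f l = \<epsilon>" if l: "l \<in> ?I" and "irrep D l z = - 1\<^sub>m (irrep_deg D l)" for l
    using minus_idem[OF f(1)[OF l l] component_scalar(2)[OF irreps idems l z_closed f(1)[OF l l] f(4)[OF l l] that(2)]
      f(3)[OF l l]] f(2)[OF l l] by blast
  have \<rho>_carrier: "\<rho> z \<in> carrier_mat d d" by (rule matrix_rep_carrier[OF \<rho> z_closed])
  have R_z: "?R (single z \<star> \<alpha>) = \<rho> z * ?R \<alpha>" for \<alpha>
    by (simp only: algebra_rep_conv[OF \<rho>] algebra_rep_single[OF \<rho> z_closed])
  show ?thesis
    unfolding trivial
  proof
    assume "\<exists>!l. l \<in> ?I \<and> ?R (f l) \<noteq> 0\<^sub>m d d"
    then obtain l where l: "l \<in> ?I" and others: "\<And>m. m \<in> ?I - {l} \<Longrightarrow> ?R (f m) = 0\<^sub>m d d"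
      by blast
    \<comment> \<open>Once these are killed, \<open>central_idem D l\<close> acts as the identity,
      so \<rho> inherits the sign by which \<open>z\<close> acts on that component.\<close>
    have "?R (central_idem D m) = 0\<^sub>m d d" if "m \<in> ?I - {l}" for m
    proof -
      have m: "m \<in> ?I" using that by simp
      show ?thesis
        by (rule algebra_rep_component_eq_0[OF \<rho> central_idem_in_QG[OF irreps idems m]
            central_idem_central[OF irreps idems m] irrep_irreducible[OF irreps idems m]
            component_separate[OF irreps idems m] central_idem_idem[OF irreps idems m]
            f(1)[OF m m] f(2)[OF m m] f(4)[OF m m] others[OF that]])
    qed
    hence "?R (\<Sum>m\<in>?I - {l}. central_idem D m) = 0\<^sub>m d d"
      by (rule algebra_rep_sum_eq_0)
    moreover have "single \<one> = central_idem D l + (\<Sum>m\<in>?I - {l}. central_idem D m)"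
      unfolding sum_central_idem[OF irreps idems, symmetric] using l by (intro sum.remove) auto
    ultimately have "?R (single \<one>) = ?R (central_idem D l) + 0\<^sub>m d d"
      by (simp only: algebra_rep_add)
    hence Re: "?R (central_idem D l) = 1\<^sub>m d"
      by (simp only: algebra_rep_one[OF \<rho>] right_add_zero_mat[OF algebra_rep_carrier])
    note scalar = component_scalar[OF irreps idems l z_closed central_idem_in_QG[OF irreps idems l]
        central_idem_idem[OF irreps idems l]]
    from Wz[OF l] show "\<rho> z = - 1\<^sub>m d"
    proof
      assume "irrep D l z = 1\<^sub>m (irrep_deg D l)"
      hence "\<rho> z * ?R (central_idem D l) = ?R (central_idem D l)"
        using scalar(1) R_z[of "central_idem D l"] by (simp only:)
      hence "\<rho> z = 1\<^sub>m d" by (simp only: Re right_mult_one_mat[OF \<rho>_carrier])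
      thus ?thesis using \<rho>z by simp
    next
      assume "irrep D l z = - 1\<^sub>m (irrep_deg D l)"
      hence "\<rho> z * ?R (central_idem D l) = 0\<^sub>m d d - ?R (central_idem D l)"
        using scalar(2) R_z[of "central_idem D l"] by (simp only: algebra_rep_diff algebra_rep_zero)
      hence "\<rho> z = 0\<^sub>m d d - 1\<^sub>m d" by (simp only: Re right_mult_one_mat[OF \<rho>_carrier])
      thus ?thesis by (auto intro!: eq_matI)
    qed
  next
    assume z: "\<rho> z = - 1\<^sub>m d"
    \<comment> \<open>\<rho> sends \<epsilon> to the identity matrix. It is nonzero because d = 0
      would make 1 and -1 equal, against \<open>\<rho>z\<close>.\<close>
    have R\<epsilon>: "?R \<epsilon> \<noteq> 0\<^sub>m d d"
    proof
      assume "?R \<epsilon> = 0\<^sub>m d d"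
      moreover have "?R \<epsilon> = of_rat (1 / 2) \<cdot>\<^sub>m (1\<^sub>m d - \<rho> z)"
        unfolding \<epsilon>_def algebra_rep_scale algebra_rep_diff algebra_rep_one[OF \<rho>]
          algebra_rep_single[OF \<rho> z_closed] ..
      hence "?R \<epsilon> = 1\<^sub>m d" unfolding z by (auto intro!: eq_matI simp: of_rat_divide)
      ultimately show False using \<rho>z z by (auto simp: mat_eq_iff)
    qed
    \<comment> \<open>If \<open>z\<close> acted as 1 in every rational irreducible representation,
      separation would give z = 1 in the group.\<close>
    have "\<exists>l\<in>?I. irrep D l z \<noteq> 1\<^sub>m (irrep_deg D l)"
    proof (rule ccontr)
      assume "\<not> ?thesis"
      hence one: "\<And>l. l \<in> ?I \<Longrightarrow> irrep D l z = 1\<^sub>m (irrep_deg D l)" by blast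
      have "single z - single \<one> = 0"
      proof (rule irreps_separate[OF irreps idems])
        show "single z - single \<one> \<in> QG" by (intro QG_diff single_in_QG) auto
        fix m assume m: "m \<in> ?I"
        note rep = irrep_rep[OF irreps idems m]
        show "algebra_rep G (irrep_deg D m) (irrep D m) (single z - single \<one>) =
          0\<^sub>m (irrep_deg D m) (irrep_deg D m)"
          by (simp only: algebra_rep_diff algebra_rep_single[OF rep z_closed] algebra_rep_one[OF rep]
              one[OF m]) auto
      qed
      hence "single z z = single \<one> z" by (simp only: right_minus_eq)
      thus False using z_not_one by (simp add: single_def)
    qed
    then obtain l where l: "l \<in> ?I" "irrep D l z = - 1\<^sub>m (irrep_deg D l)" using Wz by blast
    show "\<exists>!l. l \<in> ?I \<and> ?R (f l) \<noteq> 0\<^sub>m d d"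
    proof (rule ex1I[of _ l])
      show "l \<in> ?I \<and> ?R (f l) \<noteq> 0\<^sub>m d d" using l R\<epsilon> f_minus[OF l] by simp
      fix m assume "m \<in> ?I \<and> ?R (f m) \<noteq> 0\<^sub>m d d"
      hence m: "m \<in> ?I" and nz: "?R (f m) \<noteq> 0\<^sub>m d d" by auto
      have "irrep D m z \<noteq> 1\<^sub>m (irrep_deg D m)"
      proof
        assume "irrep D m z = 1\<^sub>m (irrep_deg D m)"
        hence "single z \<star> f m = f m"
          by (rule component_scalar(1)[OF irreps idems m z_closed f(1)[OF m m] f(4)[OF m m]])
        hence "?R (f m) = \<rho> z * ?R (f m)" using R_z[of "f m"] by (simp only:)
        also have "\<dots> = - ?R (f m)" unfolding z by (simp add: uminus_mult_left_mat)
        finally show False using double_eq_0_mat[OF algebra_rep_carrier] nz by blast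
      qed
      \<comment> \<open>Both idempotents are \<epsilon>. If \<open>m\<close> differed from
        \<open>l\<close>, the \<open>l\<close>-th representation would kill this common nonzero
        element of its own component.\<close>
      hence eq: "f m = f l" using f_minus[OF l] f_minus[OF m] Wz[OF m] by simp
      show "m = l"
      proof (rule ccontr)
        assume "m \<noteq> l"
        let ?W = "algebra_rep G (irrep_deg D l) (irrep D l)"
        have "?W (f m) = ?W (central_idem D m \<star> f m)" by (simp only: f(4)[OF m m])
        also have "\<dots> = 0\<^sub>m (irrep_deg D l) (irrep_deg D l)"
          using \<open>m \<noteq> l\<close>
          by (simp add: algebra_rep_conv[OF irrep_rep[OF irreps idems l(1)]] irrep_central_idem[OF irreps idems m l(1)])
        finally have "f l = 0"
          using component_separate[OF irreps idems l(1) f(1)[OF l(1) l(1)] f(4)[OF l(1) l(1)]]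
          by (simp only: eq)
        thus False using f(2)[OF l(1) l(1)] by simp
      qed
    qed
  qed
qed

end

section \<open>Equivalence of the conditions\<close>

text \<open>The diagonal blocks are compared entrywise, one block at a time; \<open>dim_row\<close>
  supplies their sizes, which vary along the list.\<close>

lemma diag_block_mat_eq_minus_one:
  fixes Ms :: "'a::comm_ring_1 mat list"
  assumes "\<And>M. M \<in> set Ms \<Longrightarrow> square_mat M"
  shows "diag_block_mat Ms = - 1\<^sub>m (dim_row (diag_block_mat Ms)) \<longleftrightarrow>
    (\<forall>M\<in>set Ms. M = - 1\<^sub>m (dim_row M))"
  using assms
proof (induction Ms)
  case Nil
  show ?case by auto
next
  case (Cons A Ms)
  let ?B = "diag_block_mat Ms"
  define a b where "a = dim_row A" and "b = dim_row ?B"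
  have A: "A \<in> carrier_mat a a" using Cons.prems[of A] by (auto simp: a_def)
  have "square_mat ?B" using Cons.prems by (intro diag_block_mat_square) auto
  hence B: "?B \<in> carrier_mat b b" by (auto simp: b_def)
  have AB: "diag_block_mat (A # Ms) = four_block_mat A (0\<^sub>m a b) (0\<^sub>m b a) ?B"
    using A B by (simp add: Let_def)
  have dim: "dim_row (diag_block_mat (A # Ms)) = a + b" using A B unfolding AB by simp
  have "four_block_mat A (0\<^sub>m a b) (0\<^sub>m b a) ?B = - 1\<^sub>m (a + b) \<longleftrightarrow> A = - 1\<^sub>m a \<and> ?B = - 1\<^sub>m b"
  proof
    assume eq: "four_block_mat A (0\<^sub>m a b) (0\<^sub>m b a) ?B = - 1\<^sub>m (a + b)"
    have "A = - 1\<^sub>m a"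
    proof (rule eq_matI)
      fix i j assume "i < dim_row (- 1\<^sub>m a :: 'a mat)" "j < dim_col (- 1\<^sub>m a :: 'a mat)"
      thus "A $$ (i, j) = (- 1\<^sub>m a) $$ (i, j)"
        using arg_cong[OF eq, of "\<lambda>M. M $$ (i, j)"] A B by simp
    qed (use A in auto)
    moreover have "?B = - 1\<^sub>m b"
    proof (rule eq_matI)
      fix i j assume "i < dim_row (- 1\<^sub>m b :: 'a mat)" "j < dim_col (- 1\<^sub>m b :: 'a mat)"
      thus "?B $$ (i, j) = (- 1\<^sub>m b) $$ (i, j)"
        using arg_cong[OF eq, of "\<lambda>M. M $$ (a + i, a + j)"] A B by simp
    qed (use B in auto)
    ultimately show "A = - 1\<^sub>m a \<and> ?B = - 1\<^sub>m b" ..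
  next
    assume eq: "A = - 1\<^sub>m a \<and> ?B = - 1\<^sub>m b"
    show "four_block_mat A (0\<^sub>m a b) (0\<^sub>m b a) ?B = - 1\<^sub>m (a + b)"
      unfolding conjunct1[OF eq] conjunct2[OF eq] by (rule eq_matI) auto
  qed
  also have "?B = - 1\<^sub>m b \<longleftrightarrow> (\<forall>M\<in>set Ms. M = - 1\<^sub>m (dim_row M))"
    unfolding b_def using Cons.prems by (intro Cons.IH) auto
  finally show ?case unfolding dim AB[symmetric] by (simp add: a_def)
qed

text \<open>Conjugation fixes scalar matrices; one direction suffices because similarity is
  symmetric.\<close>

lemma similar_mat_wit_minus_one:
  fixes A :: "'a::comm_ring_1 mat"
  assumes "similar_mat_wit A B P Q"
  shows "A = - 1\<^sub>m (dim_row A) \<longleftrightarrow> B = - 1\<^sub>m (dim_row B)"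
proof -
  have *: "C = - 1\<^sub>m (dim_row C)" if sim: "similar_mat_wit C D P Q" and D: "D = - 1\<^sub>m (dim_row D)"
    for C D P Q :: "'a mat"
  proof -
    define n where "n = dim_row C"
    note wit = similar_mat_witD[OF n_def sim]
    have "P * (- 1\<^sub>m n) = - P" using wit(6) by simp
    moreover have "- P * Q = - (P * Q)" using wit(6,7) by simp
    moreover have "D = - 1\<^sub>m n" using D carrier_matD(1)[OF wit(5)] by (simp only:)
    ultimately have "P * D * Q = - 1\<^sub>m n" by (simp only: wit(1))
    hence "C = - 1\<^sub>m n" by (simp only: wit(3)[symmetric])
    thus ?thesis by (simp only: n_def)
  qed
  show ?thesis using *[OF assms] *[OF similar_mat_wit_sym[OF assms]] by blast
qed

section \<open>Reading off the multiplicities at \<open>z\<close>\<close>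

context quaternion_group
begin

text \<open>As \<open>z\<close> is the square of \<open>y\<close>, the images of \<open>y\<close>
  decide: a sign squares to 1, and the matrix of \<open>\<Theta> s\<close> at \<open>y\<close>
  squares to a scalar.\<close>

lemma irreps_at_z:
  assumes irreps: "quaternion_irreps n G x y \<chi> \<Theta>"
  shows "j \<in> {1..4} \<Longrightarrow> \<chi> j z = 1\<^sub>m 1"
    and "s \<in> {1..2 ^ (n - 2) - 1} \<Longrightarrow> \<Theta> s z = (- 1) ^ s \<cdot>\<^sub>m 1\<^sub>m 2"
proof -
  show "\<chi> j z = 1\<^sub>m 1" if j: "j \<in> {1..4}"
  proof -
    have rep: "matrix_rep G 1 (\<chi> j)"
      using irreps j unfolding quaternion_irreps_def by blast
    have "j = 1 \<or> j = 2 \<or> j = 3 \<or> j = 4" using j by auto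
    hence "\<chi> j y = mat_of_rows_list 1 [[1]] \<or> \<chi> j y = mat_of_rows_list 1 [[- 1]]"
      using irreps unfolding quaternion_irreps_def by blast
    hence "\<chi> j y * \<chi> j y = 1\<^sub>m 1"
      by (auto intro!: eq_matI simp: mat_of_rows_list_def scalar_prod_def)
    thus ?thesis
      using matrix_rep_mult[OF rep, of y y] by (simp only: y_squared xy_closed)
  qed
  show "\<Theta> s z = (- 1) ^ s \<cdot>\<^sub>m 1\<^sub>m 2" if s: "s \<in> {1..2 ^ (n - 2) - 1}"
  proof -
    have rep: "matrix_rep G 2 (\<Theta> s)" and y: "\<Theta> s y = mat_of_rows_list 2 [[0, (- 1) ^ s], [1, 0]]"
      using irreps s unfolding quaternion_irreps_def Let_def by blast+
    have "\<Theta> s y * \<Theta> s y = mat_of_rows_list 2 [[(- 1) ^ s, 0], [0, (- 1) ^ s]]"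
      unfolding y mat2_mult by simp
    also have "\<dots> = (- 1) ^ s \<cdot>\<^sub>m 1\<^sub>m 2"
      by (auto intro!: eq_matI simp: mat_of_rows_list_def numeral_2_eq_2 less_Suc_eq)
    finally show ?thesis
      using matrix_rep_mult[OF rep, of y y] by (simp only: y_squared xy_closed)
  qed
qed

text \<open>Blocks of multiplicity zero are absent from the sum. Among those present, a \<chi> block
  is 1 and never -1, and a \<Theta> block is -1 just for odd \<open>s\<close>.\<close>

lemma rep_sum_at_z:
  fixes a b :: "nat \<Rightarrow> nat"
  assumes irreps: "quaternion_irreps n G x y \<chi> \<Theta>"
  defines "\<sigma> \<equiv> quaternion_rep_sum n \<chi> \<Theta> a b z"
  shows "\<sigma> = - 1\<^sub>m (dim_row \<sigma>) \<longleftrightarrow>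
    (\<forall>i\<in>{1..4}. a i = 0) \<and> (\<forall>s\<in>{1..2 ^ (n - 2) - 1}. even s \<longrightarrow> b s = 0)"
proof -
  note at_z = irreps_at_z[OF irreps]
  let ?Ms = "concat (map (\<lambda>j. replicate (a j) (\<chi> j z)) [1..<5]) @
    concat (map (\<lambda>s. replicate (b s) (\<Theta> s z)) [1..<2 ^ (n - 2)])"
  have set: "set ?Ms = {\<chi> j z | j. j \<in> {1..4} \<and> a j \<noteq> 0} \<union>
    {\<Theta> s z | s. s \<in> {1..2 ^ (n - 2) - 1} \<and> b s \<noteq> 0}"
  proof -
    have "s < 2 ^ (n - 2) \<longleftrightarrow> s \<le> 2 ^ (n - 2) - 1" for s :: nat
      using N_pos by linarith
    moreover have "j < 5 \<longleftrightarrow> j \<le> 4" for j :: nat by linarith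
    ultimately show ?thesis by (auto simp: set_replicate_conv_if split: if_splits)
  qed
  have neg1: "(1\<^sub>m 1 :: complex mat) \<noteq> - 1\<^sub>m (dim_row (1\<^sub>m 1 :: complex mat))"
    by (auto simp: mat_eq_iff)
  have neg2: "((- 1) ^ s \<cdot>\<^sub>m 1\<^sub>m 2 :: complex mat) = - 1\<^sub>m (dim_row ((- 1) ^ s \<cdot>\<^sub>m 1\<^sub>m 2 :: complex mat)) \<longleftrightarrow> odd s"
    for s :: nat
    by (cases "even s") (auto simp: mat_eq_iff intro: exI[of _ "0::nat"])
  have "\<sigma> = - 1\<^sub>m (dim_row \<sigma>) \<longleftrightarrow> (\<forall>M\<in>set ?Ms. M = - 1\<^sub>m (dim_row M))"
    unfolding \<sigma>_def quaternion_rep_sum_def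
    by (rule diag_block_mat_eq_minus_one) (auto simp only: set at_z, auto simp: at_z)
  also have "\<dots> \<longleftrightarrow> (\<forall>j\<in>{1..4}. a j \<noteq> 0 \<longrightarrow> \<chi> j z = - 1\<^sub>m (dim_row (\<chi> j z))) \<and>
    (\<forall>s\<in>{1..2 ^ (n - 2) - 1}. b s \<noteq> 0 \<longrightarrow> \<Theta> s z = - 1\<^sub>m (dim_row (\<Theta> s z)))"
    unfolding set by blast
  also have "\<dots> \<longleftrightarrow> (\<forall>i\<in>{1..4}. a i = 0) \<and> (\<forall>s\<in>{1..2 ^ (n - 2) - 1}. even s \<longrightarrow> b s = 0)"
  proof -
    have "(a j \<noteq> 0 \<longrightarrow> \<chi> j z = - 1\<^sub>m (dim_row (\<chi> j z))) \<longleftrightarrow> a j = 0" if "j \<in> {1..4}" for j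
      using at_z(1)[OF that] neg1 by metis
    moreover have "(b s \<noteq> 0 \<longrightarrow> \<Theta> s z = - 1\<^sub>m (dim_row (\<Theta> s z))) \<longleftrightarrow> (even s \<longrightarrow> b s = 0)"
      if "s \<in> {1..2 ^ (n - 2) - 1}" for s
      using at_z(2)[OF that] neg2[of s] by metis
    ultimately show ?thesis by blast
  qed
  finally show ?thesis .
qed

section \<open>Fixed vectors of elements and subgroups\<close>

context
  fixes d :: nat and \<rho> :: "'g \<Rightarrow> complex mat"
  assumes \<rho>: "matrix_rep G d \<rho>"
begin

lemma fixed_by_power:
  assumes "g \<in> carrier G" "v \<in> carrier_vec d" "\<rho> g *\<^sub>v v = v"
  shows "\<rho> (g [^] (k::nat)) *\<^sub>v v = v"
proof (induction k)
  case 0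
  show ?case using assms(2) by (simp add: matrix_rep_one[OF \<rho>])
next
  case (Suc k)
  have "\<rho> (g [^] Suc k) *\<^sub>v v = \<rho> (g [^] k) *\<^sub>v (\<rho> g *\<^sub>v v)"
    using assms matrix_rep_mult[OF \<rho>, of "g [^] k" g]
      assoc_mult_mat_vec[OF matrix_rep_carrier[OF \<rho>, of "g [^] k"] matrix_rep_carrier[OF \<rho>, of g]]
    by simp
  thus ?case by (simp only: assms(3) Suc.IH)
qed

text \<open>A vector fixed by \<open>g\<close> is fixed by its power \<open>z\<close>, which negates
  it.\<close>

lemma no_eigenvalue_one_if_minus_one:
  assumes z: "\<rho> z = - 1\<^sub>m d" and g: "g \<in> carrier G" "g \<noteq> \<one>"
  shows "\<not> eigenvalue (\<rho> g) 1"
proof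
  assume "eigenvalue (\<rho> g) 1"
  then obtain v where v: "v \<in> carrier_vec d" "v \<noteq> 0\<^sub>v d" "\<rho> g *\<^sub>v v = v"
    using matrix_rep_carrier[OF \<rho> g(1)] by (auto simp: eigenvalue_def eigenvector_def)
  obtain k :: nat where "g [^] k = z" using power_eq_z[OF g] .
  hence "- 1\<^sub>m d *\<^sub>v v = v" using fixed_by_power[OF g(1) v(1,3), of k] z by simp
  hence "- v = v" using v(1) by simp
  have "v = 0\<^sub>v d"
  proof (rule eq_vecI)
    fix i assume "i < dim_vec (0\<^sub>v d :: complex vec)"
    hence i: "i < d" by simp
    have "(- v) $ i = v $ i" by (simp only: \<open>- v = v\<close>)
    thus "v $ i = 0\<^sub>v d $ i" using v(1) i by (simp add: neg_eq_iff_add_eq_0)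
  qed (use v in simp)
  thus False using v(2) by simp
qed

text \<open>A nontrivial element of \<open>K\<close> is absorbed by the sum over \<open>K\<close>,
  so it fixes every vector in the image.\<close>

lemma subgroup_sum_eq_0_if_no_eigenvalue_one:
  assumes K: "subgroup K G" "K \<noteq> {\<one>}"
    and eig: "\<And>g. g \<in> carrier G \<Longrightarrow> g \<noteq> \<one> \<Longrightarrow> \<not> eigenvalue (\<rho> g) 1"
  shows "algebra_rep G d \<rho> (subgroup_sum K) = 0\<^sub>m d d"
proof -
  interpret K: subgroup K G by (rule K(1))
  obtain k where k: "k \<in> K" "k \<noteq> \<one>" using K.one_closed K(2) by blast
  have kG: "k \<in> carrier G" using k by simp
  have "single k \<star> subgroup_sum K = subgroup_sum K"
  proof (rule QG_ext)
    show "subgroup_sum K \<in> QG" using K.subset by (auto simp: QG_iff subgroup_sum_def)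
    fix g assume g: "g \<in> carrier G"
    have "inv k \<otimes> g \<in> K \<longleftrightarrow> g \<in> K"
    proof
      assume "inv k \<otimes> g \<in> K"
      hence "k \<otimes> (inv k \<otimes> g) \<in> K" using k by simp
      thus "g \<in> K" using kG g by (simp add: m_assoc[symmetric])
    qed (use k in auto)
    thus "(single k \<star> subgroup_sum K) g = subgroup_sum K g"
      using kG g by (simp add: single_conv subgroup_sum_def)
  qed simp
  hence eq: "\<rho> k * algebra_rep G d \<rho> (subgroup_sum K) = algebra_rep G d \<rho> (subgroup_sum K)"
    by (metis algebra_rep_conv[OF \<rho>] algebra_rep_single[OF \<rho> kG])
  show ?thesis
  proof (rule mat_eqI_mult_vec)
    fix v :: "complex vec" assume v: "v \<in> carrier_vec d"
    define w where "w = algebra_rep G d \<rho> (subgroup_sum K) *\<^sub>v v"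
    have w: "w \<in> carrier_vec d"
      unfolding w_def by (rule mult_mat_vec_carrier[OF algebra_rep_carrier v])
    have "\<rho> k *\<^sub>v w = w"
      unfolding w_def
      using assoc_mult_mat_vec[OF matrix_rep_carrier[OF \<rho> kG] algebra_rep_carrier v] eq by metis
    hence "w = 0\<^sub>v d"
      using eig[OF kG k(2)] w matrix_rep_carrier[OF \<rho> kG]
      by (auto simp: eigenvalue_def eigenvector_def)
    also have "0\<^sub>v d = 0\<^sub>m d d *\<^sub>v v" using v by (intro eq_vecI) auto
    finally show "algebra_rep G d \<rho> (subgroup_sum K) *\<^sub>v v = 0\<^sub>m d d *\<^sub>v v" by (simp only: w_def)
  qed auto
qed

text \<open>The sum over this subgroup is 1 + z.\<close>

lemma center_sum_eq_0_iff:
  "algebra_rep G d \<rho> (subgroup_sum {\<one>, z}) = 0\<^sub>m d d \<longleftrightarrow> \<rho> z = - 1\<^sub>m d"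
proof -
  have "subgroup_sum {\<one>, z} = single \<one> + single z"
    using z_not_one by (auto simp: fun_eq_iff subgroup_sum_def single_def)
  hence "algebra_rep G d \<rho> (subgroup_sum {\<one>, z}) = 1\<^sub>m d + \<rho> z"
    by (simp only: algebra_rep_add algebra_rep_one[OF \<rho>] algebra_rep_single[OF \<rho> z_closed])
  thus ?thesis
    using matrix_rep_carrier[OF \<rho> z_closed] by (auto simp: mat_eq_iff add_eq_0_iff)
qed

end

text \<open>An identity lift would make \<open>\<phi> z\<close> equal to
  \<open>\<phi> \<one>\<close>, against injectivity of the action, because \<open>z\<close> is not
  1.\<close>

lemma faithful_z:
  assumes action: "faithful_action G (carrier (complex_torus d \<Lambda>)) \<phi>"
    and rep: "analytic_rep d \<Lambda> G \<phi> \<rho>"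
  shows "\<rho> z \<noteq> 1\<^sub>m d"
proof
  assume z: "\<rho> z = 1\<^sub>m d"
  interpret faithful_action G "carrier (complex_torus d \<Lambda>)" \<phi> by (rule action)
  have one: "\<rho> \<one> = 1\<^sub>m d" using rep by (simp add: analytic_rep_def matrix_rep_def)
  have "\<phi> z = \<phi> \<one>"
  proof
    fix E
    show "\<phi> z E = \<phi> \<one> E"
    proof (cases "E \<in> carrier (complex_torus d \<Lambda>)")
      case True
      then obtain v where v: "v \<in> carrier_vec d" "E = torus_proj d \<Lambda> v"
        by (auto simp: complex_torus_def FactGroup_def RCOSETS_def torus_proj_def module_vec_simps)
      have "\<phi> g (torus_proj d \<Lambda> v) = torus_proj d \<Lambda> (\<rho> g *\<^sub>v v)" if "g \<in> carrier G" for g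
        using rep that v(1) by (simp add: analytic_rep_def)
      thus ?thesis by (simp only: v(2) z one z_closed one_closed)
    next
      case False
      \<comment> \<open>Off the carrier both maps take the same default value, since members of
        \<open>Bij\<close> are extensional.\<close>
      have "\<phi> g \<in> extensional (carrier (complex_torus d \<Lambda>))" if "g \<in> carrier G" for g
        using bij_prop0[OF that] by (simp add: Bij_def)
      thus ?thesis using False by (simp add: extensional_def)
    qed
  qed
  thus False using z_not_one inj_onD[OF faithful _ z_closed one_closed] by simp
qed

end

text \<open>Condition 1 is compared with condition 2 for each decomposition \<open>D\<close>
  separately, so triviality is also seen to be independent of \<open>D\<close>.\<close>

theorem theorem2:
  fixes n d :: nat
    and \<Lambda> :: "complex vec set"
    and G :: "'g monoid"
    and x y :: 'g
    and \<phi> :: "'g \<Rightarrow> complex vec set \<Rightarrow> complex vec set"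
    and \<rho> :: "'g \<Rightarrow> complex mat"
    and \<chi> \<Theta> :: "nat \<Rightarrow> 'g \<Rightarrow> complex mat"
    and a b :: "nat \<Rightarrow> nat"
  assumes "n \<ge> 4"
    and "abelian_variety d \<Lambda>"
    and "generalized_quaternion n G x y"
    and "faithful_action G (carrier (complex_torus d \<Lambda>)) \<phi>"
    and "analytic_rep d \<Lambda> G \<phi> \<rho>"
    and "quaternion_irreps n G x y \<chi> \<Theta>"
    and "rep_equiv G \<rho> (quaternion_rep_sum n \<chi> \<Theta> a b)"
  shows
    "let dim_zero = (\<lambda>K. subtorus_dim d \<Lambda> (fixed_image d \<Lambda> G \<rho> K) = 0);
         S1 = (\<lambda>D. trivial_decomposition d \<Lambda> D);
         S2 = dim_zero (generate G {y [^]\<^bsub>G\<^esub> (2::nat)});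
         S3 = (\<forall>K. subgroup K G \<and> K \<noteq> {\<one>\<^bsub>G\<^esub>} \<longrightarrow> dim_zero K);
         S4 = ((\<forall>i\<in>{1..4}. a i = 0) \<and> (\<forall>s\<in>{1..2 ^ (n - 2) - 1}. even s \<longrightarrow> b s = 0));
         S5 = (\<forall>g\<in>carrier G. g \<noteq> \<one>\<^bsub>G\<^esub> \<longrightarrow> \<not> eigenvalue (\<rho> g) 1)
     in (\<forall>D. group_algebra_decomposition d \<Lambda> G \<rho> D \<longrightarrow> (S1 D \<longleftrightarrow> S2)) \<and>
        (S2 \<longleftrightarrow> S3) \<and> (S3 \<longleftrightarrow> S4) \<and> (S4 \<longleftrightarrow> S5)"
proof -
  interpret quaternion_group n G x y
    by unfold_locales (use assms(1,3) in simp_all)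
  have \<Lambda>: "lattice d \<Lambda>" using assms(2) by (simp add: abelian_variety_def)
  have \<rho>: "matrix_rep G d \<rho>" using assms(5) by (simp add: analytic_rep_def)
  have \<rho>z: "\<rho> z \<noteq> 1\<^sub>m d" by (rule faithful_z[OF assms(4,5)])
  let ?\<omega> = "exp (2 * complex_of_real pi * \<i> / 2 ^ (n - 1))"
  \<comment> \<open>This puts 1 into the index range of \<Theta>; \<Theta>_1 is the representation
    that embeds the minus part into the quaternions.\<close>
  have "2 ^ (n - 2) > (1::nat)" using assms(1) by (intro one_less_power) auto
  hence "1 \<in> {1..2 ^ (n - 2) - 1 :: nat}" by simp
  hence \<Theta>1: "matrix_rep G 2 (\<Theta> 1)" "\<Theta> 1 x = mat_of_rows_list 2 [[?\<omega> ^ 1, 0], [0, (cnj ?\<omega>) ^ 1]]"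
    "\<Theta> 1 y = mat_of_rows_list 2 [[0, (- 1) ^ 1], [1, 0]]"
    using assms(6) unfolding quaternion_irreps_def Let_def by blast+
  have \<omega>: "?\<omega> ^ N = - 1"
  proof -
    have "?\<omega> ^ N = exp (of_nat N * (2 * complex_of_real pi * \<i> / 2 ^ (n - 1)))"
      by (rule exp_of_nat_mult[symmetric])
    also have "of_nat N * (2 * complex_of_real pi * \<i> / 2 ^ (n - 1)) = complex_of_real pi * \<i>"
    proof -
      have "(2::complex) ^ (n - 1) = 2 * of_nat N"
        using arg_cong[OF two_N, of "of_nat :: nat \<Rightarrow> complex"] by simp
      thus ?thesis by simp
    qed
    finally show ?thesis by (simp add: exp_pi_i)
  qed
  have dim_zero: "subtorus_dim d \<Lambda> (fixed_image d \<Lambda> G \<rho> K) = 0 \<longleftrightarrow>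
    algebra_rep G d \<rho> (subgroup_sum K) = 0\<^sub>m d d" for K
    unfolding fixed_image_def by (rule subtorus_dim_torus_image_eq_0_iff[OF \<Lambda> algebra_rep_carrier])
  define S1 where "S1 D \<longleftrightarrow> trivial_decomposition d \<Lambda> D" for D :: "'g gad"
  define S2 where "S2 \<longleftrightarrow> subtorus_dim d \<Lambda> (fixed_image d \<Lambda> G \<rho> (generate G {y [^]\<^bsub>G\<^esub> (2::nat)})) = 0"
  define S3 where "S3 \<longleftrightarrow> (\<forall>K. subgroup K G \<and> K \<noteq> {\<one>\<^bsub>G\<^esub>} \<longrightarrow>
    subtorus_dim d \<Lambda> (fixed_image d \<Lambda> G \<rho> K) = 0)"
  define S4 where "S4 \<longleftrightarrow> (\<forall>i\<in>{1..4}. a i = 0) \<and> (\<forall>s\<in>{1..2 ^ (n - 2) - 1}. even s \<longrightarrow> b s = 0)"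
  define S5 where "S5 \<longleftrightarrow> (\<forall>g\<in>carrier G. g \<noteq> \<one>\<^bsub>G\<^esub> \<longrightarrow> \<not> eigenvalue (\<rho> g) 1)"
  have S2: "S2 \<longleftrightarrow> \<rho> z = - 1\<^sub>m d"
    unfolding S2_def dim_zero generate_y_squared by (rule center_sum_eq_0_iff[OF \<rho>])
  have S1: "S1 D \<longleftrightarrow> S2" if "group_algebra_decomposition d \<Lambda> G \<rho> D" for D
    unfolding S1_def S2
    by (rule trivial_decomposition_iff[OF that \<Lambda> \<rho> \<rho>z],
        rule minus_component_idempotent[OF \<Theta>1[unfolded power_one_right] \<omega>])
  \<comment> \<open>Conditions 2, 5 and 3 imply one another in a cycle; 1 and 4 are each compared
    with 2.\<close>
  have S5: "S5" if S2
    using no_eigenvalue_one_if_minus_one[OF \<rho>] that unfolding S2 S5_def by blast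
  have S3: "S3" if S5
    using subgroup_sum_eq_0_if_no_eigenvalue_one[OF \<rho>] that unfolding S3_def S5_def dim_zero by blast
  have S2': "S2" if S3
  proof -
    have "subgroup (generate G {y [^]\<^bsub>G\<^esub> (2::nat)}) G"
      by (rule generate_is_subgroup) simp
    moreover have "generate G {y [^]\<^bsub>G\<^esub> (2::nat)} \<noteq> {\<one>\<^bsub>G\<^esub>}"
      unfolding generate_y_squared using z_not_one by blast
    ultimately show ?thesis using that unfolding S2_def S3_def by blast
  qed
  have S4: "S4 \<longleftrightarrow> S2"
  proof -
    \<comment> \<open>The equivalence of representations is evaluated at the single element
      \<open>z\<close>, where both sides can be compared with -1.\<close>
    obtain P Q where PQ: "similar_mat_wit (\<rho> z) (quaternion_rep_sum n \<chi> \<Theta> a b z) P Q"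
      using assms(7) z_closed unfolding rep_equiv_def by blast
    have "dim_row (\<rho> z) = d" using matrix_rep_carrier[OF \<rho> z_closed] by simp
    thus ?thesis
      using similar_mat_wit_minus_one[OF PQ] rep_sum_at_z[OF assms(6), of a b]
      unfolding S2 S4_def by simp
  qed
  have "(\<forall>D. group_algebra_decomposition d \<Lambda> G \<rho> D \<longrightarrow> (S1 D \<longleftrightarrow> S2)) \<and>
    (S2 \<longleftrightarrow> S3) \<and> (S3 \<longleftrightarrow> S4) \<and> (S4 \<longleftrightarrow> S5)"
    using S1 S5 S3 S2' S4 by blast
  thus ?thesis unfolding Let_def S1_def S2_def S3_def S4_def S5_def .
qed

end
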